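(* Let $\mathbb K$ be an algebraically closed field of characteristic zero and $R=\mathbb K[x_1,\ldots,x_n]$. Let $f\in R$ be a weighted homogeneous polynomial of (standard) degree $d$ and with rational weights $a_1,\ldots,a_n$. Denote by $G:={\rm cone}(f)\in R[t]$ the cone over $f$, and let $F=\frac{G}{t}$. If the ideal $I_F=\langle F_{x_1},\ldots,F_{x_n}\rangle$ of $R[t]$ is a perfect ideal of codimension $2$, then the gradient ideal $J_G$ of $G$ is perfect.
   Context: A polynomial $f\in\mathbb K[x_1,\ldots,x_n]$ is weighted homogeneous with rational weights $a_1,\dots,a_n$ ($0<a_i\le\frac12$) if $f(s^{a_1}x_1,\ldots,s^{a_n}x_n)=s\,f(x_1,\ldots,x_n)$; equivalently $f=\sum_i a_ix_if_{x_i}$. For a polynomial $f\in R$ of degree $d$, not homogeneous in the standard grading, with homogenization $F=t^df(x_1/t,\ldots,x_n/t)\in R[t]$ with respect to a new variable $t$, the cone over $f$ is the homogeneous polynomial ${\rm cone}(f):=tF$. The gradient ideal $J_G\subset R[t]$ is generated by the partial derivatives of $G$ with respect to $x_1,\ldots,x_n,t$. A homogeneous ideal $J$ in a polynomial ring $S$ is perfect if $S/J$ is Cohen–Macaulay. Subscripts denote partial derivatives. *)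

theory Defs
  imports
    "HOL-Library.Poly_Mapping"
    "HOL-Library.Extended_Nat"
    "HOL-Algebra.Algebra"
    "HOL-Algebra.Algebraic_Closure_Type"
begin

section \<open>Polynomials in finitely many variables\<close>

text \<open>
  A monomial is its exponent vector, and multiplication is the convolution product of
  \<^theory>\<open>HOL-Library.Poly_Mapping\<close>. If the variables
  \<open>x\<^sub>1, \<dots>, x\<^sub>n\<close> of \<open>R\<close> are indexed by a finite type \<open>'n\<close>, those of \<open>R[t]\<close> are indexed by
  \<open>'n option\<close>: \<open>Some i\<close> stands for \<open>x\<^sub>i\<close> and \<open>None\<close> for \<open>t\<close>.
\<close>

type_synonym ('x, 'k) mpoly = "('x \<Rightarrow>\<^sub>0 nat) \<Rightarrow>\<^sub>0 'k"

definition Const :: "'k::zero \<Rightarrow> ('x, 'k) mpoly"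
  where "Const c = Poly_Mapping.single 0 c"

definition Var :: "'x \<Rightarrow> ('x, 'k::zero_neq_one) mpoly"
  where "Var x = Poly_Mapping.single (Poly_Mapping.single x 1) 1"

definition mon_degree :: "('x::finite \<Rightarrow>\<^sub>0 nat) \<Rightarrow> nat"
  where "mon_degree m = (\<Sum>x\<in>UNIV. Poly_Mapping.lookup m x)"

text \<open>The zero polynomial gets degree 0; it is homogeneous in the sense below.\<close>

definition total_degree :: "('x::finite, 'k::zero) mpoly \<Rightarrow> nat"
  where "total_degree f = Max (insert 0 (mon_degree ` Poly_Mapping.keys f))"

definition homogeneous :: "('x::finite, 'k::zero) mpoly \<Rightarrow> bool"
  where "homogeneous f \<longleftrightarrow> (\<exists>d. \<forall>m\<in>Poly_Mapping.keys f. mon_degree m = d)"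

definition partial_deriv :: "'x \<Rightarrow> ('x, 'k::comm_ring_1) mpoly \<Rightarrow> ('x, 'k) mpoly"
  where "partial_deriv x f = (\<Sum>m\<in>Poly_Mapping.keys f.
    Poly_Mapping.single (m - Poly_Mapping.single x 1)
      (of_nat (Poly_Mapping.lookup m x) * Poly_Mapping.lookup f m))"

text \<open>Substitution of \<open>v x\<close> for every variable \<open>x\<close>, the coefficients being mapped by \<open>c\<close>.\<close>

definition subst_vars ::
    "('k::zero \<Rightarrow> 'b::comm_ring_1) \<Rightarrow> ('x::finite \<Rightarrow> 'b) \<Rightarrow> ('x, 'k) mpoly \<Rightarrow> 'b"
  where "subst_vars c v f = (\<Sum>m\<in>Poly_Mapping.keys f.
    c (Poly_Mapping.lookup f m) * (\<Prod>x\<in>UNIV. v x ^ Poly_Mapping.lookup m x))"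

text \<open>
  The identity \<open>f (s\<^bsup>a\<^sub>1\<^esup> x\<^sub>1, \<dots>, s\<^bsup>a\<^sub>n\<^esup> x\<^sub>n) = s f\<close> is an identity in the ring of
  polynomials in a formal \<open>s\<close> with rational exponents and coefficients in \<open>R\<close>, that is,
  in \<^typ>\<open>rat \<Rightarrow>\<^sub>0 ('x, 'k::comm_ring_1) mpoly\<close>; \<open>Poly_Mapping.single q p\<close> is \<open>s\<^bsup>q\<^esup> p\<close>.
\<close>

definition weighted_homogeneous ::
    "('x::finite \<Rightarrow> rat) \<Rightarrow> ('x, 'k::comm_ring_1) mpoly \<Rightarrow> bool"
  where "weighted_homogeneous a f \<longleftrightarrow>
    (\<forall>x. 0 < a x \<and> a x \<le> 1 / 2) \<and>
    subst_vars (\<lambda>c. Poly_Mapping.single 0 (Const c))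
      (\<lambda>x. Poly_Mapping.single (a x) (Var x)) f = Poly_Mapping.single 1 f"

text \<open>
  \<open>t\<^bsup>d\<^esup> f (x\<^sub>1/t, \<dots>, x\<^sub>n/t)\<close> with \<open>d\<close> the degree of \<open>f\<close>, expanded monomial by monomial.
  The subtraction of exponents does not truncate.
\<close>

definition homogenization :: "('x::finite, 'k::comm_ring_1) mpoly \<Rightarrow> ('x option, 'k) mpoly"
  where "homogenization f = (\<Sum>m\<in>Poly_Mapping.keys f.
    Const (Poly_Mapping.lookup f m) * (\<Prod>x\<in>UNIV. Var (Some x) ^ Poly_Mapping.lookup m x)
      * Var None ^ (total_degree f - mon_degree m))"

definition cone :: "('x::finite, 'k::comm_ring_1) mpoly \<Rightarrow> ('x option, 'k) mpoly"
  where "cone f = Var None * homogenization f"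

abbreviation polynomial_ring :: "('x, 'k::comm_ring_1) mpoly ring"
  where "polynomial_ring == ring_of_type_algebra"

definition gradient_ideal :: "('x, 'k::comm_ring_1) mpoly \<Rightarrow> ('x, 'k) mpoly set"
  where "gradient_ideal G =
    genideal polynomial_ring (range (\<lambda>x. partial_deriv x G))"


section \<open>Codimension, depth and Cohen--Macaulay rings\<close>

definition prime_height :: "('a, 'b) ring_scheme \<Rightarrow> 'a set \<Rightarrow> enat"
  where "prime_height R P = Sup {enat k | k. \<exists>Q :: nat \<Rightarrow> 'a set.
    (\<forall>i\<le>k. primeideal (Q i) R) \<and> (\<forall>i<k. Q i \<subset> Q (Suc i)) \<and> Q k = P}"

text \<open>The unit ideal has codimension \<open>\<infinity>\<close>.\<close>

definition codimension :: "('a, 'b) ring_scheme \<Rightarrow> 'a set \<Rightarrow> enat"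
  where "codimension R I = Inf {prime_height R P | P. primeideal P R \<and> I \<subseteq> P}"

text \<open>
  The last condition says that each \<open>xs ! i\<close> is a nonzerodivisor modulo the ideal
  generated by the preceding entries.
\<close>

definition regular_sequence :: "('a, 'b) ring_scheme \<Rightarrow> 'a list \<Rightarrow> bool"
  where "regular_sequence R xs \<longleftrightarrow>
    set xs \<subseteq> carrier R \<and> genideal R (set xs) \<noteq> carrier R \<and>
    (\<forall>i<length xs. \<forall>y\<in>carrier R.
      xs ! i \<otimes>\<^bsub>R\<^esub> y \<in> genideal R (set (take i xs)) \<longrightarrow> y \<in> genideal R (set (take i xs)))"

definition ideal_depth :: "('a, 'b) ring_scheme \<Rightarrow> 'a set \<Rightarrow> enat"
  where "ideal_depth R I = Sup {enat (length xs) | xs. regular_sequence R xs \<and> set xs \<subseteq> I}"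

text \<open>
  Eisenbud's form of the definition (Commutative Algebra, Section 18.2), which needs no
  localization: a Noetherian ring in which depth and codimension agree for every
  maximal ideal.
\<close>

definition cohen_macaulay :: "('a, 'b) ring_scheme \<Rightarrow> bool"
  where "cohen_macaulay R \<longleftrightarrow> cring R \<and> noetherian_ring R \<and>
    (\<forall>P. maximalideal P R \<longrightarrow> ideal_depth R P = codimension R P)"

definition perfect_ideal :: "('a, 'b) ring_scheme \<Rightarrow> 'a set \<Rightarrow> bool"
  where "perfect_ideal R J \<longleftrightarrow> cohen_macaulay (R Quot J)"

end

theory Submission
  imports Defs
begin

text \<open>
  Write \<open>A = R[t]\<close>, \<open>I = I\<^sub>F\<close>, \<open>H = G\<^sub>t = F + t F\<^sub>t\<close> and \<open>J = J\<^sub>G\<close>. As \<open>F = \<Sum>\<^sub>i a\<^sub>i x\<^sub>i F\<^bsub>x\<^sub>i\<^esub>\<close>, Euler's formula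
  gives \<open>H \<in> I\<close>, and \<open>J = t I + (H)\<close> since \<open>G\<^bsub>x\<^sub>i\<^esub> = t F\<^bsub>x\<^sub>i\<^esub>\<close>. The variable \<open>t\<close> does not divide \<open>H\<close>, because
  \<open>H\<close> modulo \<open>t\<close> is the leading form of \<open>f\<close>. Hence \<open>J : t = I\<close> and \<open>J + (t) = (t, H)\<close>, so \<open>A/J\<close> is an extension
  of the complete intersection \<open>A/(t, H)\<close> by \<open>A/I\<close>. With \<open>N = n + 1\<close>, both have depth at least \<open>N - 2\<close> at
  the origin, and generic linear forms are regular on both, hence on \<open>A/J\<close>. Since \<open>J\<close> is homogeneous, the
  translates of these linear forms are regular as well, which gives depth at least \<open>N - 2\<close> at
  every maximal ideal, by the Nullstellensatz. All primes containing \<open>J\<close> have height at least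
  \<open>2\<close>, so chains of primes over \<open>J\<close> have length at most \<open>N - 2\<close>.

  Dimensions are measured by the growth of the number of linearly independent residue classes of
  degree at most \<open>d\<close>: a prime chain of length \<open>k\<close> raises the exponent of growth by \<open>k\<close>.
\<close>

text \<open>Perfection of \<open>I\<close> is used at the origin only: there the depth of A/I equals
  the height s of the irrelevant ideal over \<open>I\<close>. A system of s linear parameters bounds
  the growth of A/I by s, while a prime of height 2 over \<open>I\<close> forces growth N - 2; hence
  s is at least N - 2. This comparison is what growth is introduced for: heights are accessible only
  through chains.

  The obstacle is that \<open>cohen_macaulay\<close> quantifies over all maximal ideals, whereas
  socles and linear forms control the depth of an extension at the origin alone. The passage is by
  degree: a linear form minus a constant has that linear form as its leading form, and regularity on
  leading forms lifts to the ideal itself. At a maximal ideal the constants are the values of the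
  linear forms at its point. There depth and height are squeezed: a regular sequence yields a prime
  chain of equal length, and every chain over J has length at most N - 2.

  Exchange of regular elements and avoidance of primes stand in for localization, Ext and the
  principal ideal theorem.\<close>

abbreviation "lookup \<equiv> Poly_Mapping.lookup"
abbreviation "single \<equiv> Poly_Mapping.single"
abbreviation "keys \<equiv> Poly_Mapping.keys"

section \<open>Ideals and regular sequences\<close>

interpretation idl: Modules.module "(*) :: 'a::comm_ring_1 \<Rightarrow> 'a \<Rightarrow> 'a"
  by unfold_locales (simp_all add: algebra_simps)

text \<open>Scalar multiplication is the ring multiplication here, so these rules loop with associativity
  or duplicate distributivity.\<close>

declare idl.scale_scale [simp del] idl.scale_one [simp del] idl.scale_right_distrib [algebra_simps del, algebra_split_simps del]
  idl.scale_left_distrib [algebra_simps del, algebra_split_simps del]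

definition prime_idl :: "'a::comm_ring_1 set \<Rightarrow> bool"
  where "prime_idl P \<longleftrightarrow> idl.subspace P \<and> 1 \<notin> P \<and> (\<forall>a b. a * b \<in> P \<longrightarrow> a \<in> P \<or> b \<in> P)"

text \<open>Membership is spelled out with a witness, which keeps the computations with ideals
  elementary; \<open>idl_add_eq_span\<close> is the link to generated ideals.\<close>

definition idl_add :: "'a::comm_ring_1 \<Rightarrow> 'a set \<Rightarrow> 'a set"
  where "idl_add z K = {x. \<exists>k. x - k * z \<in> K}"

lemma idl_addI: "x - k * z \<in> K \<Longrightarrow> x \<in> idl_add z K"
  by (auto simp: idl_add_def)

definition regular_mod :: "'a::comm_ring_1 set \<Rightarrow> 'a \<Rightarrow> bool"
  where "regular_mod K z \<longleftrightarrow> (\<forall>u. z * u \<in> K \<longrightarrow> u \<in> K)"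

text \<open>Unlike \<open>regular_sequence\<close> this does not demand that the generated ideal be
  proper; where that matters, properness comes from a prime containing all entries.\<close>

fun regs :: "'a::comm_ring_1 set \<Rightarrow> 'a list \<Rightarrow> bool" where
  "regs K [] \<longleftrightarrow> True"
| "regs K (z # zs) \<longleftrightarrow> regular_mod K z \<and> regs (idl_add z K) zs"

definition prime_chain :: "(nat \<Rightarrow> 'a::comm_ring_1 set) \<Rightarrow> nat \<Rightarrow> bool"
  where "prime_chain Q k \<longleftrightarrow> (\<forall>i\<le>k. prime_idl (Q i)) \<and> (\<forall>i<k. Q i \<subset> Q (Suc i))"

lemma idl_mult_left: "idl.subspace K \<Longrightarrow> x \<in> K \<Longrightarrow> x * c \<in> K" for x :: "'a::comm_ring_1"
  using idl.subspace_scale[of K x c] by (simp add: mult.commute)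

lemma prime_idl_subspace: "prime_idl P \<Longrightarrow> idl.subspace P"
  by (simp add: prime_idl_def)

lemma prime_idl_mult_iff: "prime_idl P \<Longrightarrow> a * b \<in> P \<longleftrightarrow> a \<in> P \<or> b \<in> P"
  by (metis prime_idl_def idl.subspace_scale idl_mult_left)

lemma prime_idl_prod_list: "prime_idl P \<Longrightarrow> prod_list fs \<in> P \<Longrightarrow> \<exists>f\<in>set fs. f \<in> P"
  by (induction fs) (auto simp: prime_idl_mult_iff, auto simp: prime_idl_def)

lemma prime_idl_prod: "prime_idl P \<Longrightarrow> prod f S \<in> P \<Longrightarrow> \<exists>x\<in>S. f x \<in> P"
  by (induction S rule: infinite_finite_induct) (auto simp: prime_idl_mult_iff, auto simp: prime_idl_def)

lemma idl_add_eq_span: "idl.subspace K \<Longrightarrow> idl_add z K = idl.span (insert z K)"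
  by (simp add: idl_add_def idl.span_insert del: idl.span_eq_iff)
     (metis idl.span_eq_iff)

lemma subspace_idl_add: "idl.subspace K \<Longrightarrow> idl.subspace (idl_add z K)"
  by (simp add: idl_add_eq_span)

lemma idl_add_superset: "idl.subspace K \<Longrightarrow> K \<subseteq> idl_add z K"
  by (auto simp: idl_add_eq_span intro: idl.span_base)

lemma idl_add_self: "idl.subspace K \<Longrightarrow> z \<in> idl_add z K"
  by (auto simp: idl_add_eq_span intro: idl.span_base)

lemma idl_add_least: "idl.subspace I \<Longrightarrow> K \<subseteq> I \<Longrightarrow> z \<in> I \<Longrightarrow> idl_add z K \<subseteq> I"
proof
  fix x assume I: "idl.subspace I" "K \<subseteq> I" "z \<in> I" and "x \<in> idl_add z K"
  then obtain k where "x - k * z \<in> I" by (auto simp: idl_add_def)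
  with I show "x \<in> I" by (metis diff_add_cancel idl.subspace_add idl.subspace_scale)
qed

lemma idl_add_commute: "idl_add y (idl_add z K) = idl_add z (idl_add y K)"
proof -
  have "x - k * y - l * z = x - l * z - k * y" for x k l by simp
  then show ?thesis unfolding idl_add_def by (simp, metis)
qed

lemma subspace_fold_idl_add: "idl.subspace K \<Longrightarrow> idl.subspace (fold idl_add zs K)"
  by (induction zs arbitrary: K) (auto simp: subspace_idl_add)

lemma fold_idl_add_eq_span: "idl.subspace K \<Longrightarrow> fold idl_add zs K = idl.span (set zs \<union> K)"
proof (induction zs arbitrary: K)
  case (Cons z zs)
  have "idl.span (set zs \<union> idl_add z K) = idl.span (insert z (set zs \<union> K))"
    using Cons.prems
    by (simp add: idl_add_eq_span idl.span_Un idl.span_span)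
       (simp add: idl.span_Un[symmetric] flip: Un_insert_right)
  then show ?case using Cons by (simp add: subspace_idl_add)
qed (metis empty_set fold_simps(1) idl.span_eq_iff sup_bot_left)

text \<open>From \<open>z * u = v * l\<close> modulo \<open>K\<close>, regularity of
  \<open>l\<close> modulo K + (z) makes \<open>v\<close> a multiple of \<open>z\<close>, and
  \<open>z\<close> cancels. This half of exchanging two regular elements holds in every ring;
  regularity of \<open>l\<close> modulo \<open>K\<close> itself would be a matter of Nakayama's
  lemma and has to be supplied separately.\<close>

lemma regular_mod_exchange:
  assumes K: "idl.subspace K" and "regular_mod K z" "regular_mod (idl_add z K) l"
  shows "regular_mod (idl_add l K) z"
  unfolding regular_mod_def
proof (intro allI impI)
  fix u assume "z * u \<in> idl_add l K"
  then obtain v where v: "z * u - v * l \<in> K" by (auto simp: idl_add_def)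
  have "l * v - u * z = - (z * u - v * l)" by (simp add: algebra_simps)
  then have "l * v \<in> idl_add z K"
    using idl.subspace_neg[OF K v] by (intro idl_addI[of _ u]) (simp add: mult.commute)
  then obtain w where w: "v - w * z \<in> K"
    using assms(3) by (auto simp: regular_mod_def idl_add_def)
  have "z * (u - w * l) = (z * u - v * l) + l * (v - w * z)" by (simp add: algebra_simps)
  then have "z * (u - w * l) \<in> K"
    using v w K by (simp only:) (assumption | rule idl.subspace_add idl.subspace_diff idl.subspace_scale)+
  then show "u \<in> idl_add l K" using assms(2) by (auto simp: regular_mod_def idl_add_def)
qed

text \<open>The condition under which \<open>l\<close> can be moved in front of \<open>zs\<close>:
  it is regular modulo every ideal that the exchange passes through.\<close>

fun regular_mod_prefixes :: "'a::comm_ring_1 set \<Rightarrow> 'a list \<Rightarrow> 'a \<Rightarrow> bool" where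
  "regular_mod_prefixes K [] l \<longleftrightarrow> regular_mod K l"
| "regular_mod_prefixes K (z # zs) l \<longleftrightarrow> regular_mod K l \<and> regular_mod_prefixes (idl_add z K) zs l"

lemma regs_idl_add:
  "idl.subspace K \<Longrightarrow> regs K zs \<Longrightarrow> regular_mod_prefixes K zs l \<Longrightarrow> regs (idl_add l K) zs"
proof (induction zs arbitrary: K)
  case (Cons z zs)
  have "regular_mod (idl_add z K) l" using Cons.prems by (cases zs) auto
  then have "regular_mod (idl_add l K) z"
    using Cons.prems regular_mod_exchange by auto
  moreover have "regs (idl_add l (idl_add z K)) zs"
    using Cons by (auto simp: subspace_idl_add)
  ultimately show ?case by (simp add: idl_add_commute)
qed simp

text \<open>Kaplansky's argument: an element killed by \<open>M\<close> modulo \<open>K + (h)\<close> yields one modulo \<open>K + (x)\<close>.\<close>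

lemma no_socle_mod_regular:
  assumes K: "idl.subspace K" and x: "x \<in> M" and y: "y \<in> M"
    and regx: "regular_mod K x" and regy: "regular_mod (idl_add x K) y"
    and regh: "regular_mod K h" and u: "\<And>a. a \<in> M \<Longrightarrow> a * u \<in> idl_add h K"
  shows "u \<in> idl_add h K"
proof -
  obtain v where v: "x * u - v * h \<in> K" using u[OF x] by (auto simp: idl_add_def)
  have "y * v \<in> idl_add x K"
  proof -
    obtain w where w: "y * u - w * h \<in> K" using u[OF y] by (auto simp: idl_add_def)
    have "h * (y * v - w * x) = x * (y * u - w * h) - y * (x * u - v * h)"
      by (simp add: algebra_simps)
    then have "h * (y * v - w * x) \<in> K"
      using v w K by (simp only:) (assumption | rule idl.subspace_add idl.subspace_diff idl.subspace_scale)+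
    then show ?thesis using regh by (auto simp: regular_mod_def idl_add_def)
  qed
  then obtain s where s: "v - s * x \<in> K" using regy by (auto simp: regular_mod_def idl_add_def)
  have "x * (u - s * h) = (x * u - v * h) + h * (v - s * x)" by (simp add: algebra_simps)
  then have "x * (u - s * h) \<in> K" using v s K by (simp only:) (assumption | rule idl.subspace_add idl.subspace_diff idl.subspace_scale)+
  then show ?thesis using regx by (auto simp: regular_mod_def idl_add_def)
qed

definition idl_colon :: "'a::comm_ring_1 set \<Rightarrow> 'a \<Rightarrow> 'a set"
  where "idl_colon K u = {a. a * u \<in> K}"

lemma subspace_idl_colon: "idl.subspace K \<Longrightarrow> idl.subspace (idl_colon K u)"
  by (auto simp: idl_colon_def idl.subspace_def algebra_simps)

text \<open>Multiplication by \<open>t\<close> gives the exact sequence 0 -> A/(K : t) -> A/K ->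
  A/(K + (t)) -> 0; an element regular on both outer terms is regular on the middle one.\<close>

lemma regular_mod_extension:
  assumes K: "idl.subspace K" and "regular_mod (idl_colon K t) l" "regular_mod (idl_add t K) l"
  shows "regular_mod K l"
  unfolding regular_mod_def
proof (intro allI impI)
  fix u assume u: "l * u \<in> K"
  then have "u \<in> idl_add t K" using assms(3) idl_add_superset[OF K] unfolding regular_mod_def by blast
  then obtain v where v: "u - v * t \<in> K" by (auto simp: idl_add_def)
  have "(l * v) * t = l * u - l * (u - v * t)" by (simp add: algebra_simps)
  then have "l * v \<in> idl_colon K t"
    unfolding idl_colon_def mem_Collect_eq using u v K
    by (simp only:) (assumption | rule idl.subspace_add idl.subspace_diff idl.subspace_scale)+
  then have "v * t \<in> K" using assms(2) by (auto simp: regular_mod_def idl_colon_def)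
  then show "u \<in> K" using v K by (metis diff_add_cancel idl.subspace_add)
qed

text \<open>Since \<open>l\<close> is regular on A/(K + (t)), the exact sequence of
  \<open>regular_mod_extension\<close> stays exact modulo \<open>l\<close>. This permits induction
  on the length of a common regular sequence.\<close>

lemma idl_colon_idl_add:
  assumes K: "idl.subspace K" and reg: "regular_mod (idl_add t K) l"
  shows "idl_colon (idl_add l K) t = idl_add l (idl_colon K t)"
proof (intro equalityI subsetI)
  fix g assume "g \<in> idl_colon (idl_add l K) t"
  then obtain u where u: "g * t - u * l \<in> K" by (auto simp: idl_colon_def idl_add_def)
  have "l * u - g * t = - (g * t - u * l)" by (simp add: algebra_simps)
  then have "l * u \<in> idl_add t K"
    using idl.subspace_neg[OF K u] by (intro idl_addI[of _ g]) (simp add: mult.commute)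
  then obtain v where v: "u - v * t \<in> K" using reg by (auto simp: regular_mod_def idl_add_def)
  have "(g - v * l) * t = (g * t - u * l) + l * (u - v * t)" by (simp add: algebra_simps)
  then have "(g - v * l) * t \<in> K" using u v K by (simp only:) (assumption | rule idl.subspace_add idl.subspace_diff idl.subspace_scale)+
  then show "g \<in> idl_add l (idl_colon K t)" by (auto simp: idl_add_def idl_colon_def)
next
  fix g assume "g \<in> idl_add l (idl_colon K t)"
  then obtain v where v: "(g - v * l) * t \<in> K" by (auto simp: idl_add_def idl_colon_def)
  have "(g - v * l) * t = g * t - (v * t) * l" by (simp add: algebra_simps)
  then have "g * t \<in> idl_add l K" using v by (intro idl_addI[of _ "v * t"]) simp
  then show "g \<in> idl_colon (idl_add l K) t" by (simp add: idl_colon_def)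
qed

section \<open>Noetherian rings: existence of primes, prime chains, zero divisors\<close>

locale noetherian_type =
  fixes ty :: "'a::comm_ring_1 itself"
  assumes fin_gen: "\<And>I :: 'a set. idl.subspace I \<Longrightarrow> \<exists>S. finite S \<and> I = idl.span S"
begin

text \<open>Zorn's lemma applies because the union of a chain of ideals is finitely generated: one
  member contains all generators and so equals the union.\<close>

lemma maximal_exists:
  fixes F :: "'a set set"
  assumes ne: "F \<noteq> {}" and sub: "\<And>I. I \<in> F \<Longrightarrow> idl.subspace I"
  shows "\<exists>M\<in>F. \<forall>I\<in>F. M \<subseteq> I \<longrightarrow> I = M"
proof (rule subset_Zorn_nonempty[OF ne])
  fix C assume C: "C \<noteq> {}" "subset.chain F C"
  have CX: "C \<subseteq> F" using C(2) by (simp add: subset_chain_def)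
  have "idl.subspace (\<Union>C)"
  proof (rule idl.subspaceI)
    show "0 \<in> \<Union>C" using C(1) CX sub idl.subspace_0 by blast
    show "c * x \<in> \<Union>C" if "x \<in> \<Union>C" for c x using that CX sub idl.subspace_scale by blast
    fix x y assume "x \<in> \<Union>C" "y \<in> \<Union>C"
    then obtain I J where IJ: "I \<in> C" "J \<in> C" "x \<in> I" "y \<in> J" by blast
    then have "I \<subseteq> J \<or> J \<subseteq> I" using C(2) by (auto simp: subset_chain_def)
    then show "x + y \<in> \<Union>C" using IJ CX sub idl.subspace_add by blast
  qed
  then obtain S where S: "finite S" "\<Union>C = idl.span S" using fin_gen by blast
  then have "S \<subseteq> \<Union>C" using idl.span_superset by blast
  then obtain B where B: "B \<in> C" "S \<subseteq> B"
    using finite_subset_Union_chain[OF S(1) _ C] by metis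
  then have "\<Union>C \<subseteq> B" using S CX sub by (metis idl.span_minimal subsetD)
  then have "\<Union>C = B" using B by blast
  then show "\<Union>C \<in> F" using B CX by auto
qed

text \<open>The generators have to be found inside \<open>F\<close>, which \<open>fin_gen\<close>
  alone does not give: a maximal one among the spans of finite subsets must contain all of
  \<open>F\<close>.\<close>

lemma finite_subset_span:
  fixes F :: "'a set"
  shows "\<exists>T. finite T \<and> T \<subseteq> F \<and> idl.span T = idl.span F"
proof -
  let ?FF = "{idl.span T | T. finite T \<and> T \<subseteq> F}"
  have "?FF \<noteq> {}" by blast
  then have "\<exists>M\<in>?FF. \<forall>I\<in>?FF. M \<subseteq> I \<longrightarrow> I = M" by (rule maximal_exists) auto
  then obtain M where M: "M \<in> ?FF" and "\<forall>I\<in>?FF. M \<subseteq> I \<longrightarrow> I = M" ..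
  then have Mmax: "I = M" if "I \<in> ?FF" "M \<subseteq> I" for I using that by simp
  obtain T where T: "finite T" "T \<subseteq> F" "M = idl.span T" using M by blast
  have "x \<in> idl.span T" if "x \<in> F" for x
  proof -
    have "idl.span (insert x T) \<in> ?FF" using T that by (auto intro!: exI[of _ "insert x T"])
    moreover have "M \<subseteq> idl.span (insert x T)" using T by (simp add: idl.span_mono subset_insertI)
    ultimately have "idl.span (insert x T) = M" by (rule Mmax)
    then show ?thesis using T(3) idl.span_base[of x "insert x T"] by simp
  qed
  then have "F \<subseteq> idl.span T" by blast
  then have "idl.span F \<subseteq> idl.span T" by (simp add: idl.span_minimal)
  then show ?thesis using T idl.span_mono[OF T(2)] by blast
qed

text \<open>Krull's argument: an ideal maximal among those avoiding a multiplicative set is prime,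
  since enlarging it by \<open>a\<close> or by \<open>b\<close> meets the set, and with
  \<open>a * b\<close> in the ideal the product of the two elements found would lie in it.\<close>

lemma prime_disjoint:
  fixes K S :: "'a set"
  assumes K: "idl.subspace K" "K \<inter> S = {}" and S: "1 \<in> S" "\<And>a b. a \<in> S \<Longrightarrow> b \<in> S \<Longrightarrow> a * b \<in> S"
  shows "\<exists>P. prime_idl P \<and> K \<subseteq> P \<and> P \<inter> S = {}"
proof -
  let ?FF = "{I. idl.subspace I \<and> K \<subseteq> I \<and> I \<inter> S = {}}"
  have "\<exists>M\<in>?FF. \<forall>I\<in>?FF. M \<subseteq> I \<longrightarrow> I = M" by (rule maximal_exists) (use K in auto)
  then obtain P where P: "P \<in> ?FF" and "\<forall>I\<in>?FF. P \<subseteq> I \<longrightarrow> I = P" ..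
  then have Pmax: "I = P" if "I \<in> ?FF" "P \<subseteq> I" for I using that by simp
  have Ps: "idl.subspace P" using P by simp
  have meet: "\<exists>s\<in>S. \<exists>k. s - k * a \<in> P" if "a \<notin> P" for a
  proof -
    have "idl_add a P \<notin> ?FF"
      using Pmax[of "idl_add a P"] idl_add_superset[OF Ps, of a] idl_add_self[OF Ps, of a] that by blast
    then show ?thesis
      using subspace_idl_add[OF Ps, of a] idl_add_superset[OF Ps, of a] P by (auto simp: idl_add_def)
  qed
  have "a \<in> P \<or> b \<in> P" if ab: "a * b \<in> P" for a b
  proof (rule ccontr)
    assume "\<not> ?thesis"
    then obtain s k s' k' where s: "s \<in> S" "s' \<in> S" "s - k * a \<in> P" "s' - k' * b \<in> P"
      using meet by metis
    have "s * s' = s' * (s - k * a) + (k * a) * (s' - k' * b) + (k * k') * (a * b)"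
      by (simp add: algebra_simps)
    then have "s * s' \<in> P" using s ab Ps by (simp only:) (assumption | rule idl.subspace_add idl.subspace_diff idl.subspace_scale)+
    then show False using S(2)[OF s(1,2)] P by blast
  qed
  moreover have "1 \<notin> P" using P S(1) by blast
  ultimately have "prime_idl P" using Ps by (auto simp: prime_idl_def)
  then show ?thesis using P by blast
qed

text \<open>This replaces localization at \<open>Q\<close>. The products of powers of
  \<open>x\<close> with elements outside \<open>Q\<close> miss \<open>K\<close>, because the regular
  \<open>x\<close> cancels and \<open>K \<subseteq> Q\<close>. A prime missing them lies in
  \<open>Q\<close> and omits \<open>x\<close>.\<close>

lemma prime_below_avoiding:
  fixes K Q :: "'a set"
  assumes K: "idl.subspace K" "K \<subseteq> Q" and Q: "prime_idl Q" and reg: "regular_mod K x"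
  shows "\<exists>q. prime_idl q \<and> K \<subseteq> q \<and> q \<subseteq> Q \<and> x \<notin> q"
proof -
  let ?S = "{u * x ^ n | u n. u \<notin> Q}"
  have one_notin: "1 \<notin> Q" using Q by (simp add: prime_idl_def)
  have pow: "u \<in> K" if "u * x ^ n \<in> K" for u n
    using that
  proof (induction n)
    case (Suc n)
    have "x * (u * x ^ n) \<in> K" using Suc.prems by (simp add: algebra_simps)
    then show ?case using Suc.IH reg by (auto simp: regular_mod_def)
  qed simp
  have "K \<inter> ?S = {}" using pow K(2) by auto
  moreover have "1 \<in> ?S"
  proof -
    have "1 = 1 * x ^ 0" by simp
    then show ?thesis using one_notin by blast
  qed
  moreover have "a * b \<in> ?S" if "a \<in> ?S" "b \<in> ?S" for a b
  proof -
    obtain u n u' n' where "a = u * x ^ n" "b = u' * x ^ n'" "u \<notin> Q" "u' \<notin> Q" using \<open>a \<in> ?S\<close> \<open>b \<in> ?S\<close> by auto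
    then have "a * b = (u * u') * x ^ (n + n')" "u * u' \<notin> Q"
      using prime_idl_mult_iff[OF Q] by (auto simp: power_add algebra_simps)
    then show ?thesis by blast
  qed
  ultimately obtain q where q: "prime_idl q" "K \<subseteq> q" "q \<inter> ?S = {}" using prime_disjoint[OF K(1), of ?S] by blast
  have "x = 1 * x ^ 1" by simp
  then have "x \<in> ?S" using one_notin by blast
  moreover have "q \<subseteq> Q"
  proof
    fix u assume u: "u \<in> q"
    have "u = u * x ^ 0" by simp
    then show "u \<in> Q" using u q(3) by blast
  qed
  ultimately show ?thesis using q by blast
qed

text \<open>Each regular element allows one more prime at the bottom of the chain, so depth is
  bounded by height over \<open>K\<close>.\<close>

lemma regs_imp_chain:
  fixes K P :: "'a set"
  assumes "idl.subspace K" "regs K zs" "K \<subseteq> P" "set zs \<subseteq> P" "prime_idl P"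
  shows "\<exists>Q. prime_chain Q (length zs) \<and> K \<subseteq> Q 0 \<and> Q (length zs) = P"
  using assms
proof (induction zs arbitrary: K)
  case Nil
  then show ?case by (intro exI[of _ "\<lambda>_. P"]) (simp add: prime_chain_def)
next
  case (Cons z zs)
  have "idl_add z K \<subseteq> P" using Cons.prems by (intro idl_add_least prime_idl_subspace) auto
  then obtain Q where Q: "prime_chain Q (length zs)" "idl_add z K \<subseteq> Q 0" "Q (length zs) = P"
    using Cons.IH[of "idl_add z K"] Cons.prems subspace_idl_add[OF Cons.prems(1), of z] by auto
  have "K \<subseteq> Q 0" using Q(2) idl_add_superset[OF Cons.prems(1), of z] by blast
  then obtain q where q: "prime_idl q" "K \<subseteq> q" "q \<subseteq> Q 0" "z \<notin> q"
    using prime_below_avoiding[OF Cons.prems(1), of "Q 0" z] Cons.prems Q(1) by (auto simp: prime_chain_def)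
  have "z \<in> Q 0" using Q(2) idl_add_self[OF Cons.prems(1), of z] by blast
  then have "q \<subset> Q 0" using q by blast
  then have "prime_chain (case_nat q Q) (length (z # zs))"
    using Q(1) q(1) by (auto simp: prime_chain_def less_Suc_eq_0_disj split: nat.splits)
  then show ?case using q Q by (intro exI[of _ "case_nat q Q"]) simp
qed

text \<open>Noetherian induction: a maximal counterexample is not prime, and the lists for K + (a)
  and K + (b) with \<open>a * b \<in> K\<close> can be concatenated. The product of the primes is
  expressed by products of elements, one from each entry; the empty list serves the unit
  ideal.\<close>

lemma prime_product:
  fixes K :: "'a set"
  assumes "idl.subspace K"
  shows "\<exists>ps. (\<forall>p\<in>set ps. prime_idl p \<and> K \<subseteq> p) \<and> (\<forall>fs. list_all2 (\<in>) fs ps \<longrightarrow> prod_list fs \<in> K)"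
proof (rule ccontr)
  define good where "good = (\<lambda>K :: 'a set. \<exists>ps. (\<forall>p\<in>set ps. prime_idl p \<and> K \<subseteq> p) \<and>
    (\<forall>fs. list_all2 (\<in>) fs ps \<longrightarrow> prod_list fs \<in> K))"
  assume "\<not> ?thesis"
  then have "{K. idl.subspace K \<and> \<not> good K} \<noteq> {}" using assms by (auto simp: good_def)
  then have "\<exists>M\<in>{K. idl.subspace K \<and> \<not> good K}. \<forall>I\<in>{K. idl.subspace K \<and> \<not> good K}. M \<subseteq> I \<longrightarrow> I = M"
    by (rule maximal_exists) auto
  then obtain M where M: "idl.subspace M" "\<not> good M"
    and Mm: "\<forall>I\<in>{K. idl.subspace K \<and> \<not> good K}. M \<subseteq> I \<longrightarrow> I = M" by (elim bexE) blast
  have Mmax: "I = M" if "idl.subspace I" "\<not> good I" "M \<subseteq> I" for I using Mm that by simp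
  have "1 \<notin> M"
  proof
    assume "1 \<in> M"
    then have "good M" unfolding good_def by (intro exI[of _ "[]"]) simp
    then show False using M by simp
  qed
  moreover have "\<not> prime_idl M"
  proof
    assume "prime_idl M"
    then have "good M" unfolding good_def
      by (intro exI[of _ "[M]"]) (auto simp: list_all2_Cons2)
    then show False using M by simp
  qed
  ultimately obtain a b where ab: "a * b \<in> M" "a \<notin> M" "b \<notin> M" using M(1) by (auto simp: prime_idl_def)
  have g: "good (idl_add c M)" if "c \<notin> M" for c
    using Mmax[of "idl_add c M"] subspace_idl_add[OF M(1)] idl_add_superset[OF M(1)] idl_add_self[OF M(1), of c] that
    by blast
  obtain ps qs where ps: "\<And>p. p \<in> set ps \<Longrightarrow> prime_idl p \<and> idl_add a M \<subseteq> p"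
      "\<And>fs. list_all2 (\<in>) fs ps \<Longrightarrow> prod_list fs \<in> idl_add a M"
    and qs: "\<And>p. p \<in> set qs \<Longrightarrow> prime_idl p \<and> idl_add b M \<subseteq> p"
      "\<And>fs. list_all2 (\<in>) fs qs \<Longrightarrow> prod_list fs \<in> idl_add b M"
    using g[OF ab(2)] g[OF ab(3)] unfolding good_def by metis
  have "prod_list fs \<in> M" if fs: "list_all2 (\<in>) fs (ps @ qs)" for fs
  proof -
    obtain f1 f2 where f: "fs = f1 @ f2" "list_all2 (\<in>) f1 ps" "list_all2 (\<in>) f2 qs"
      using fs by (auto simp: list_all2_append2)
    obtain k l where kl: "prod_list f1 - k * a \<in> M" "prod_list f2 - l * b \<in> M"
      using ps(2)[OF f(2)] qs(2)[OF f(3)] by (auto simp: idl_add_def)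
    have "prod_list fs = prod_list f2 * (prod_list f1 - k * a) + (k * a) * (prod_list f2 - l * b) + (k * l) * (a * b)"
      by (simp add: f algebra_simps)
    then show ?thesis using kl ab(1) M(1) by (simp only:) (assumption | rule idl.subspace_add idl.subspace_diff idl.subspace_scale)+
  qed
  moreover have "prime_idl p \<and> M \<subseteq> p" if "p \<in> set (ps @ qs)" for p
    using that ps(1) qs(1) idl_add_superset[OF M(1)] by fastforce
  ultimately have "good M" unfolding good_def by (intro exI[of _ "ps @ qs"]) blast
  then show False using M by simp
qed

text \<open>These are associated primes of A/K. Maximal annihilators of nonzero residue classes are
  prime, and every zero divisor lies in one. Finiteness comes from finitely many generators of the
  ideal spanned by \<open>K\<close> and the elements whose annihilators are maximal.\<close>

lemma zero_divisors_primes: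
  fixes K :: "'a set"
  assumes K: "idl.subspace K"
  shows "\<exists>\<P>. finite \<P> \<and> (\<forall>p\<in>\<P>. prime_idl p \<and> (\<exists>u. u \<notin> K \<and> p = idl_colon K u)) \<and>
    (\<forall>z. \<not> regular_mod K z \<longrightarrow> (\<exists>p\<in>\<P>. z \<in> p))"
proof -
  define maxc where "maxc = (\<lambda>u. u \<notin> K \<and> (\<forall>v. v \<notin> K \<longrightarrow> idl_colon K u \<subseteq> idl_colon K v \<longrightarrow> idl_colon K v = idl_colon K u))"
  have pr: "prime_idl (idl_colon K u)" if "maxc u" for u
    unfolding prime_idl_def
  proof (intro conjI allI impI)
    show "idl.subspace (idl_colon K u)" using K by (rule subspace_idl_colon)
    show "1 \<notin> idl_colon K u" using that by (simp add: maxc_def idl_colon_def)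
    fix a b assume ab: "a * b \<in> idl_colon K u"
    show "a \<in> idl_colon K u \<or> b \<in> idl_colon K u"
    proof (rule disjCI)
      assume "b \<notin> idl_colon K u"
      then have bu: "b * u \<notin> K" by (simp add: idl_colon_def)
      have "idl_colon K u \<subseteq> idl_colon K (b * u)"
        using idl.subspace_scale[OF K, of _ b] by (auto simp: idl_colon_def mult.left_commute[of _ b])
      then have "idl_colon K (b * u) = idl_colon K u" using that bu by (simp add: maxc_def)
      moreover have "a \<in> idl_colon K (b * u)" using ab by (simp add: idl_colon_def algebra_simps)
      ultimately show "a \<in> idl_colon K u" by simp
    qed
  qed
  obtain T where T: "finite T" "T \<subseteq> {u. maxc u} \<union> K" "idl.span T = idl.span ({u. maxc u} \<union> K)"
    using finite_subset_span by metis
  define \<P> where "\<P> = idl_colon K ` (T \<inter> {u. maxc u})"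
  have colon_in: "idl_colon K u \<in> \<P>" if u: "maxc u" for u
  proof -
    \<comment> \<open>Otherwise each of these annihilators has an element that does not kill
      \<open>u\<close>. Their product kills the span of \<open>T\<close>, hence \<open>u\<close>,
      and since the annihilator of \<open>u\<close> is prime, one of the factors kills
      \<open>u\<close> after all.\<close>
    have "\<exists>t\<in>T \<inter> {u. maxc u}. idl_colon K t \<subseteq> idl_colon K u"
    proof (rule ccontr)
      assume "\<not> ?thesis"
      then have "\<forall>t\<in>T \<inter> {u. maxc u}. \<exists>a. a \<in> idl_colon K t \<and> a \<notin> idl_colon K u" by blast
      then obtain a where a: "\<And>t. t \<in> T \<Longrightarrow> maxc t \<Longrightarrow> a t * t \<in> K" "\<And>t. t \<in> T \<Longrightarrow> maxc t \<Longrightarrow> a t \<notin> idl_colon K u"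
        by (metis IntI idl_colon_def mem_Collect_eq)
      define c where "c = prod a (T \<inter> {u. maxc u})"
      have fin: "finite (T \<inter> {u. maxc u})" using T by simp
      have ct: "c * t \<in> K" if "t \<in> T" for t
      proof (cases "maxc t")
        case True
        then have "c = a t * prod a (T \<inter> {u. maxc u} - {t})"
          unfolding c_def using that by (simp add: prod.remove[OF fin])
        then show ?thesis using a(1)[OF that True] idl.subspace_scale[OF K, of "a t * t" "prod a (T \<inter> {u. maxc u} - {t})"]
          by (simp add: algebra_simps)
      next
        case False
        then have "t \<in> K" using T(2) that by blast
        then show ?thesis using K by (simp add: idl.subspace_scale)
      qed
      have sp: "idl.subspace {x. c * x \<in> K}"
        using K by (auto simp: idl.subspace_def algebra_simps)
      have "u \<in> idl.span T" using u T(3) by (simp add: idl.span_base)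
      moreover have "idl.span T \<subseteq> {x. c * x \<in> K}" using ct by (intro idl.span_minimal sp) auto
      ultimately have "c \<in> idl_colon K u" by (auto simp: idl_colon_def)
      then obtain t where "t \<in> T" "maxc t" "a t \<in> idl_colon K u"
        using prime_idl_prod[OF pr[OF u]] unfolding c_def by blast
      then show False using a by blast
    qed
    then obtain t where t: "t \<in> T" "maxc t" "idl_colon K t \<subseteq> idl_colon K u" by blast
    then have "idl_colon K u = idl_colon K t" using u by (auto simp: maxc_def)
    then show ?thesis using t by (auto simp: \<P>_def)
  qed
  have "\<exists>p\<in>\<P>. z \<in> p" if nreg: "\<not> regular_mod K z" for z
  proof -
    obtain u where u: "u \<notin> K" "z * u \<in> K" using nreg by (auto simp: regular_mod_def)
    \<comment> \<open>A maximal member of this family is maximal among all annihilators, because a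
      larger one still contains \<open>z\<close>.\<close>
    let ?FF = "{idl_colon K v | v. v \<notin> K \<and> z * v \<in> K}"
    have "?FF \<noteq> {}" using u by blast
    then have "\<exists>M\<in>?FF. \<forall>I\<in>?FF. M \<subseteq> I \<longrightarrow> I = M"
      by (rule maximal_exists) (use subspace_idl_colon[OF K] in blast)
    then obtain M where M: "M \<in> ?FF" and "\<forall>I\<in>?FF. M \<subseteq> I \<longrightarrow> I = M" ..
    then have Mmax: "I = M" if "I \<in> ?FF" "M \<subseteq> I" for I using that by simp
    obtain v where v: "v \<notin> K" "z * v \<in> K" "M = idl_colon K v" using M by blast
    have "maxc v" unfolding maxc_def
    proof (intro conjI allI impI)
      fix w assume w: "w \<notin> K" "idl_colon K v \<subseteq> idl_colon K w"
      have "z \<in> idl_colon K v" using v by (simp add: idl_colon_def)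
      then have "z * w \<in> K" using w by (auto simp: idl_colon_def)
      then show "idl_colon K w = idl_colon K v" using Mmax[of "idl_colon K w"] w v by blast
    qed (use v in auto)
    then have "idl_colon K v \<in> \<P>" by (rule colon_in)
    then show ?thesis using v by (auto simp: idl_colon_def)
  qed
  moreover have "finite \<P>" using T by (simp add: \<P>_def)
  moreover have "\<forall>p\<in>\<P>. prime_idl p \<and> (\<exists>u. u \<notin> K \<and> p = idl_colon K u)"
    using pr by (auto simp: \<P>_def maxc_def)
  ultimately show ?thesis by blast
qed

end

section \<open>Polynomials\<close>

lemma sum_single_keys: "(\<Sum>m\<in>keys p. single m (lookup p m)) = p"
  for p :: "'a \<Rightarrow>\<^sub>0 'b::comm_monoid_add"
  by (rule poly_mapping_eqI)
     (auto simp: lookup_sum lookup_single when_def in_keys_iff if_distrib sum.delta cong: if_cong)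

lemma poly_mapping_add_induct [case_names single add]:
  fixes p :: "'a \<Rightarrow>\<^sub>0 'b::comm_monoid_add"
  assumes "\<And>m a. P (single m a)" and "\<And>p q. P p \<Longrightarrow> P q \<Longrightarrow> P (p + q)"
  shows "P p"
proof -
  have "P (\<Sum>m\<in>S. single m (lookup p m))" if "finite S" for S
    using that
  proof (induction S rule: finite_induct)
    case empty
    then show ?case using assms(1)[of undefined 0] by simp
  qed (simp add: assms)
  from this[of "keys p"] show ?thesis by (simp add: sum_single_keys)
qed

lemma Const_0 [simp]: "Const 0 = 0"
  and Const_1 [simp]: "Const 1 = (1 :: ('x, 'k::comm_ring_1) mpoly)"
  by (simp_all add: Const_def)

lemma Const_add: "Const (a + b) = Const a + (Const b :: ('x, 'k::comm_ring_1) mpoly)"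
  by (simp add: Const_def single_add)

lemma Const_mult: "Const (a * b) = Const a * (Const b :: ('x, 'k::comm_ring_1) mpoly)"
  by (simp add: Const_def mult_single)

lemma Const_uminus: "Const (- a) = - (Const a :: ('x, 'k::comm_ring_1) mpoly)"
  by (simp add: Const_def single_uminus)

lemma Const_diff: "Const (a - b) = Const a - (Const b :: ('x, 'k::comm_ring_1) mpoly)"
  by (simp add: Const_def single_diff)

lemma lookup_Const: "lookup (Const a) m = (a when m = 0)"
  by (auto simp: Const_def lookup_single when_def)

lemma Const_eq_iff [simp]: "Const a = Const b \<longleftrightarrow> a = b"
  by (simp add: Const_def inj_eq)

lemma Const_eq_0_iff [simp]: "Const a = 0 \<longleftrightarrow> a = 0"
  using Const_eq_iff[of a 0] by (simp del: Const_eq_iff)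

lemma single_Const_mult: "single m a = Const a * (single m 1 :: ('x, 'k::comm_ring_1) mpoly)"
  by (simp add: Const_def mult_single)

lemma Var_power: "(Var x :: ('x, 'k::comm_ring_1) mpoly) ^ n = single (single x n) 1"
  by (induction n) (simp_all add: Var_def mult_single flip: single_add)

lemma prod_single_1: "(\<Prod>x\<in>S. single (f x) (1 :: 'k::comm_ring_1)) = single (sum f S) 1"
  by (induction S rule: infinite_finite_induct) (simp_all add: mult_single)

lemma sum_single_UNIV: "(\<Sum>x\<in>UNIV. single x (lookup m x)) = m"
  for m :: "'x::finite \<Rightarrow>\<^sub>0 nat"
  by (rule poly_mapping_eqI) (simp add: lookup_sum lookup_single when_def if_distrib sum.delta cong: if_cong)

lemma prod_Var_power: "(\<Prod>x\<in>UNIV. (Var x :: ('x::finite, 'k::comm_ring_1) mpoly) ^ lookup m x) = single m 1"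
  by (simp add: Var_power prod_single_1 sum_single_UNIV)

locale subst_hom =
  fixes c :: "'k::comm_ring_1 \<Rightarrow> 'b::comm_ring_1" and v :: "'x::finite \<Rightarrow> 'b"
  assumes c_1: "c 1 = 1" and c_add: "c (a + b) = c a + c b" and c_mult: "c (a * b) = c a * c b"
begin

lemma c_0: "c 0 = 0"
  using c_add[of 0 0] by simp

lemma subst_superset:
  assumes "finite S" "keys f \<subseteq> S"
  shows "subst_vars c v f = (\<Sum>m\<in>S. c (lookup f m) * (\<Prod>x\<in>UNIV. v x ^ lookup m x))"
  unfolding subst_vars_def
  by (rule sum.mono_neutral_left) (use assms in \<open>auto simp: in_keys_iff c_0\<close>)

lemma subst_single: "subst_vars c v (single m a) = c a * (\<Prod>x\<in>UNIV. v x ^ lookup m x)"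
  by (subst subst_superset[of "{m}"]) (auto split: if_splits)

lemma subst_add: "subst_vars c v (f + g) = subst_vars c v f + subst_vars c v g"
proof -
  let ?S = "keys f \<union> keys g"
  have "keys (f + g) \<subseteq> ?S" by (rule Poly_Mapping.keys_add)
  then show ?thesis
    by (simp add: subst_superset[of ?S] lookup_add c_add distrib_right sum.distrib)
qed

lemma subst_0: "subst_vars c v 0 = 0"
  by (simp add: subst_vars_def)

lemma subst_mult: "subst_vars c v (f * g) = subst_vars c v f * subst_vars c v g"
proof (induction f rule: poly_mapping_add_induct)
  case (single m a)
  show ?case
  proof (induction g rule: poly_mapping_add_induct)
    case (single m' b)
    then show ?case
      by (simp add: mult_single subst_single c_mult lookup_add power_add prod.distrib)
  qed (simp add: distrib_left subst_add)
qed (simp add: distrib_right subst_add)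

lemma subst_Const: "subst_vars c v (Const a) = c a"
  by (simp add: Const_def subst_single)

lemma subst_Var: "subst_vars c v (Var x) = v x"
proof -
  have "(\<Prod>y\<in>UNIV. v y ^ (1 when x = y)) = v x"
    by (subst prod.remove[of _ x]) (auto intro!: prod.neutral)
  then show ?thesis by (simp add: Var_def subst_single c_1 lookup_single)
qed

lemma subst_1: "subst_vars c v 1 = 1"
  using subst_Const[of 1] by (simp add: c_1)

lemma subst_uminus: "subst_vars c v (- f) = - subst_vars c v f"
  using subst_add[of f "- f"] by (simp add: subst_0 eq_neg_iff_add_eq_0 add.commute)

lemma subst_diff: "subst_vars c v (f - g) = subst_vars c v f - subst_vars c v g"
  using subst_add[of f "- g"] by (simp add: subst_uminus)

lemma subst_sum: "subst_vars c v (sum f S) = (\<Sum>x\<in>S. subst_vars c v (f x))"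
  by (induction S rule: infinite_finite_induct) (simp_all add: subst_0 subst_add)

lemma subst_power: "subst_vars c v (f ^ n) = subst_vars c v f ^ n"
  by (induction n) (simp_all add: subst_1 subst_mult)

lemmas subst_simps = subst_add subst_0 subst_mult subst_Const subst_Var subst_1 subst_uminus
  subst_diff subst_sum subst_power

end

lemma mpoly_hom_eqI:
  fixes f g :: "('x::finite, 'k::comm_ring_1) mpoly \<Rightarrow> 'b::comm_ring_1"
  assumes "\<And>p q. f (p + q) = f p + f q" "\<And>p q. f (p * q) = f p * f q"
    and "\<And>p q. g (p + q) = g p + g q" "\<And>p q. g (p * q) = g p * g q"
    and "f 1 = 1" "g 1 = 1" and C: "\<And>a. f (Const a) = g (Const a)" and V: "\<And>x. f (Var x) = g (Var x)"
  shows "f p = g p"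
proof (induction p rule: poly_mapping_add_induct)
  case (single m a)
  have pw: "f (q ^ n) = f q ^ n" "g (q ^ n) = g q ^ n" for q n
    by (induction n) (simp_all add: assms)
  have pr: "f (\<Prod>x\<in>S. h x) = (\<Prod>x\<in>S. f (h x))" "g (\<Prod>x\<in>S. h x) = (\<Prod>x\<in>S. g (h x))"
    for S and h :: "'x \<Rightarrow> ('x, 'k) mpoly"
    by (induction S rule: infinite_finite_induct) (simp_all add: assms)
  have "single m a = Const a * (\<Prod>x\<in>UNIV. Var x ^ lookup m x)"
    by (simp add: prod_Var_power flip: single_Const_mult)
  then show ?case by (simp add: assms(2,4) pw pr C V)
qed (simp add: assms)

section \<open>Evaluation at points\<close>

abbreviation ev :: "('x::finite \<Rightarrow> 'k::comm_ring_1) \<Rightarrow> ('x, 'k) mpoly \<Rightarrow> 'k"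
  where "ev \<equiv> subst_vars (\<lambda>c. c)"

interpretation ev: subst_hom "\<lambda>c :: 'k::comm_ring_1. c" a for a :: "'x::finite \<Rightarrow> 'k::comm_ring_1"
  by unfold_locales auto

definition irrelevant_idl :: "('x, 'k::comm_ring_1) mpoly set"
  where "irrelevant_idl = {p. lookup p 0 = 0}"

lemma ev_zero: "ev (\<lambda>_ :: 'x::finite. 0 :: 'a::comm_ring_1) p = lookup p 0"
proof (induction p rule: poly_mapping_add_induct)
  case (single m a)
  show ?case
  proof (cases "m = 0")
    case False
    then obtain x where "lookup m x \<noteq> 0" by (metis poly_mapping_eqI lookup_zero)
    then have "(\<Prod>x\<in>UNIV. (0 :: 'a) ^ lookup m x) = 0"
      by (intro prod_zero) (auto intro!: exI[of _ x] zero_power)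
    then show ?thesis using False by (simp add: ev.subst_single lookup_single)
  qed (simp add: ev.subst_single)
qed (simp add: ev.subst_add lookup_add)

lemma irrelevant_idl_iff: "p \<in> irrelevant_idl \<longleftrightarrow> ev (\<lambda>_. 0) p = 0"
  by (simp add: irrelevant_idl_def ev_zero)

lemma ev_kernel_prime: "prime_idl {p. ev a p = (0 :: 'k::field)}"
  by (auto simp: prime_idl_def idl.subspace_def ev.subst_simps)

lemma prime_irrelevant_idl: "prime_idl (irrelevant_idl :: ('x::finite, 'k::field) mpoly set)"
  using ev_kernel_prime[of "\<lambda>_ :: 'x. 0 :: 'k"] by (simp add: irrelevant_idl_iff[symmetric])

lemma subst_vars_diff_in_idl:
  fixes p :: "('x::finite, 'k::comm_ring_1) mpoly"
  assumes K: "idl.subspace K" and v: "\<And>x. Var x - v x \<in> K"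
  shows "p - subst_vars Const v p \<in> K"
proof -
  interpret h: subst_hom Const v by unfold_locales (simp_all add: Const_add Const_mult)
  have pw: "q ^ n - r ^ n \<in> K" if "q - r \<in> K" for q r :: "('x, 'k) mpoly" and n
  proof (induction n)
    case (Suc n)
    have "q ^ Suc n - r ^ Suc n = q * (q ^ n - r ^ n) + r ^ n * (q - r)" by (simp add: algebra_simps)
    then show ?case using Suc that K
      by (simp only:) (assumption | rule idl.subspace_add idl.subspace_scale)+
  qed (use idl.subspace_0[OF K] in simp)
  have pr: "(\<Prod>x\<in>S. q x) - (\<Prod>x\<in>S. r x) \<in> K" if "\<And>x. q x - r x \<in> K" "finite S"
    for q r :: "'x \<Rightarrow> ('x, 'k) mpoly" and S
    using that(2)
  proof (induction S rule: finite_induct)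
    case (insert x S)
    have eq: "prod q (insert x S) - prod r (insert x S) = q x * (prod q S - prod r S) + prod r S * (q x - r x)"
      using insert by (simp add: algebra_simps)
    show ?case unfolding eq
      by (intro idl.subspace_add[OF K] idl.subspace_scale[OF K] that insert)
  qed (use idl.subspace_0[OF K] in simp)
  show ?thesis
  proof (induction p rule: poly_mapping_add_induct)
    case (single m a)
    have "single m a = Const a * (\<Prod>x\<in>UNIV. Var x ^ lookup m x)"
      by (simp add: prod_Var_power flip: single_Const_mult)
    then show ?case
      unfolding h.subst_single using idl.subspace_scale[OF K pr[OF pw[OF v], of UNIV]]
      by (simp only: right_diff_distrib[symmetric]) simp
  next
    case (add p q)
    then have "(p - subst_vars Const v p) + (q - subst_vars Const v q) \<in> K" using K idl.subspace_add by blast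
    then show ?case by (simp add: h.subst_add algebra_simps)
  qed
qed

text \<open>Applied to the ideal of a point, this is where the translated linear forms come from: an
  element minus its value lies in the ideal.\<close>

lemma ev_diff_in_idl:
  fixes p :: "('x::finite, 'k::comm_ring_1) mpoly"
  assumes "idl.subspace K" "\<And>x. Var x - Const (a x) \<in> K"
  shows "p - Const (ev a p) \<in> K"
proof -
  interpret h: subst_hom Const "\<lambda>x. Const (a x) :: ('x, 'k) mpoly"
    by unfold_locales (simp_all add: Const_add Const_mult)
  have "subst_vars Const (\<lambda>x. Const (a x)) p = (Const (ev a p) :: ('x, 'k) mpoly)"
    by (rule mpoly_hom_eqI) (simp_all add: h.subst_simps ev.subst_simps Const_add Const_mult)
  then show ?thesis using subst_vars_diff_in_idl[OF assms(1), of "\<lambda>x. Const (a x)" p] assms(2) by simp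
qed

lemma irrelevant_subset_iff:
  fixes K :: "('x::finite, 'k::comm_ring_1) mpoly set"
  assumes K: "idl.subspace K" and "range Var \<subseteq> K"
  shows "irrelevant_idl \<subseteq> K"
proof
  fix p :: "('x, 'k) mpoly" assume p: "p \<in> irrelevant_idl"
  have "p - Const (ev (\<lambda>_. 0) p) \<in> K" using assms by (intro ev_diff_in_idl) auto
  then show "p \<in> K" using p by (simp add: irrelevant_idl_iff)
qed

lemma Var_irrelevant: "Var (x :: 'x::finite) \<in> irrelevant_idl"
  by (simp add: irrelevant_idl_iff ev.subst_Var)

section \<open>Grading\<close>

definition homog :: "nat \<Rightarrow> ('x::finite, 'k::comm_ring_1) mpoly \<Rightarrow> bool"
  where "homog d p \<longleftrightarrow> (\<forall>m\<in>keys p. mon_degree m = d)"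

definition deg_le :: "nat \<Rightarrow> ('x::finite, 'k::comm_ring_1) mpoly \<Rightarrow> bool"
  where "deg_le d p \<longleftrightarrow> (\<forall>m\<in>keys p. mon_degree m \<le> d)"

text \<open>Every variable is multiplied by a new indeterminate, so that the homogeneous components
  of a product obey the rule for coefficients of a product of univariate polynomials.\<close>

definition grading :: "('x::finite, 'k::comm_ring_1) mpoly \<Rightarrow> ('x, 'k) mpoly poly"
  where "grading = subst_vars (\<lambda>c. [:Const c:]) (\<lambda>x. monom (Var x) 1)"

definition hcomp :: "nat \<Rightarrow> ('x::finite, 'k::comm_ring_1) mpoly \<Rightarrow> ('x, 'k) mpoly"
  where "hcomp d p = coeff (grading p) d"

interpretation grading: subst_hom "\<lambda>c :: 'k::comm_ring_1. [:Const c :: ('x::finite, 'k) mpoly:]" v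
  for v :: "'y::finite \<Rightarrow> ('x::finite, 'k::comm_ring_1) mpoly poly"
  by unfold_locales (simp_all add: Const_add Const_mult flip: pCons_one)

lemma prod_monom: "(\<Prod>x\<in>S. monom (f x) (g x)) = monom (\<Prod>x\<in>S. f x) (\<Sum>x\<in>S. g x)"
  by (induction S rule: infinite_finite_induct) (simp_all add: mult_monom flip: monom_eq_1)

lemma grading_single: "grading (single m a) = monom (single m a) (mon_degree m)"
proof -
  have "grading (single m a)
    = [:Const a:] * monom (\<Prod>x\<in>UNIV. Var x ^ lookup m x) (mon_degree m)"
    by (simp add: grading_def grading.subst_single monom_power prod_monom mon_degree_def)
  also have "\<dots> = monom (single m a) (mon_degree m)"
    unfolding prod_Var_power by (simp add: smult_monom flip: single_Const_mult)
  finally show ?thesis .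
qed

lemma lookup_hcomp: "lookup (hcomp d p) m = (if mon_degree m = d then lookup p m else 0)"
proof (induction p rule: poly_mapping_add_induct)
  case (single m a)
  then show ?case by (auto simp: hcomp_def grading_single lookup_single when_def)
next
  case (add p q)
  then show ?case by (simp add: hcomp_def grading_def grading.subst_add lookup_add)
qed

lemma hcomp_mult: "hcomp d (p * q) = (\<Sum>i\<le>d. hcomp i p * hcomp (d - i) q)"
  by (simp add: hcomp_def grading_def grading.subst_mult coeff_mult)

lemma hcomp_add: "hcomp d (p + q) = hcomp d p + hcomp d q"
  and hcomp_diff: "hcomp d (p - q) = hcomp d p - hcomp d q"
  and hcomp_0 [simp]: "hcomp d 0 = 0"
  by (simp_all add: hcomp_def grading_def grading.subst_add grading.subst_diff grading.subst_0)

lemma hcomp_sum: "hcomp d (sum f S) = (\<Sum>x\<in>S. hcomp d (f x))"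
  by (induction S rule: infinite_finite_induct) (simp_all add: hcomp_add)

lemma homog_hcomp: "homog d (hcomp d p)"
  by (auto simp: homog_def in_keys_iff lookup_hcomp split: if_splits)

lemma hcomp_homog: "homog e p \<Longrightarrow> hcomp d p = (if d = e then p else 0)"
  by (rule poly_mapping_eqI) (auto simp: lookup_hcomp homog_def in_keys_iff)

lemma homog_iff_hcomp: "homog d p \<longleftrightarrow> hcomp d p = p"
  by (metis homog_hcomp hcomp_homog)

lemma homog_0 [simp]: "homog d 0"
  by (simp add: homog_def)

lemma homog_add: "homog d p \<Longrightarrow> homog d q \<Longrightarrow> homog d (p + q)"
  by (simp add: homog_iff_hcomp hcomp_add)

lemma homog_sum: "(\<And>x. x \<in> S \<Longrightarrow> homog d (f x)) \<Longrightarrow> homog d (sum f S)"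
  by (simp add: homog_iff_hcomp hcomp_sum)

lemma hcomp_homog_mult:
  assumes "homog e p"
  shows "hcomp d (p * q) = (if e \<le> d then p * hcomp (d - e) q else 0)"
  using assms by (simp add: hcomp_mult hcomp_homog if_distrib[of "\<lambda>r. r * _"] sum.delta cong: if_cong)

lemma homog_mult: "homog d p \<Longrightarrow> homog e q \<Longrightarrow> homog (d + e) (p * q)"
  by (simp add: homog_iff_hcomp[of "d + e"] hcomp_homog_mult) (simp add: homog_iff_hcomp)

lemma homog_single: "homog (mon_degree m) (single m a)"
  by (simp add: homog_def)

lemma mon_degree_0 [simp]: "mon_degree 0 = 0"
  by (simp add: mon_degree_def)

lemma mon_degree_add: "mon_degree (m + m') = mon_degree m + mon_degree m'"
  by (simp add: mon_degree_def lookup_add sum.distrib)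

lemma mon_degree_single [simp]: "mon_degree (single x n) = n"
  by (simp add: mon_degree_def lookup_single when_def sum.delta)

lemma mon_degree_eq_0 [simp]: "mon_degree m = 0 \<longleftrightarrow> m = 0"
  by (auto simp: mon_degree_def intro!: poly_mapping_eqI)

lemma homog_Const: "homog 0 (Const a)"
  using homog_single[of 0 a] by (simp add: Const_def)

lemma homog_Var: "homog 1 (Var x)"
  using homog_single[of "single x 1" 1] by (simp add: Var_def)

lemma homog_Const_mult: "homog d p \<Longrightarrow> homog d (Const a * p)"
  using homog_mult[OF homog_Const] by fastforce

lemma deg_le_homog: "homog d p \<Longrightarrow> deg_le d p"
  by (simp add: homog_def deg_le_def)

lemma deg_le_mono: "deg_le d p \<Longrightarrow> d \<le> e \<Longrightarrow> deg_le e p"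
  by (fastforce simp: deg_le_def)

lemma deg_le_iff: "deg_le d p \<longleftrightarrow> (\<forall>e>d. hcomp e p = 0)"
  by (auto simp: deg_le_def poly_mapping_eq_iff fun_eq_iff lookup_hcomp in_keys_iff not_le[symmetric])

lemma deg_le_0 [simp]: "deg_le d 0"
  by (simp add: deg_le_def)

lemma deg_le_add: "deg_le d p \<Longrightarrow> deg_le d q \<Longrightarrow> deg_le d (p + q)"
  and deg_le_diff: "deg_le d p \<Longrightarrow> deg_le d q \<Longrightarrow> deg_le d (p - q)"
  by (simp_all add: deg_le_iff hcomp_add hcomp_diff)

lemma deg_le_mult: "deg_le d p \<Longrightarrow> deg_le e q \<Longrightarrow> deg_le (d + e) (p * q)"
  unfolding deg_le_iff hcomp_mult
proof (intro allI impI sum.neutral ballI)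
  fix n i assume "\<forall>n>d. hcomp n p = 0" "\<forall>n>e. hcomp n q = 0" "d + e < n" "i \<in> {..n}"
  moreover from this have "d < i \<or> e < n - i" by auto
  ultimately show "hcomp i p * hcomp (n - i) q = 0" by auto
qed

lemma deg_le_power: "deg_le d p \<Longrightarrow> deg_le (n * d) (p ^ n)"
proof (induction n)
  case 0
  then show ?case using deg_le_homog[OF homog_Const[of 1]] by simp
qed (simp add: deg_le_mult)

lemma deg_le_exists: "\<exists>d. deg_le d p"
  unfolding deg_le_def
  by (intro exI[of _ "Max (insert 0 (mon_degree ` keys p))"]) (auto intro!: Max_ge)

lemma hcomp_decomp: "deg_le d p \<Longrightarrow> p = (\<Sum>e\<le>d. hcomp e p)"
  by (rule poly_mapping_eqI) (force simp: lookup_sum lookup_hcomp deg_le_def in_keys_iff sum.delta)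

lemma deg_le_step: "deg_le (Suc d) p \<Longrightarrow> hcomp (Suc d) p = 0 \<Longrightarrow> deg_le d p"
  unfolding deg_le_iff by (metis Suc_lessI)

lemma deg_le_0D: "deg_le 0 p \<Longrightarrow> p = Const (lookup p 0)"
  by (rule poly_mapping_eqI) (auto simp: deg_le_def lookup_Const when_def in_keys_iff)

definition homog_idl :: "('x::finite, 'k::comm_ring_1) mpoly set \<Rightarrow> bool"
  where "homog_idl K \<longleftrightarrow> idl.subspace K \<and> (\<forall>p\<in>K. \<forall>d. hcomp d p \<in> K)"

lemma homog_idl_subspace: "homog_idl K \<Longrightarrow> idl.subspace K"
  by (simp add: homog_idl_def)

lemma homog_idl_add:
  assumes K: "homog_idl K" and z: "homog e z"
  shows "homog_idl (idl_add z K)"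
  unfolding homog_idl_def
proof (intro conjI ballI allI)
  show "idl.subspace (idl_add z K)" using K by (simp add: homog_idl_def subspace_idl_add)
  fix p d assume "p \<in> idl_add z K"
  then obtain k where "p - k * z \<in> K" by (auto simp: idl_add_def)
  then have "hcomp d (p - z * k) \<in> K" using K by (auto simp: homog_idl_def mult.commute)
  then have "hcomp d p - (if e \<le> d then hcomp (d - e) k else 0) * z \<in> K"
    by (auto simp: hcomp_diff hcomp_homog_mult[OF z] mult.commute[of _ z])
  then show "hcomp d p \<in> idl_add z K" by (rule idl_addI)
qed

lemma homog_idl_zero: "homog_idl {0}"
  by (simp add: homog_idl_def)

lemma homog_idl_span:
  assumes "\<And>z. z \<in> S \<Longrightarrow> \<exists>e. homog e z"
  shows "homog_idl (idl.span S)"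
  unfolding homog_idl_def
proof (intro conjI ballI allI)
  fix p d assume "p \<in> idl.span S"
  then show "hcomp d p \<in> idl.span S"
  proof (induction rule: idl.span_induct_alt)
    case (step c z y)
    obtain e where "homog e z" using assms step by blast
    then have "hcomp d (z * c) \<in> idl.span S"
      using step(1) by (simp add: hcomp_homog_mult) (simp add: mult.commute[of z] idl.span_scale idl.span_base idl.span_zero)
    then show ?case using step by (simp add: hcomp_add mult.commute[of c] idl.span_add)
  qed (simp add: idl.span_zero)
qed simp

section \<open>Splitting off a variable\<close>

text \<open>The coefficients stay in the same type and are merely free of \<open>x\<close>
  (\<open>in_vars_coeff_split_var\<close>), so inductions on the number of variables run over sets
  \<open>W\<close> instead of types.\<close>

definition split_var :: "'x \<Rightarrow> ('x::finite, 'k::comm_ring_1) mpoly \<Rightarrow> ('x, 'k) mpoly poly"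
  where "split_var x = subst_vars (\<lambda>c. [:Const c:]) (\<lambda>y. if y = x then [:0, 1:] else [:Var y:])"

definition in_vars :: "'x set \<Rightarrow> ('x, 'k::comm_ring_1) mpoly \<Rightarrow> bool"
  where "in_vars W p \<longleftrightarrow> (\<forall>m\<in>keys p. keys m \<subseteq> W)"

lemma split_var_add: "split_var x (p + q) = split_var x p + split_var x q"
  and split_var_mult: "split_var x (p * q) = split_var x p * split_var x q"
  and split_var_0 [simp]: "split_var x 0 = 0"
  and split_var_1 [simp]: "split_var x 1 = 1"
  and split_var_Const: "split_var x (Const a) = [:Const a:]"
  and split_var_Var: "split_var x (Var y) = (if y = x then [:0, 1:] else [:Var y:])"
  by (simp_all add: split_var_def grading.subst_simps flip: pCons_one)

lemma split_var_sum: "split_var x (sum f S) = (\<Sum>y\<in>S. split_var x (f y))"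
  by (simp add: split_var_def grading.subst_sum)

lemma poly_split_var: "poly (split_var x p) (Var x) = p"
  by (rule mpoly_hom_eqI) (simp_all add: split_var_add split_var_mult split_var_Const split_var_Var)

lemma split_var_eq_0_iff [simp]: "split_var x p = 0 \<longleftrightarrow> p = 0"
  by (metis poly_split_var poly_0 split_var_0)

lemma split_var_single:
  "split_var x (single m a)
    = monom (single (\<Sum>y\<in>UNIV - {x}. single y (lookup m y)) a)
        (lookup m x)"
proof -
  have "(\<Prod>y\<in>UNIV - {x}. (if y = x then [:0, 1:] else [:Var y:]) ^ lookup m y)
    = (\<Prod>y\<in>UNIV - {x}. monom (single (single y (lookup m y)) (1 :: 'b)) 0)"
    by (rule prod.cong) (auto simp: Var_power[symmetric] monom_0 poly_const_pow)
  also have "\<dots> = monom (single (\<Sum>y\<in>UNIV - {x}. single y (lookup m y)) 1) 0"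
    by (simp add: prod_monom prod_single_1)
  finally have eq: "(\<Prod>y\<in>UNIV. (if y = x then [:0, 1:] else [:Var y:]) ^ lookup m y)
    = monom 1 (lookup m x)
      * monom (single (\<Sum>y\<in>UNIV - {x}. single y (lookup m y)) (1 :: 'b)) 0"
    by (subst prod.remove[of _ x]) (simp_all add: monom_altdef)
  show ?thesis
    unfolding split_var_def grading.subst_single eq
    by (simp add: mult_monom smult_monom single_Const_mult[of _ a, symmetric])
qed

lemma in_vars_UNIV [simp]: "in_vars UNIV p"
  by (simp add: in_vars_def)

lemma in_vars_0 [simp]: "in_vars W 0"
  by (simp add: in_vars_def)

lemma in_vars_single [simp]: "in_vars W (single m a) \<longleftrightarrow> a = 0 \<or> keys m \<subseteq> W"
  by (simp add: in_vars_def)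

lemma in_vars_Const [simp]: "in_vars W (Const a)"
  by (simp add: Const_def)

lemma in_vars_1 [simp]: "in_vars W 1"
  using in_vars_Const[of W 1] by simp

lemma in_vars_Var: "in_vars W (Var x :: ('x, 'k::comm_ring_1) mpoly) \<longleftrightarrow> x \<in> W"
  by (simp add: Var_def)

lemma in_vars_add: "in_vars W p \<Longrightarrow> in_vars W q \<Longrightarrow> in_vars W (p + q)"
  using Poly_Mapping.keys_add[of p q] by (fastforce simp: in_vars_def)

lemma in_vars_uminus: "in_vars W p \<Longrightarrow> in_vars W (- p)"
  by (simp add: in_vars_def in_keys_iff)

lemma in_vars_diff: "in_vars W p \<Longrightarrow> in_vars W q \<Longrightarrow> in_vars W (p - q)"
  using in_vars_add[of W p "- q"] by (simp add: in_vars_uminus)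

lemma in_vars_mult: "in_vars W p \<Longrightarrow> in_vars W q \<Longrightarrow> in_vars W (p * q)"
  unfolding in_vars_def
proof
  fix m assume W: "\<forall>m\<in>keys p. keys m \<subseteq> W" "\<forall>m\<in>keys q. keys m \<subseteq> W"
    and "m \<in> keys (p * q)"
  then obtain a b where "m = a + b" "a \<in> keys p" "b \<in> keys q"
    using keys_mult[of p q] by blast
  then show "keys m \<subseteq> W" using W Poly_Mapping.keys_add[of a b] by blast
qed

lemma in_vars_power: "in_vars W p \<Longrightarrow> in_vars W (p ^ n)"
  by (induction n) (auto intro: in_vars_mult)

lemma in_vars_sum: "(\<And>x. x \<in> S \<Longrightarrow> in_vars W (f x)) \<Longrightarrow> in_vars W (sum f S)"
  by (induction S rule: infinite_finite_induct) (auto intro: in_vars_add)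

lemma in_vars_prod: "(\<And>x. x \<in> S \<Longrightarrow> in_vars W (f x)) \<Longrightarrow> in_vars W (prod f S)"
  by (induction S rule: infinite_finite_induct) (auto intro: in_vars_mult)

lemma in_vars_mono: "in_vars W p \<Longrightarrow> W \<subseteq> W' \<Longrightarrow> in_vars W' p"
  by (auto simp: in_vars_def)

lemma in_vars_coeff_split_var:
  assumes "in_vars W p"
  shows "in_vars (W - {x}) (coeff (split_var x p) i)"
proof -
  have "coeff (split_var x p) i = (\<Sum>m\<in>keys p.
      coeff (split_var x (single m (lookup p m))) i)"
    by (subst sum_single_keys[of p, symmetric]) (simp add: split_var_sum coeff_sum)
  also have "in_vars (W - {x}) \<dots>"
  proof (rule in_vars_sum)
    fix m assume "m \<in> keys p"
    then have m: "keys m \<subseteq> W" using assms by (simp add: in_vars_def)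
    have "keys (\<Sum>y\<in>UNIV - {x}. single y (lookup m y)) \<subseteq> W - {x}"
      using m by (auto simp: in_keys_iff lookup_sum lookup_single when_def sum.delta split: if_splits)
    then show "in_vars (W - {x}) (coeff (split_var x (single m (lookup p m))) i)"
      by (simp add: split_var_single)
  qed
  finally show ?thesis .
qed

text \<open>This is the extension of the contraction of \<open>q\<close> to the polynomials without
  \<open>x\<close>, as the coefficients of \<open>split_var\<close> are free of
  \<open>x\<close>.\<close>

definition extend_idl :: "'x \<Rightarrow> ('x::finite, 'k::comm_ring_1) mpoly set \<Rightarrow> ('x, 'k) mpoly set"
  where "extend_idl x q = {p. \<forall>i. coeff (split_var x p) i \<in> q}"

lemma extend_idl_subset: "idl.subspace q \<Longrightarrow> extend_idl x q \<subseteq> q"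
proof
  fix p assume q: "idl.subspace q" and p: "p \<in> extend_idl x q"
  have "poly (split_var x p) (Var x) \<in> q"
    unfolding poly_altdef using p
    by (intro idl.subspace_sum[OF q]) (auto simp: extend_idl_def intro: idl_mult_left[OF q])
  then show "p \<in> q" by (simp add: poly_split_var)
qed

text \<open>The argument of Gauss's lemma, with lowest instead of leading coefficients.\<close>

lemma prime_extend_idl:
  fixes q :: "('x::finite, 'k::comm_ring_1) mpoly set"
  assumes q: "prime_idl q"
  shows "prime_idl (extend_idl x q)"
  unfolding prime_idl_def
proof (intro conjI allI impI)
  have qs: "idl.subspace q" using q by (rule prime_idl_subspace)
  show "idl.subspace (extend_idl x q)"
    by (rule idl.subspaceI)
       (auto simp: extend_idl_def split_var_add split_var_mult coeff_mult idl.subspace_0[OF qs]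
         idl.subspace_add[OF qs] intro!: idl.subspace_sum[OF qs] idl.subspace_scale[OF qs])
  show "1 \<notin> extend_idl x q"
    using extend_idl_subset[OF qs, of x] q by (auto simp: prime_idl_def)
  fix a b assume ab: "a * b \<in> extend_idl x q"
  show "a \<in> extend_idl x q \<or> b \<in> extend_idl x q"
  proof (rule ccontr)
    assume "\<not> ?thesis"
    then have ne: "\<exists>i. coeff (split_var x a) i \<notin> q" "\<exists>j. coeff (split_var x b) j \<notin> q"
      by (auto simp: extend_idl_def)
    define i where "i = (LEAST i. coeff (split_var x a) i \<notin> q)"
    define j where "j = (LEAST j. coeff (split_var x b) j \<notin> q)"
    have i: "coeff (split_var x a) i \<notin> q" and i': "\<And>l. l < i \<Longrightarrow> coeff (split_var x a) l \<in> q"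
      unfolding i_def using LeastI_ex[OF ne(1)] not_less_Least by blast+
    have j: "coeff (split_var x b) j \<notin> q" and j': "\<And>l. l < j \<Longrightarrow> coeff (split_var x b) l \<in> q"
      unfolding j_def using LeastI_ex[OF ne(2)] not_less_Least by blast+
    \<comment> \<open>In the coefficient of degree \<open>i + j\<close>, every product except that
      of the two lowest coefficients outside \<open>q\<close> has a factor in
      \<open>q\<close>.\<close>
    define c where "c = (\<lambda>l. coeff (split_var x a) l * coeff (split_var x b) (i + j - l))"
    have "(\<Sum>l\<le>i + j. c l) = c i + (\<Sum>l\<in>{..i + j} - {i}. c l)"
      by (rule sum.remove) auto
    moreover have "(\<Sum>l\<le>i + j. c l) \<in> q"
      using ab by (simp add: extend_idl_def split_var_mult coeff_mult c_def)
    moreover have "(\<Sum>l\<in>{..i + j} - {i}. c l) \<in> q"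
    proof (rule idl.subspace_sum[OF qs])
      fix l assume "l \<in> {..i + j} - {i}"
      then have "l < i \<or> i + j - l < j" by auto
      then show "c l \<in> q"
        unfolding c_def using i' j' idl.subspace_scale[OF qs] idl_mult_left[OF qs] by blast
    qed
    ultimately have "c i \<in> q" using idl.subspace_diff[OF qs] by (metis add_diff_cancel_right')
    then show False using i j prime_idl_mult_iff[OF q] by (simp add: c_def)
  qed
qed

text \<open>Iterated extension starting from the irrelevant ideal ends in the zero ideal.\<close>

lemma prime_zero_idl: "prime_idl ({0} :: ('x::finite, 'k::field) mpoly set)"
proof -
  have "\<exists>q :: ('x, 'k) mpoly set. prime_idl q \<and> (\<forall>p\<in>q. in_vars W p \<longrightarrow> p = 0)" if "finite W" for W
    using that
  proof (induction W rule: finite_induct)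
    case empty
    have "p = 0" if "p \<in> irrelevant_idl" "in_vars {} p" for p :: "('x, 'k) mpoly"
      using that
      by (intro poly_mapping_eqI) (metis (mono_tags) in_vars_def irrelevant_idl_def in_keys_iff keys_eq_empty lookup_zero mem_Collect_eq subset_empty)
    then show ?case using prime_irrelevant_idl by blast
  next
    case (insert x W)
    then obtain q :: "('x, 'k) mpoly set" where q: "prime_idl q" "\<And>p. p \<in> q \<Longrightarrow> in_vars W p \<Longrightarrow> p = 0" by blast
    have "p = 0" if "p \<in> extend_idl x q" "in_vars (insert x W) p" for p
    proof -
      have "coeff (split_var x p) i = 0" for i
        using q(2)[of "coeff (split_var x p) i"] that in_vars_coeff_split_var[of "insert x W" p x i] insert(2)
        by (simp add: extend_idl_def)
      then have "split_var x p = 0" by (simp add: poly_eq_iff)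
      then show ?thesis by simp
    qed
    then show ?case using prime_extend_idl[OF q(1)] by blast
  qed
  from this[OF finite_class.finite_UNIV] obtain q :: "('x, 'k) mpoly set"
    where q: "prime_idl q" "\<And>p. p \<in> q \<Longrightarrow> p = 0" by auto
  have "q = {0}" using q idl.subspace_0[OF prime_idl_subspace[OF q(1)]] by auto
  then show ?thesis using q by simp
qed

lemma mpoly_mult_eq_0_iff: "p * q = 0 \<longleftrightarrow> p = 0 \<or> q = 0" for p q :: "('x::finite, 'k::field) mpoly"
  using prime_idl_mult_iff[OF prime_zero_idl, of p q] by simp

lemma mpoly_prod_eq_0: "finite S \<Longrightarrow> prod f S = 0 \<Longrightarrow> \<exists>x\<in>S. f x = (0 :: ('x::finite, 'k::field) mpoly)"
  using prime_idl_prod[OF prime_zero_idl, of f S] by auto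

lemma ev_cong: "in_vars W p \<Longrightarrow> (\<And>x. x \<in> W \<Longrightarrow> a x = b x) \<Longrightarrow> ev a p = ev b p"
  unfolding subst_vars_def
proof (rule sum.cong[OF refl])
  fix m assume "in_vars W p" and ab: "\<And>x. x \<in> W \<Longrightarrow> a x = b x" and "m \<in> keys p"
  then have "a x ^ lookup m x = b x ^ lookup m x" for x
    by (cases "lookup m x = 0") (auto simp: in_vars_def in_keys_iff subset_iff)
  then show "lookup p m * (\<Prod>x\<in>UNIV. a x ^ lookup m x)
    = lookup p m * (\<Prod>x\<in>UNIV. b x ^ lookup m x)" by simp
qed

text \<open>Induction on the variables: once the others are specialized so that some coefficient
  survives, a nonzero univariate polynomial over an infinite field remains.\<close>

lemma ev_nonzero_exists:
  fixes p :: "('x::finite, 'k::field_char_0) mpoly"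
  assumes "p \<noteq> 0"
  shows "\<exists>a. ev a p \<noteq> 0"
proof -
  have "\<exists>a. ev a p \<noteq> 0" if "finite W" "in_vars W p" "p \<noteq> 0" for W and p :: "('x, 'k) mpoly"
    using that
  proof (induction W arbitrary: p rule: finite_induct)
    case (empty p)
    then have "p = Const (lookup p 0)"
      by (intro poly_mapping_eqI) (auto simp: in_vars_def lookup_Const when_def in_keys_iff)
    then show ?case using empty.prems by (metis ev.subst_Const Const_0)
  next
    case (insert x W p)
    then obtain i where i: "coeff (split_var x p) i \<noteq> 0"
      using split_var_eq_0_iff[of x p] by (metis leading_coeff_0_iff)
    have cW: "in_vars W (coeff (split_var x p) l)" for l
      using in_vars_coeff_split_var[OF insert.prems(1), of x l] insert(2) by simp
    obtain a where a: "ev a (coeff (split_var x p) i) \<noteq> 0"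
      using insert.IH[OF cW i] by blast
    define h where "h = (\<Sum>l\<le>degree (split_var x p). monom (ev a (coeff (split_var x p) l)) l)"
    have "coeff h i = ev a (coeff (split_var x p) i)"
      by (auto simp: h_def coeff_sum coeff_eq_0 not_le ev.subst_0)
    then have "h \<noteq> 0" using a by auto
    then have "finite {b. poly h b = 0}" by (rule poly_roots_finite)
    then obtain b where b: "poly h b \<noteq> 0"
      using ex_new_if_finite[OF infinite_UNIV_char_0, of "{b. poly h b = 0}"] by auto
    let ?a = "a(x := b)"
    have "ev ?a p = ev ?a (poly (split_var x p) (Var x))" by (simp add: poly_split_var)
    also have "\<dots> = (\<Sum>l\<le>degree (split_var x p). ev ?a (coeff (split_var x p) l) * b ^ l)"
      unfolding poly_altdef by (simp add: ev.subst_simps)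
    also have "\<dots> = (\<Sum>l\<le>degree (split_var x p). ev a (coeff (split_var x p) l) * b ^ l)"
      using insert(2) by (intro sum.cong refl arg_cong2[of _ _ _ _ "(*)"] ev_cong[OF cW]) auto
    also have "\<dots> = poly h b" by (simp add: h_def poly_sum poly_monom)
    finally have "ev ?a p \<noteq> 0" using b by simp
    then show ?case by (intro exI[of _ ?a])
  qed
  from this[OF finite_class.finite_UNIV in_vars_UNIV assms] show ?thesis .
qed

section \<open>Hilbert's basis theorem\<close>

text \<open>Rings are subsets of one type here, because Hilbert's theorem is iterated along the
  polynomial rings in the variables of a growing set \<open>W\<close>.\<close>

definition subring_set :: "'a::comm_ring_1 set \<Rightarrow> bool"
  where "subring_set R \<longleftrightarrow> 0 \<in> R \<and> 1 \<in> R \<and> (\<forall>a\<in>R. \<forall>b\<in>R. a - b \<in> R \<and> a * b \<in> R)"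

definition idl_of :: "'a::comm_ring_1 set \<Rightarrow> 'a set \<Rightarrow> bool"
  where "idl_of R I \<longleftrightarrow> 0 \<in> I \<and> I \<subseteq> R \<and> (\<forall>a\<in>I. \<forall>b\<in>I. a + b \<in> I) \<and> (\<forall>r\<in>R. \<forall>a\<in>I. r * a \<in> I)"

definition noetherian_subring :: "'a::comm_ring_1 set \<Rightarrow> bool"
  where "noetherian_subring R \<longleftrightarrow> subring_set R \<and>
    (\<forall>I. idl_of R I \<longrightarrow> (\<exists>S. finite S \<and> S \<subseteq> I \<and> (\<forall>I'. idl_of R I' \<longrightarrow> S \<subseteq> I' \<longrightarrow> I \<subseteq> I')))"

definition adjoin :: "'a::comm_ring_1 set \<Rightarrow> 'a \<Rightarrow> 'a set"
  where "adjoin R x = {poly q x | q. \<forall>i. coeff q i \<in> R}"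

lemma idl_of_diff: "subring_set R \<Longrightarrow> idl_of R I \<Longrightarrow> a \<in> I \<Longrightarrow> b \<in> I \<Longrightarrow> a - b \<in> I"
proof -
  assume R: "subring_set R" and I: "idl_of R I" and ab: "a \<in> I" "b \<in> I"
  have "0 - 1 \<in> R" using R unfolding subring_set_def by blast
  then have "(0 - 1) * b \<in> I" using I ab unfolding idl_of_def by blast
  then have "a + (0 - 1) * b \<in> I" using I ab unfolding idl_of_def by blast
  then show ?thesis by simp
qed

lemma subring_add: "subring_set R \<Longrightarrow> a \<in> R \<Longrightarrow> b \<in> R \<Longrightarrow> a + b \<in> R"
proof -
  assume R: "subring_set R" and ab: "a \<in> R" "b \<in> R"
  have "a - (0 - b) \<in> R" using R ab unfolding subring_set_def by blast
  then show ?thesis by simp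
qed

lemma subring_sum: "subring_set R \<Longrightarrow> (\<And>x. x \<in> S \<Longrightarrow> f x \<in> R) \<Longrightarrow> sum f S \<in> R"
  by (induction S rule: infinite_finite_induct) (auto intro: subring_add simp: subring_set_def)

lemma subring_poly_mult:
  "subring_set R \<Longrightarrow> \<forall>i. coeff q i \<in> R \<Longrightarrow> \<forall>i. coeff r i \<in> R \<Longrightarrow>
    coeff (q * r) i \<in> R"
  unfolding coeff_mult by (rule subring_sum) (auto simp: subring_set_def)

lemma subring_adjoin:
  assumes R: "subring_set R"
  shows "subring_set (adjoin R x)"
  unfolding subring_set_def
proof (intro conjI ballI)
  show "0 \<in> adjoin R x"
    using R by (auto simp: adjoin_def subring_set_def intro!: exI[of _ 0])
  show "1 \<in> adjoin R x"
    using R by (auto simp: adjoin_def subring_set_def intro!: exI[of _ 1])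
  fix a b assume "a \<in> adjoin R x" "b \<in> adjoin R x"
  then obtain q r where qr: "a = poly q x" "b = poly r x" "\<forall>i. coeff q i \<in> R" "\<forall>i. coeff r i \<in> R"
    by (auto simp: adjoin_def)
  show "a - b \<in> adjoin R x"
    using qr R by (auto simp: adjoin_def subring_set_def intro!: exI[of _ "q - r"])
  show "a * b \<in> adjoin R x"
    using qr subring_poly_mult[OF R] by (auto simp: adjoin_def intro!: exI[of _ "q * r"])
qed

text \<open>\<open>L d I\<close> collects the coefficients of \<open>x\<^sup>d\<close> of the elements of \<open>I\<close> that are polynomials of
  degree at most \<open>d\<close> in \<open>x\<close>; \<open>x\<close> need not be transcendental over \<open>R\<close>.\<close>

lemma noetherian_adjoin:
  fixes R :: "'a::comm_ring_1 set"
  assumes "noetherian_subring R"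
  shows "noetherian_subring (adjoin R x)"
proof -
  have R: "subring_set R"
    and fg: "\<And>I. idl_of R I \<Longrightarrow> \<exists>S. finite S \<and> S \<subseteq> I \<and> (\<forall>I'. idl_of R I' \<longrightarrow> S \<subseteq> I' \<longrightarrow> I \<subseteq> I')"
    using assms by (auto simp: noetherian_subring_def)
  define PI where "PI = (\<lambda>I. {q. (\<forall>i. coeff q i \<in> R) \<and> poly q x \<in> I})"
  define L where "L = (\<lambda>d I. {coeff q d | q. q \<in> PI I \<and> degree q \<le> d})"
  have L_idl: "idl_of R (L d I)" if I: "idl_of (adjoin R x) I" for d I
    unfolding idl_of_def
  proof (intro conjI ballI)
    show "0 \<in> L d I"
      using I R by (auto simp: L_def PI_def idl_of_def subring_set_def intro!: exI[of _ 0])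
    show "L d I \<subseteq> R" by (auto simp: L_def PI_def)
    fix a assume "a \<in> L d I"
    then obtain q where q: "q \<in> PI I" "degree q \<le> d" "a = coeff q d" by (auto simp: L_def)
    {
      fix b assume "b \<in> L d I"
      then obtain r where r: "r \<in> PI I" "degree r \<le> d" "b = coeff r d" by (auto simp: L_def)
      have "q + r \<in> PI I" using q r I subring_add[OF R] by (auto simp: PI_def idl_of_def)
      then show "a + b \<in> L d I"
        using q r by (auto simp: L_def degree_add_le intro!: exI[of _ "q + r"])
    next
      fix b assume b: "b \<in> R"
      have "b \<in> adjoin R x" using b R by (auto simp: adjoin_def coeff_pCons subring_set_def split: nat.splits intro!: exI[of _ "[:b:]"])
      then have "smult b q \<in> PI I" using q I b R by (auto simp: PI_def idl_of_def subring_set_def)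
      then show "b * a \<in> L d I"
        using q degree_smult_le[of b q] by (auto simp: L_def intro!: exI[of _ "smult b q"])
    }
  qed
  have L_Suc: "L d I \<subseteq> L (Suc d) I" if I: "idl_of (adjoin R x) I" for d I
  proof
    fix a assume "a \<in> L d I"
    then obtain q where q: "q \<in> PI I" "degree q \<le> d" "a = coeff q d" by (auto simp: L_def)
    have "x \<in> adjoin R x"
      using R by (auto simp: adjoin_def coeff_pCons subring_set_def split: nat.splits intro!: exI[of _ "[:0, 1:]"])
    then have "pCons 0 q \<in> PI I"
      using q R I by (auto simp: PI_def coeff_pCons subring_set_def idl_of_def split: nat.splits)
    moreover have "degree (pCons 0 q) \<le> Suc d" using q degree_pCons_le[of 0 q] by simp
    ultimately show "a \<in> L (Suc d) I" using q by (auto simp: L_def intro!: exI[of _ "pCons 0 q"])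
  qed
  have L_mono: "L d I \<subseteq> L e I" if "idl_of (adjoin R x) I" "d \<le> e" for d e I
    using that(2) L_Suc[OF that(1)] by (induction e rule: dec_induct) auto
  have "\<exists>S. finite S \<and> S \<subseteq> I \<and> (\<forall>I'. idl_of (adjoin R x) I' \<longrightarrow> S \<subseteq> I' \<longrightarrow> I \<subseteq> I')"
    if I: "idl_of (adjoin R x) I" for I
  proof -
    have "idl_of R (\<Union>d. L d I)" unfolding idl_of_def
    proof (intro conjI ballI)
      show "0 \<in> (\<Union>d. L d I)" "(\<Union>d. L d I) \<subseteq> R" using L_idl[OF I] unfolding idl_of_def by blast+
      fix a b assume "a \<in> (\<Union>d. L d I)" "b \<in> (\<Union>d. L d I)"
      then obtain d e where "a \<in> L d I" "b \<in> L e I" by blast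
      then have "a \<in> L (max d e) I" "b \<in> L (max d e) I"
        using L_mono[OF I, of d "max d e"] L_mono[OF I, of e "max d e"] by auto
      then show "a + b \<in> (\<Union>d. L d I)" using L_idl[OF I] unfolding idl_of_def by blast
    next
      fix r a assume "r \<in> R" "a \<in> (\<Union>d. L d I)"
      then show "r * a \<in> (\<Union>d. L d I)" using L_idl[OF I] unfolding idl_of_def by blast
    qed
    from fg[OF this] obtain S where S: "finite S" "S \<subseteq> (\<Union>d. L d I)"
      "\<And>I'. idl_of R I' \<Longrightarrow> S \<subseteq> I' \<Longrightarrow> (\<Union>d. L d I) \<subseteq> I'" by blast
    have "\<exists>n. S \<subseteq> L n I" using S(1,2)
    proof (induction S rule: finite_induct)
      case (insert s S)
      then obtain n d where "S \<subseteq> L n I" "s \<in> L d I" by auto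
      then show ?case using L_mono[OF I, of n "max n d"] L_mono[OF I, of d "max n d"]
        by (intro exI[of _ "max n d"]) auto
    qed simp
    then obtain n where n: "S \<subseteq> L n I" by blast
    have "\<exists>S. finite S \<and> S \<subseteq> L d I \<and> (\<forall>I'. idl_of R I' \<longrightarrow> S \<subseteq> I' \<longrightarrow> L d I \<subseteq> I')" for d
      using fg[OF L_idl[OF I]] .
    then obtain T where T: "\<And>d. finite (T d)" "\<And>d. T d \<subseteq> L d I"
      "\<And>d I'. idl_of R I' \<Longrightarrow> T d \<subseteq> I' \<Longrightarrow> L d I \<subseteq> I'" by metis
    \<comment> \<open>\<open>S\<close> generates the coefficient ideals of all stages from
      \<open>n\<close> on, so it joins the generators of stage \<open>n\<close>; below
      \<open>n\<close> each stage has its own.\<close>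
    define U where "U = (\<lambda>d. if d = n then S \<union> T n else T d)"
    have "\<forall>d s. \<exists>q. s \<in> U d \<longrightarrow> q \<in> PI I \<and> degree q \<le> d \<and> coeff q d = s"
      using T(2) n by (fastforce simp: L_def U_def)
    then obtain g where g: "\<And>d s. s \<in> U d \<Longrightarrow> g d s \<in> PI I \<and> degree (g d s) \<le> d \<and> coeff (g d s) d = s"
      by metis
    define Z where "Z = (\<Union>d\<le>n. (\<lambda>s. poly (g d s) x) ` U d)"
    have "finite Z" using S(1) T(1) by (auto simp: Z_def U_def)
    moreover have "Z \<subseteq> I" using g by (auto simp: Z_def PI_def)
    moreover have "I \<subseteq> I'" if I': "idl_of (adjoin R x) I'" "Z \<subseteq> I'" for I'
    proof -
      \<comment> \<open>Working in \<open>I \<inter> I'\<close> keeps the polynomial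
        \<open>r\<close> chosen below in \<open>PI I\<close>, so that \<open>q - r\<close> stays
        there and its degree can be lowered again.\<close>
      have II: "idl_of (adjoin R x) (I \<inter> I')"
        using I I' unfolding idl_of_def by blast
      have Ud: "U d \<subseteq> L d (I \<inter> I')" if "d \<le> n" for d
      proof
        fix s assume s: "s \<in> U d"
        then have "poly (g d s) x \<in> Z" using that by (auto simp: Z_def)
        then have "g d s \<in> PI (I \<inter> I')" using g[OF s] I'(2) by (auto simp: PI_def)
        then show "s \<in> L d (I \<inter> I')"
          unfolding L_def using g[OF s] by (intro CollectI exI[of _ "g d s"]) simp
      qed
      have Ld: "L d I \<subseteq> L d (I \<inter> I')" for d
      proof (cases "d \<le> n")
        case True
        have "T d \<subseteq> L d (I \<inter> I')" using Ud[OF True] by (auto simp: U_def)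
        then show ?thesis using T(3)[OF L_idl[OF II]] by blast
      next
        case False
        have "S \<subseteq> L n (I \<inter> I')" using Ud[of n] by (auto simp: U_def)
        then have "(\<Union>d. L d I) \<subseteq> L n (I \<inter> I')" using S(3)[OF L_idl[OF II]] by blast
        then show ?thesis using L_mono[OF II, of n d] False by auto
      qed
      have "poly q x \<in> I'" if "q \<in> PI I" "degree q \<le> d" for q d
        using that
      proof (induction d arbitrary: q rule: less_induct)
        case (less d)
        have "coeff q d \<in> L d (I \<inter> I')" using less.prems Ld[of d] by (auto simp: L_def)
        then obtain r where r: "r \<in> PI (I \<inter> I')" "degree r \<le> d" "coeff r d = coeff q d"
          by (auto simp: L_def)
        have qr: "q - r \<in> PI I"
          using less.prems r R idl_of_diff[OF subring_adjoin[OF R] I] by (auto simp: PI_def subring_set_def)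
        have rI: "poly r x \<in> I'" using r by (auto simp: PI_def)
        have deg: "degree (q - r) \<le> d" using less.prems r by (intro degree_diff_le)
        have "poly (q - r) x \<in> I'"
        proof (cases d)
          case 0
          then have "q - r = 0" using r(3) deg by (metis coeff_diff diff_self le_zero_eq leading_coeff_0_iff)
          then show ?thesis using I' by (simp add: idl_of_def)
        next
          case (Suc e)
          have "degree (q - r) \<le> e"
            using r(3) deg by (intro degree_le) (metis Suc Suc_lessI coeff_diff coeff_eq_0 diff_self le_less_trans)
          then show ?thesis using less.IH[of e "q - r"] qr Suc by simp
        qed
        then have "poly (q - r) x + poly r x \<in> I'" using rI I' unfolding idl_of_def by blast
        then show ?case by simp
      qed
      moreover have "\<exists>q\<in>PI I. a = poly q x" if "a \<in> I" for a
      proof -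
        have "a \<in> adjoin R x" using that I by (auto simp: idl_of_def)
        then show ?thesis using that by (auto simp: adjoin_def PI_def)
      qed
      ultimately show ?thesis by (metis subsetI order_refl)
    qed
    ultimately show ?thesis by blast
  qed
  then show ?thesis unfolding noetherian_subring_def using subring_adjoin[OF R] by blast
qed

lemma noetherian_in_vars:
  "finite W \<Longrightarrow> noetherian_subring {p :: ('x::finite, 'k::field) mpoly. in_vars W p}"
proof (induction W rule: finite_induct)
  case empty
  have rC: "{p :: ('x, 'k) mpoly. in_vars {} p} = range Const"
  proof (intro equalityI subsetI)
    fix p :: "('x, 'k) mpoly" assume "p \<in> {p. in_vars {} p}"
    then have "p = Const (lookup p 0)"
      by (intro poly_mapping_eqI) (auto simp: in_vars_def lookup_Const when_def in_keys_iff)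
    then show "p \<in> range Const" by blast
  qed auto
  have sub: "subring_set (range Const :: ('x, 'k) mpoly set)"
    unfolding subring_set_def by (auto simp flip: Const_diff Const_mult intro: range_eqI[of _ _ 0] range_eqI[of _ _ 1])
  have "\<exists>S. finite S \<and> S \<subseteq> I \<and> (\<forall>I'. idl_of (range Const) I' \<longrightarrow> S \<subseteq> I' \<longrightarrow> I \<subseteq> I')"
    if I: "idl_of (range Const) I" for I :: "('x, 'k) mpoly set"
  proof (cases "I = {0}")
    case True
    then show ?thesis by (intro exI[of _ "{}"]) (auto simp: idl_of_def)
  next
    case False
    then obtain y where y: "y \<in> I" "y \<noteq> 0" using I by (auto simp: idl_of_def)
    then obtain c where c: "Const c \<in> I" "c \<noteq> 0" using I by (auto simp: idl_of_def)
    have "I \<subseteq> I'" if I': "idl_of (range Const) I'" "{Const c} \<subseteq> I'" for I'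
    proof
      fix a assume "a \<in> I"
      then obtain b where b: "a = Const b" using I by (auto simp: idl_of_def)
      have "Const (b / c) * Const c \<in> I'" using I' unfolding idl_of_def by blast
      then show "a \<in> I'" using b c by (simp flip: Const_mult)
    qed
    then show ?thesis using c by (intro exI[of _ "{Const c}"]) auto
  qed
  then show ?case using sub by (simp add: rC noetherian_subring_def)
next
  case (insert x W)
  have "{p :: ('x, 'k) mpoly. in_vars (insert x W) p} = adjoin {p. in_vars W p} (Var x)"
  proof (intro equalityI subsetI)
    fix p :: "('x, 'k) mpoly" assume "p \<in> {p. in_vars (insert x W) p}"
    then have "in_vars W (coeff (split_var x p) i)" for i
      using in_vars_coeff_split_var[of "insert x W" p x i] insert(2) by simp
    then show "p \<in> adjoin {p. in_vars W p} (Var x)"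
      unfolding adjoin_def by (auto intro!: exI[of _ "split_var x p"] simp: poly_split_var)
  next
    fix p :: "('x, 'k) mpoly" assume "p \<in> adjoin {p. in_vars W p} (Var x)"
    then obtain q where "p = poly q (Var x)" "\<forall>i. in_vars W (coeff q i)" by (auto simp: adjoin_def)
    then show "p \<in> {p. in_vars (insert x W) p}"
      unfolding poly_altdef
      by (auto intro!: in_vars_sum in_vars_mult in_vars_power simp: in_vars_Var intro: in_vars_mono[of W])
  qed
  then show ?case using noetherian_adjoin[OF insert.IH] by simp
qed

interpretation mpoly: noetherian_type "TYPE(('x::finite, 'k::field) mpoly)"
proof
  fix I :: "('x, 'k) mpoly set" assume I: "idl.subspace I"
  have iff: "idl_of UNIV J \<longleftrightarrow> idl.subspace J" for J :: "('x, 'k) mpoly set"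
    by (auto simp: idl_of_def idl.subspace_def)
  have "noetherian_subring (UNIV :: ('x, 'k) mpoly set)"
    using noetherian_in_vars[OF finite_class.finite_UNIV] by simp
  then obtain S where S: "finite S" "S \<subseteq> I" "\<And>J. idl.subspace J \<Longrightarrow> S \<subseteq> J \<Longrightarrow> I \<subseteq> J"
    using I unfolding noetherian_subring_def iff by blast
  have "I = idl.span S"
    using S(3)[of "idl.span S"] S(2) I by (auto simp: idl.span_superset dest: idl.span_minimal)
  then show "\<exists>S. finite S \<and> I = idl.span S" using S(1) by blast
qed

interpretation kv: Vector_Spaces.vector_space "\<lambda>c (p :: ('x, 'k::field) mpoly). Const c * p"
  by unfold_locales (simp_all add: algebra_simps Const_add Const_mult)

declare kv.scale_scale [simp del]
  kv.scale_right_distrib [algebra_simps del, algebra_split_simps del]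
  kv.scale_left_distrib [algebra_simps del, algebra_split_simps del]

section \<open>Growth of residue class rings\<close>

text \<open>The affine Hilbert function of \<open>K\<close> at \<open>d\<close> is at least
  \<open>n\<close>.\<close>

definition indep_mod :: "('x::finite, 'k::field) mpoly set \<Rightarrow> nat \<Rightarrow> nat \<Rightarrow> bool"
  where "indep_mod K d n \<longleftrightarrow> (\<exists>u. (\<forall>i<n. deg_le d (u i)) \<and>
    (\<forall>c. (\<Sum>i<n. Const (c i) * u i) \<in> K \<longrightarrow> (\<forall>i<n. c i = 0)))"

text \<open>Together with \<open>growth_le\<close> this brackets the degree of the Hilbert
  polynomial. Sampling at the multiples \<open>e * q\<close> keeps the lower bound a plain power of
  \<open>q\<close>.\<close>

definition growth_ge :: "('x::finite, 'k::field) mpoly set \<Rightarrow> nat \<Rightarrow> bool"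
  where "growth_ge K b \<longleftrightarrow> (\<exists>e. \<forall>q. indep_mod K (e * q) (q ^ b))"

definition growth_le :: "('x::finite, 'k::field) mpoly set \<Rightarrow> nat \<Rightarrow> bool"
  where "growth_le K s \<longleftrightarrow> (\<exists>C. \<forall>d n. indep_mod K d n \<longrightarrow> n \<le> C * (d + 1) ^ s)"

lemma indep_modI:
  fixes u :: "'s \<Rightarrow> ('x::finite, 'k::field) mpoly"
  assumes S: "finite S" "card S = n" and deg: "\<And>s. s \<in> S \<Longrightarrow> deg_le d (u s)"
    and ind: "\<And>c s. (\<Sum>s\<in>S. Const (c s) * u s) \<in> K \<Longrightarrow> s \<in> S \<Longrightarrow> c s = 0"
  shows "indep_mod K d n"
proof -
  obtain h where h: "bij_betw h {..<n} S"
    using ex_bij_betw_nat_finite[OF S(1)] S(2) by (auto simp: atLeast0LessThan)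
  define h' where "h' = the_inv_into {..<n} h"
  have h'h: "h' (h i) = i" if "i < n" for i
    using h that by (simp add: h'_def the_inv_into_f_f bij_betw_def)
  show ?thesis unfolding indep_mod_def
  proof (intro exI[of _ "\<lambda>i. u (h i)"] conjI allI impI)
    fix i assume "i < n"
    then show "deg_le d (u (h i))" using h by (intro deg) (auto simp: bij_betw_def)
  next
    fix c i assume c: "(\<Sum>i<n. Const (c i) * u (h i)) \<in> K" and i: "i < n"
    have "(\<Sum>s\<in>S. Const (c (h' s)) * u s) = (\<Sum>i<n. Const (c (h' (h i))) * u (h i))"
      by (rule sum.reindex_bij_betw[OF h, symmetric])
    also have "\<dots> = (\<Sum>i<n. Const (c i) * u (h i))" by (intro sum.cong) (simp_all add: h'h)
    finally have "c (h' (h i)) = 0" using ind[of "\<lambda>s. c (h' s)" "h i"] c h i by (auto simp: bij_betw_def)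
    then show "c i = 0" using i by (simp add: h'h)
  qed
qed

lemma indep_mod_mono: "indep_mod K' d n \<Longrightarrow> K \<subseteq> K' \<Longrightarrow> indep_mod K d n"
  unfolding indep_mod_def by (elim ex_forward conj_forward all_forward imp_forward) auto

lemma growth_ge_mono: "growth_ge K' b \<Longrightarrow> K \<subseteq> K' \<Longrightarrow> growth_ge K b"
  unfolding growth_ge_def using indep_mod_mono by blast

lemma growth_ge_proper:
  fixes P :: "('x::finite, 'k::field) mpoly set"
  assumes P: "idl.subspace P" "1 \<notin> P"
  shows "growth_ge P 0"
  unfolding growth_ge_def
proof (intro exI[of _ 0] allI)
  fix q :: nat
  show "indep_mod P (0 * q) (q ^ 0)"
  proof (rule indep_modI[of "{()}" _ _ "\<lambda>_. 1"])
    show "deg_le (0 * q) (1 :: ('x, 'k) mpoly)" using deg_le_homog[OF homog_Const[of 1]] by simp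
    fix c s assume "(\<Sum>s\<in>{()}. Const (c s) * 1) \<in> P"
    then have c: "Const (c ()) \<in> P" by simp
    show "c s = 0"
    proof (rule ccontr)
      assume "c s \<noteq> 0"
      moreover have "Const (inverse (c s)) * Const (c s) \<in> P" using idl.subspace_scale[OF P(1) c] by simp
      ultimately show False using P(2) by (simp flip: Const_mult)
    qed
  qed auto
qed

text \<open>If the \<open>u\<^sub>i\<close> are independent modulo \<open>P'\<close> and \<open>g \<in> P' - P\<close>, then the \<open>g\<^sup>j u\<^sub>i\<close> are independent
  modulo \<open>P\<close>.\<close>

lemma growth_ge_step:
  fixes P P' :: "('x::finite, 'k::field) mpoly set"
  assumes P: "prime_idl P" and P': "idl.subspace P'" "P \<subset> P'" and gr: "growth_ge P' b"
  shows "growth_ge P (Suc b)"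
proof -
  obtain e where e: "\<And>q. indep_mod P' (e * q) (q ^ b)" using gr by (auto simp: growth_ge_def)
  obtain g where g: "g \<in> P'" "g \<notin> P" using P' by blast
  obtain e' where e': "deg_le e' g" using deg_le_exists by blast
  have "indep_mod P ((e + e') * q) (q ^ Suc b)" for q
  proof -
    obtain u where u: "\<And>i. i < q ^ b \<Longrightarrow> deg_le (e * q) (u i)"
      "\<And>c i. (\<Sum>i<q ^ b. Const (c i) * u i) \<in> P' \<Longrightarrow> i < q ^ b \<Longrightarrow> c i = 0"
      using e[of q] unfolding indep_mod_def by blast
    \<comment> \<open>Induction on the number of powers of \<open>g\<close>: modulo
      \<open>P'\<close> only the term without \<open>g\<close> survives, so its coefficients vanish;
      the rest is divisible by \<open>g\<close>, which cancels because \<open>P\<close> is prime and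
      omits \<open>g\<close>.\<close>
    have ind: "c j i = 0" if "(\<Sum>j<r. g ^ j * (\<Sum>i<q ^ b. Const (c j i) * u i)) \<in> P" "j < r" "i < q ^ b" for r c j i
      using that
    proof (induction r arbitrary: c j)
      case (Suc r)
      let ?w = "\<lambda>c. \<Sum>i<q ^ b. Const (c i) * u i"
      define s where "s = (\<Sum>j<r. g ^ j * ?w (c (Suc j)))"
      have eq: "(\<Sum>j<Suc r. g ^ j * ?w (c j)) = ?w (c 0) + s * g"
        unfolding sum.lessThan_Suc_shift s_def by (simp add: sum_distrib_left sum_distrib_right mult_ac)
      have "?w (c 0) + s * g \<in> P'" using Suc.prems(1) eq P' by auto
      moreover have "s * g \<in> P'" using idl.subspace_scale[OF P'(1) g(1)] .
      ultimately have "?w (c 0) \<in> P'" by (metis add_diff_cancel_right' idl.subspace_diff[OF P'(1)])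
      then have c0: "c 0 i = 0" if "i < q ^ b" for i using u(2) that by blast
      then have "?w (c 0) = 0" by simp
      then have "s * g \<in> P" using Suc.prems(1) eq by simp
      then have "s \<in> P" using g(2) prime_idl_mult_iff[OF P] by blast
      then have "c (Suc j) i = 0" if "j < r" for j
        using Suc.IH[of "\<lambda>j. c (Suc j)" j] that Suc.prems(3) by (simp add: s_def)
      then show ?case using c0[OF Suc.prems(3)] Suc.prems(2) by (cases j) auto
    qed simp
    show ?thesis
    proof (rule indep_modI[of "{..<q} \<times> {..<q ^ b}" _ _ "\<lambda>(j, i). g ^ j * u i"])
      fix s assume "s \<in> {..<q} \<times> {..<q ^ b}"
      then obtain j i where s: "s = (j, i)" "j < q" "i < q ^ b" by auto
      have "deg_le (j * e' + e * q) (g ^ j * u i)"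
        using deg_le_mult[OF deg_le_power[OF e'] u(1)[OF s(3)]] .
      moreover have "j * e' + e * q \<le> (e + e') * q"
        using mult_le_mono1[of j q e'] s(2) by (simp add: algebra_simps)
      ultimately show "deg_le ((e + e') * q) ((\<lambda>(j, i). g ^ j * u i) s)" using s deg_le_mono by auto
    next
      fix c s assume c: "(\<Sum>s\<in>{..<q} \<times> {..<q ^ b}. Const (c s) * (case s of (j, i) \<Rightarrow> g ^ j * u i)) \<in> P"
        and s: "s \<in> {..<q} \<times> {..<q ^ b}"
      have "(\<Sum>s\<in>{..<q} \<times> {..<q ^ b}. Const (c s) * (case s of (j, i) \<Rightarrow> g ^ j * u i))
        = (\<Sum>j<q. g ^ j * (\<Sum>i<q ^ b. Const (c (j, i)) * u i))"
        unfolding sum_distrib_left sum.cartesian_product by (intro sum.cong) (auto simp: mult_ac)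
      then show "c s = 0" using ind[where r = q and c = "\<lambda>j i. c (j, i)"] c s by auto
    qed (auto simp: card_cartesian_product)
  qed
  then show ?thesis unfolding growth_ge_def by blast
qed

lemma growth_ge_chain:
  assumes "prime_chain Q k" "growth_ge (Q k) b"
  shows "growth_ge (Q 0) (b + k)"
  using assms
proof (induction k arbitrary: b)
  case (Suc k)
  have "growth_ge (Q k) (Suc b)"
    using Suc.prems by (intro growth_ge_step[of _ "Q (Suc k)"]) (auto simp: prime_chain_def intro: prime_idl_subspace)
  moreover have "prime_chain Q k" using Suc.prems(1) by (simp add: prime_chain_def)
  ultimately show ?case using Suc.IH[of "Suc b"] by simp
qed simp

text \<open>The monomials in \<open>W\<close> with all exponents below \<open>q\<close> are
  independent modulo \<open>Q\<close>; their number is \<open>q ^ card W\<close> and their degree at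
  most \<open>card W * q\<close>.\<close>

lemma growth_ge_vars:
  fixes Q :: "('x::finite, 'k::field) mpoly set"
  assumes Q: "\<And>p. p \<in> Q \<Longrightarrow> in_vars W p \<Longrightarrow> p = 0"
  shows "growth_ge Q (card W)"
  unfolding growth_ge_def
proof (intro exI[of _ "card W"] allI)
  fix q :: nat
  let ?S = "PiE W (\<lambda>_. {..<q})"
  define mo :: "('x \<Rightarrow> nat) \<Rightarrow> 'x \<Rightarrow>\<^sub>0 nat" where "mo = (\<lambda>\<alpha>. \<Sum>x\<in>W. single x (\<alpha> x))"
  have lk: "lookup (mo \<alpha>) x = (if x \<in> W then \<alpha> x else 0)" for \<alpha> x
    by (simp add: mo_def lookup_sum lookup_single when_def sum.delta)
  show "indep_mod Q (card W * q) (q ^ card W)"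
  proof (rule indep_modI[of ?S _ _ "\<lambda>\<alpha>. single (mo \<alpha>) 1"])
    show "finite ?S" by (auto intro: finite_PiE)
    show "card ?S = q ^ card W" by (simp add: card_PiE)
    fix \<alpha> assume "\<alpha> \<in> ?S"
    then have "\<alpha> x < q" if "x \<in> W" for x using that by (auto simp: PiE_def)
    then have "(\<Sum>x\<in>W. \<alpha> x) \<le> (\<Sum>x\<in>W. q)" by (intro sum_mono less_imp_le)
    then have "mon_degree (mo \<alpha>) \<le> card W * q"
      unfolding mon_degree_def lk by (simp add: sum.If_cases)
    then show "deg_le (card W * q) (single (mo \<alpha>) (1 :: 'k))" by (simp add: deg_le_def)
  next
    fix c \<alpha> assume c: "(\<Sum>\<alpha>\<in>?S. Const (c \<alpha>) * single (mo \<alpha>) 1) \<in> Q" and \<alpha>: "\<alpha> \<in> ?S"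
    let ?p = "\<Sum>\<alpha>\<in>?S. single (mo \<alpha>) (c \<alpha>)"
    have "keys (mo \<alpha>) \<subseteq> W" for \<alpha> by (auto simp: in_keys_iff lk split: if_splits)
    then have "in_vars W ?p" by (intro in_vars_sum) simp
    moreover have "?p \<in> Q" using c by (simp flip: single_Const_mult)
    ultimately have "?p = 0" by (rule Q[rotated])
    then have "0 = lookup ?p (mo \<alpha>)" by simp
    also have "\<dots> = (\<Sum>\<beta>\<in>?S. if \<beta> = \<alpha> then c \<alpha> else 0)"
      unfolding lookup_sum
    proof (rule sum.cong[OF refl])
      fix \<beta> assume \<beta>: "\<beta> \<in> ?S"
      have "\<beta> = \<alpha>" if "mo \<beta> = mo \<alpha>"
      proof (rule PiE_ext[OF \<beta> \<alpha>])
        fix x assume "x \<in> W" then show "\<beta> x = \<alpha> x" using lk[of \<beta> x] lk[of \<alpha> x] that by simp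
      qed
      then show "lookup (single (mo \<beta>) (c \<beta>)) (mo \<alpha>) = (if \<beta> = \<alpha> then c \<alpha> else 0)"
        by (auto simp: lookup_single when_def)
    qed
    also have "\<dots> = c \<alpha>" using \<alpha> by (subst sum.delta) (auto intro: finite_PiE)
    finally show "c \<alpha> = 0" by simp
  qed
qed

lemma growth_ge_le:
  assumes "growth_ge K b" "growth_le K s"
  shows "b \<le> s"
proof (rule ccontr)
  assume "\<not> b \<le> s"
  obtain e where e: "\<And>q. indep_mod K (e * q) (q ^ b)" using assms(1) by (auto simp: growth_ge_def)
  obtain C where C: "\<And>d n. indep_mod K d n \<Longrightarrow> n \<le> C * (d + 1) ^ s" using assms(2) by (auto simp: growth_le_def)
  \<comment> \<open>One more than the constant that remains when \<open>q ^ s\<close> is cancelled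
    from the two bounds.\<close>
  define q where "q = Suc (C * (e + 1) ^ s)"
  have q: "q \<ge> 1" by (simp add: q_def)
  have "q ^ Suc s \<le> q ^ b" using \<open>\<not> b \<le> s\<close> q by (intro power_increasing) auto
  also have "\<dots> \<le> C * (e * q + 1) ^ s" using C[OF e] .
  also have "\<dots> \<le> C * ((e + 1) * q) ^ s"
    using q by (intro mult_le_mono2 power_mono) (auto simp: algebra_simps)
  also have "\<dots> = (C * (e + 1) ^ s) * q ^ s" by (simp only: power_mult_distrib mult.assoc)
  finally have "q * q ^ s \<le> (C * (e + 1) ^ s) * q ^ s" by simp
  then have "q \<le> C * (e + 1) ^ s" using q by (simp only: mult_le_cancel2) auto
  then show False by (simp add: q_def)
qed

lemma fold_idl_add_decomp:
  "p \<in> fold idl_add ls K \<Longrightarrow> \<exists>k\<in>K. \<exists>a. p = k + (\<Sum>i<length ls. a i * ls ! i)"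
proof (induction ls arbitrary: K)
  case (Cons l ls)
  have "p \<in> fold idl_add ls (idl_add l K)" using Cons.prems by simp
  then obtain k a where ka: "k \<in> idl_add l K" "p = k + (\<Sum>i<length ls. a i * ls ! i)"
    using Cons.IH by blast
  then obtain b where b: "k - b * l \<in> K" by (auto simp: idl_add_def)
  have "p = (k - b * l) + (\<Sum>i<length (l # ls). case_nat b a i * (l # ls) ! i)"
    by (simp add: ka(2) sum.lessThan_Suc_shift del: sum.lessThan_Suc)
  then show ?case using b by blast
qed auto

lemma finite_mon_degree_less: "finite {m :: 'x::finite \<Rightarrow>\<^sub>0 nat. mon_degree m < c}"
proof (rule finite_subset)
  show "{m :: 'x \<Rightarrow>\<^sub>0 nat. mon_degree m < c} \<subseteq>
    (\<lambda>f. \<Sum>x\<in>UNIV. single x (f x)) ` PiE UNIV (\<lambda>_. {..<c})"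
  proof
    fix m :: "'x \<Rightarrow>\<^sub>0 nat" assume "m \<in> {m. mon_degree m < c}"
    moreover have "lookup m x \<le> mon_degree m" for x
      unfolding mon_degree_def by (rule member_le_sum) auto
    ultimately have "lookup m \<in> PiE UNIV (\<lambda>_. {..<c})"
      by (auto simp: PiE_def intro: le_less_trans)
    then show "m \<in> (\<lambda>f. \<Sum>x\<in>UNIV. single x (f x)) ` PiE UNIV (\<lambda>_. {..<c})"
      by (rule rev_image_eqI) (rule sum_single_UNIV[symmetric])
  qed
qed (auto intro!: finite_imageI finite_PiE)

text \<open>A graded form of Nakayama's lemma: modulo \<open>K\<close> the ring is generated over
  the polynomials in the \<open>ls\<close> by the monomials of degree below \<open>c\<close>. The
  products of these monomials with powers of the \<open>ls\<close> of exponents at most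
  \<open>d\<close> suffice up to degree \<open>d\<close>, and they are counted.\<close>

lemma growth_le_linear:
  fixes K :: "('x::finite, 'k::field) mpoly set"
  assumes K: "homog_idl K" and ls: "\<And>l. l \<in> set ls \<Longrightarrow> homog 1 l"
    and sp: "\<And>j p. c \<le> j \<Longrightarrow> homog j p \<Longrightarrow> p \<in> fold idl_add ls K"
  shows "growth_le K (length ls)"
proof -
  have Ks: "idl.subspace K" using K by (rule homog_idl_subspace)
  define s where "s = length ls"
  define t where "t = (\<lambda>(m, \<alpha>). single m (1 :: 'k) * (\<Prod>i<s. (ls ! i) ^ \<alpha> i))"
  define T where "T = (\<lambda>d. t ` ({m. mon_degree m < c} \<times> PiE {..<s} (\<lambda>_. {..d})))"
  have T_mono: "T j \<subseteq> T d" if "j \<le> d" for j d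
    unfolding T_def using that by (intro image_mono Sigma_mono PiE_mono) auto
  have T_mult: "ls ! i * p \<in> kv.span (T (Suc j))" if i: "i < s" and p: "p \<in> kv.span (T j)" for i j p
    using p
  proof (induction rule: kv.span_induct_alt)
    case (step a z y)
    obtain m \<alpha> where z: "z = t (m, \<alpha>)" "mon_degree m < c" "\<alpha> \<in> PiE {..<s} (\<lambda>_. {..j})"
      using step(1) by (auto simp: T_def)
    let ?\<beta> = "\<alpha>(i := Suc (\<alpha> i))"
    have "(\<Prod>l<s. (ls ! l) ^ ?\<beta> l) = ls ! i * (\<Prod>l<s. (ls ! l) ^ \<alpha> l)"
      using i by (simp add: prod.remove[of "{..<s}" i] algebra_simps)
    then have "ls ! i * z = t (m, ?\<beta>)" by (simp add: z t_def algebra_simps)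
    moreover have "?\<beta> \<in> PiE {..<s} (\<lambda>_. {..Suc j})"
      using z(3) i by (auto simp: PiE_def Pi_def extensional_def le_SucI)
    ultimately have "ls ! i * z \<in> T (Suc j)" using z by (auto simp: T_def)
    then have "Const a * (ls ! i * z) + ls ! i * y \<in> kv.span (T (Suc j))"
      using step by (intro kv.span_add[OF kv.span_scale[OF kv.span_base]]) auto
    then show ?case by (simp add: algebra_simps)
  qed (simp add: kv.span_zero)
  have homog_span: "\<exists>k\<in>K. p - k \<in> kv.span (T j)" if "homog j p" for j p
    using that
  proof (induction j arbitrary: p rule: less_induct)
    case (less j)
    show ?case
    proof (cases "j < c")
      case True
      have "single m (lookup p m) \<in> kv.span (T j)" if "m \<in> keys p" for m
      proof -
        have "mon_degree m < c" using less.prems that True by (simp add: homog_def)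
        then have "t (m, \<lambda>i\<in>{..<s}. 0) \<in> T j" by (auto simp: T_def)
        then have "Const (lookup p m) * t (m, \<lambda>i\<in>{..<s}. 0) \<in> kv.span (T j)"
          by (intro kv.span_scale kv.span_base)
        then show ?thesis by (simp add: t_def flip: single_Const_mult)
      qed
      then have "p \<in> kv.span (T j)"
        using kv.span_sum[of "keys p" "\<lambda>m. single m (lookup p m)" "T j"]
        by (simp add: sum_single_keys)
      then show ?thesis using idl.subspace_0[OF Ks] by (intro bexI[of _ 0]) simp_all
    next
      case False
      then have "p \<in> fold idl_add ls K" using sp[of j p] less.prems by simp
      then obtain k a where ka: "k \<in> K" "p = k + (\<Sum>i<s. a i * ls ! i)"
        using fold_idl_add_decomp unfolding s_def by blast
      \<comment> \<open>Comparing components of degree \<open>j\<close> makes the coefficients of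
        the linear forms homogeneous of degree \<open>j - 1\<close>, where the induction hypothesis
        applies.\<close>
      have "p = hcomp j p" using less.prems by (simp add: homog_iff_hcomp)
      also have "\<dots> = hcomp j k + (\<Sum>i<s. hcomp j (ls ! i * a i))"
        by (simp add: ka(2) hcomp_add hcomp_sum mult.commute)
      finally have p: "p = hcomp j k + (\<Sum>i<s. hcomp j (ls ! i * a i))" .
      have hk: "hcomp j k \<in> K" using K ka(1) by (simp add: homog_idl_def)
      have hl: "hcomp j (ls ! i * a i) = (if 1 \<le> j then ls ! i * hcomp (j - 1) (a i) else 0)" if "i < s" for i
        using ls that by (intro hcomp_homog_mult) (simp add: s_def)
      show ?thesis
      proof (cases j)
        case 0
        then have "p = hcomp j k" using p hl by simp
        then show ?thesis using hk kv.span_zero by (intro bexI[of _ "hcomp j k"]) simp_all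
      next
        case (Suc j')
        have "\<exists>k\<in>K. hcomp j' (a i) - k \<in> kv.span (T j')" for i
          using less.IH[of j' "hcomp j' (a i)"] Suc homog_hcomp by auto
        then obtain k' where k': "\<And>i. k' i \<in> K" "\<And>i. hcomp j' (a i) - k' i \<in> kv.span (T j')" by metis
        have "p - (hcomp j k + (\<Sum>i<s. ls ! i * k' i)) = (\<Sum>i<s. ls ! i * (hcomp j' (a i) - k' i))"
          unfolding p using hl Suc by (simp add: right_diff_distrib sum_subtractf)
        also have "\<dots> \<in> kv.span (T j)"
          using k'(2) T_mult Suc by (intro kv.span_sum) auto
        finally show ?thesis
          using hk k'(1) by (intro bexI[of _ "hcomp j k + (\<Sum>i<s. ls ! i * k' i)"])
            (auto intro!: idl.subspace_add[OF Ks] idl.subspace_sum[OF Ks] idl.subspace_scale[OF Ks])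
      qed
    qed
  qed
  have deg_span: "\<exists>k\<in>K. p - k \<in> kv.span (T d)" if "deg_le d p" for d p
  proof -
    have "\<exists>k\<in>K. hcomp e p - k \<in> kv.span (T e)" for e using homog_span[OF homog_hcomp] .
    then obtain k where k: "\<And>e. k e \<in> K" "\<And>e. hcomp e p - k e \<in> kv.span (T e)" by metis
    have "p - (\<Sum>e\<le>d. k e) = (\<Sum>e\<le>d. hcomp e p - k e)"
      by (subst hcomp_decomp[OF that]) (simp add: sum_subtractf)
    also have "\<dots> \<in> kv.span (T d)"
      using k(2) kv.span_mono[OF T_mono] by (intro kv.span_sum) blast
    finally show ?thesis using k(1) by (intro bexI[of _ "\<Sum>e\<le>d. k e"]) (auto intro: idl.subspace_sum[OF Ks])
  qed
  define C where "C = card {m :: 'x \<Rightarrow>\<^sub>0 nat. mon_degree m < c}"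
  have finT: "finite (T d)" for d
    unfolding T_def by (intro finite_imageI finite_cartesian_product finite_mon_degree_less finite_PiE) auto
  have cardT: "card (T d) \<le> C * (d + 1) ^ s" for d
  proof -
    have "card (T d) \<le> card ({m :: 'x \<Rightarrow>\<^sub>0 nat. mon_degree m < c} \<times> PiE {..<s} (\<lambda>_. {..d}))"
      unfolding T_def by (intro card_image_le finite_cartesian_product finite_mon_degree_less finite_PiE) auto
    also have "\<dots> = C * (d + 1) ^ s" by (simp add: C_def card_cartesian_product card_PiE)
    finally show ?thesis .
  qed
  have "n \<le> C * (d + 1) ^ s" if ind: "indep_mod K d n" for d n
  proof -
    obtain u where u: "\<And>i. i < n \<Longrightarrow> deg_le d (u i)"
      "\<And>c i. (\<Sum>i<n. Const (c i) * u i) \<in> K \<Longrightarrow> i < n \<Longrightarrow> c i = 0"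
      using ind unfolding indep_mod_def by blast
    have "\<forall>i. \<exists>k. i < n \<longrightarrow> k \<in> K \<and> u i - k \<in> kv.span (T d)" using deg_span[OF u(1)] by blast
    then obtain k where k: "\<And>i. i < n \<Longrightarrow> k i \<in> K" "\<And>i. i < n \<Longrightarrow> u i - k i \<in> kv.span (T d)" by metis
    define v where "v = (\<lambda>i. u i - k i)"
    have v: "c i = 0" if "(\<Sum>i<n. Const (c i) * v i) = 0" "i < n" for c i
    proof -
      have "(\<Sum>i<n. Const (c i) * u i) = (\<Sum>i<n. Const (c i) * v i) + (\<Sum>i<n. Const (c i) * k i)"
        by (simp add: v_def right_diff_distrib sum_subtractf)
      also have "\<dots> \<in> K" using that(1) k(1) by (auto intro!: idl.subspace_sum[OF Ks] idl.subspace_scale[OF Ks])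
      finally show ?thesis using u(2) that(2) by blast
    qed
    \<comment> \<open>The dimension bound concerns sets; a repetition in the family would be a
      relation with coefficients 1 and -1.\<close>
    have inj: "inj_on v {..<n}"
    proof (rule inj_onI, rule ccontr)
      fix i j assume ij: "i \<in> {..<n}" "j \<in> {..<n}" "v i = v j" "i \<noteq> j"
      define c where "c = (\<lambda>l. if l = i then 1 else if l = j then -1 else 0 :: 'k)"
      have "(\<Sum>l<n. Const (c l) * v l) = (\<Sum>l\<in>{i, j}. Const (c l) * v l)"
        by (rule sum.mono_neutral_right) (use ij in \<open>auto simp: c_def\<close>)
      also have "\<dots> = 0" using ij by (simp add: c_def Const_uminus)
      finally have "c i = 0" using v[of c i] ij by simp
      then show False by (simp add: c_def)
    qed
    have "\<not> kv.dependent (v ` {..<n})"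
    proof (rule kv.independent_if_scalars_zero)
      fix f x assume f: "(\<Sum>x\<in>v ` {..<n}. Const (f x) * x) = 0" and x: "x \<in> v ` {..<n}"
      have "(\<Sum>i<n. Const (f (v i)) * v i) = 0" using f by (simp add: sum.reindex[OF inj])
      then show "f x = 0" using v[of "\<lambda>i. f (v i)"] x by auto
    qed simp
    then have "card (v ` {..<n}) \<le> card (T d)"
      using kv.independent_span_bound[OF finT, of "v ` {..<n}" d] k(2) by (auto simp: v_def)
    then show ?thesis using cardT[of d] by (simp add: card_image[OF inj])
  qed
  then show ?thesis unfolding growth_le_def s_def by blast
qed

section \<open>Lengths of prime chains and heights in the polynomial ring\<close>

lemma growth_le_zero: "growth_le ({0} :: ('x::finite, 'k::field) mpoly set) (card (UNIV :: 'x set))"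
proof -
  obtain xs :: "'x list" where xs: "set xs = UNIV" "distinct xs"
    using finite_distinct_list[OF finite_class.finite_UNIV] by blast
  let ?ls = "map Var xs :: ('x, 'k) mpoly list"
  have "p \<in> fold idl_add ?ls {0}" if "1 \<le> j" "homog j p" for j and p :: "('x, 'k) mpoly"
  proof -
    have "irrelevant_idl \<subseteq> idl.span (set ?ls \<union> {0})"
      using xs by (intro irrelevant_subset_iff) (auto intro: idl.span_base)
    moreover have "lookup p 0 = 0" using that by (force simp: homog_def in_keys_iff)
    ultimately show ?thesis by (auto simp: fold_idl_add_eq_span irrelevant_idl_def)
  qed
  with growth_le_linear[OF homog_idl_zero, of ?ls 1] show ?thesis
    using distinct_card[OF xs(2)] xs(1) homog_Var by auto
qed

text \<open>A chain of length \<open>k\<close> forces growth of exponent \<open>k\<close>, and the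
  whole polynomial ring grows with exponent at most the number of variables.\<close>

lemma prime_chain_length_le:
  fixes Q :: "nat \<Rightarrow> ('x::finite, 'k::field) mpoly set"
  assumes "prime_chain Q k"
  shows "k \<le> (card (UNIV :: 'x set))"
proof -
  have "prime_idl (Q k)" "prime_idl (Q 0)" using assms by (auto simp: prime_chain_def)
  then have g: "growth_ge (Q 0) (0 + k)"
    using growth_ge_proper by (intro growth_ge_chain[OF assms]) (auto simp: prime_idl_def)
  have "{0} \<subseteq> Q 0" using \<open>prime_idl (Q 0)\<close> idl.subspace_0 prime_idl_subspace by blast
  from growth_ge_le[OF growth_ge_mono[OF g this] growth_le_zero] show ?thesis by simp
qed

lemma prime_chain_Suc:
  assumes "prime_chain Q k" "prime_idl P" "Q k \<subset> P"
  shows "prime_chain (Q(Suc k := P)) (Suc k)"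
  using assms by (auto simp: prime_chain_def less_Suc_eq le_Suc_eq)

text \<open>Freeing one variable outside \<open>W\<close> at a time by \<open>extend_idl\<close> lowers \<open>q\<close> strictly.\<close>

lemma prime_chain_below_vars:
  fixes q :: "('x::finite, 'k::field) mpoly set"
  assumes "prime_idl q" "\<And>p. p \<in> q \<Longrightarrow> in_vars W p \<Longrightarrow> p = 0"
    and "\<And>x. x \<notin> W \<Longrightarrow> \<exists>g\<in>q. g \<noteq> 0 \<and> in_vars (insert x W) g"
  shows "\<exists>Q. prime_chain Q (card (- W)) \<and> Q (card (- W)) = q"
  using assms
proof (induction "card (- W)" arbitrary: W q)
  case 0
  then show ?case by (intro exI[of _ "\<lambda>_. q"]) (auto simp: prime_chain_def)
next
  case (Suc k)
  then obtain x where x: "x \<notin> W" by (metis Compl_iff card.empty equals0I nat.distinct(1))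
  let ?q = "extend_idl x q"
  have qs: "idl.subspace q" using Suc.prems(1) by (rule prime_idl_subspace)
  have ind: "p = 0" if "p \<in> ?q" "in_vars (insert x W) p" for p
  proof -
    have "coeff (split_var x p) i = 0" for i
      using Suc.prems(2)[of "coeff (split_var x p) i"] that in_vars_coeff_split_var[of "insert x W" p x i] x
      by (simp add: extend_idl_def)
    then have "split_var x p = 0" by (simp add: poly_eq_iff)
    then show ?thesis by simp
  qed
  have ex: "\<exists>g\<in>?q. g \<noteq> 0 \<and> in_vars (insert y (insert x W)) g" if y: "y \<notin> insert x W" for y
  proof -
    obtain g where g: "g \<in> q" "g \<noteq> 0" "in_vars (insert y W) g" using Suc.prems(3)[of y] y by auto
    have sv: "split_var x g = [:g:]"
    proof (rule poly_eqI)
      have "coeff (split_var x g) i = coeff [:g:] i" for i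
      proof -
        have "\<forall>m\<in>keys g. lookup m x = 0"
          using g(3) x y by (auto simp: in_vars_def in_keys_iff subset_iff)
        then have "split_var x (single m (lookup g m))
            = [:single m (lookup g m):]" if "m \<in> keys g" for m
        proof -
          have m0: "lookup m x = 0" using that \<open>\<forall>m\<in>_. _\<close> by blast
          have "(\<Sum>y\<in>UNIV - {x}. single y (lookup m y)) = m"
            by (subst sum_single_UNIV[of m, symmetric]) (simp add: sum.remove[of UNIV x] m0)
          then show ?thesis by (simp add: split_var_single m0 monom_0)
        qed
        then have "split_var x g = (\<Sum>m\<in>keys g. [:single m (lookup g m):])"
          by (subst sum_single_keys[of g, symmetric]) (simp add: split_var_sum)
        also have "\<dots> = [:\<Sum>m\<in>keys g. single m (lookup g m):]"
          by (induction rule: infinite_finite_induct) simp_all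
        finally show ?thesis by (simp add: sum_single_keys)
      qed
      then show "coeff (split_var x g) i = coeff [:g:] i" for i .
    qed
    have "g \<in> ?q" using g(1) idl.subspace_0[OF qs] by (auto simp: extend_idl_def sv coeff_pCons split: nat.splits)
    then show ?thesis using g by (blast intro: in_vars_mono)
  qed
  have "- W = insert x (- insert x W)" using x by auto
  then have "card (- W) = Suc (card (- insert x W))" by (metis card_insert_disjoint finite Compl_iff insertI1)
  then have k: "k = card (- insert x W)" using Suc.hyps(2) by simp
  obtain Q where Q: "prime_chain Q k" "Q k = ?q"
    using Suc.hyps(1)[OF k prime_extend_idl[OF Suc.prems(1)] ind ex] k by auto
  obtain g where g: "g \<in> q" "g \<noteq> 0" "in_vars (insert x W) g" using Suc.prems(3)[OF x] by blast
  then have "g \<notin> ?q" using ind by blast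
  then have "Q k \<subset> q" using Q(2) g(1) extend_idl_subset[OF qs, of x] by blast
  then show ?case
    using prime_chain_Suc[OF Q(1) Suc.prems(1)] Suc.hyps(2) by (intro exI[of _ "Q(Suc k := q)"]) simp
qed

text \<open>Height plus dimension is at least the number of variables. For a largest set
  \<open>W\<close> of variables independent modulo \<open>q\<close>, the variables outside
  \<open>W\<close> give a chain ending in \<open>q\<close>, and those in \<open>W\<close> give the
  growth.\<close>

lemma prime_growth_height:
  fixes q :: "('x::finite, 'k::field) mpoly set"
  assumes q: "prime_idl q" and ht: "\<And>Q k. prime_chain Q k \<Longrightarrow> Q k = q \<Longrightarrow> k \<le> h"
  shows "growth_ge q ((card (UNIV :: 'x set)) - h)"
proof -
  let ?I = "\<lambda>W. \<forall>p\<in>q. in_vars W p \<longrightarrow> p = 0"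
  have "?I {}"
  proof (intro ballI impI)
    fix p assume p: "p \<in> q" "in_vars {} p"
    define c where "c = lookup p 0"
    have pc: "p = Const c"
      using p by (intro poly_mapping_eqI) (auto simp: in_vars_def lookup_Const when_def in_keys_iff c_def)
    show "p = 0"
    proof (rule ccontr)
      assume "p \<noteq> 0"
      then have "Const (inverse c) * p = 1" by (simp add: pc flip: Const_mult)
      moreover have "Const (inverse c) * p \<in> q" using idl.subspace_scale[OF prime_idl_subspace[OF q] p(1)] .
      ultimately show False using q by (simp add: prime_idl_def)
    qed
  qed
  then have "\<exists>W. ?I W \<and> (\<forall>W'. ?I W' \<longrightarrow> card W' \<le> card W)"
    by (rule ex_has_greatest_nat[of ?I "{}" card "Suc (card (UNIV :: 'x set))"]) (simp add: card_mono le_imp_less_Suc)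
  then obtain W where W: "?I W" "\<And>W'. ?I W' \<Longrightarrow> card W' \<le> card W" by blast
  have "\<exists>g\<in>q. g \<noteq> 0 \<and> in_vars (insert x W) g" if "x \<notin> W" for x
    using W(2)[of "insert x W"] that by auto
  then obtain Q where "prime_chain Q (card (- W))" "Q (card (- W)) = q"
    using prime_chain_below_vars[OF q] W(1) by blast
  then have "card (- W) \<le> h" using ht by blast
  then have le: "(card (UNIV :: 'x set)) - h \<le> card W" by (simp add: Compl_eq_Diff_UNIV card_Diff_subset)
  \<comment> \<open>A subset of the exact size is taken because \<open>growth_ge\<close> speaks of a
    single exponent.\<close>
  obtain V where V: "V \<subseteq> W" "card V = (card (UNIV :: 'x set)) - h" using le by (meson obtain_subset_with_card_n)
  have "growth_ge q (card V)" using W(1) V(1) by (intro growth_ge_vars) (auto intro: in_vars_mono)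
  then show ?thesis using V by simp
qed

section \<open>Regular sequences of linear forms\<close>

text \<open>On the line of all \<open>l + Const c * Var x\<close>, with \<open>Var x\<close> outside
  the new prime and \<open>l\<close> outside the old ones, each prime excludes at most one
  \<open>c\<close>: two values would put first \<open>Var x\<close> and then \<open>l\<close> into
  it. Characteristic zero supplies infinitely many \<open>c\<close>.\<close>

lemma linear_form_avoiding:
  fixes \<P> :: "('x::finite, 'k::field_char_0) mpoly set set"
  assumes "finite \<P>" "\<And>p. p \<in> \<P> \<Longrightarrow> prime_idl p" "\<And>p. p \<in> \<P> \<Longrightarrow> \<exists>x. Var x \<notin> p"
  shows "\<exists>l. homog 1 l \<and> (\<forall>p\<in>\<P>. l \<notin> p)"
  using assms
proof (induction \<P> rule: finite_induct)
  case empty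
  then show ?case by (intro exI[of _ 0]) simp
next
  case (insert p \<P>)
  then obtain l where l: "homog 1 l" "\<And>p. p \<in> \<P> \<Longrightarrow> l \<notin> p" by auto
  obtain x where x: "Var x \<notin> p" using insert.prems(2) by auto
  define B where "B = (\<lambda>p'. {c :: 'k. l + Const c * Var x \<in> p'})"
  have "finite (B p')" if p': "p' \<in> insert p \<P>" for p'
  proof -
    have sub: "idl.subspace p'" using insert.prems(1)[OF p'] by (rule prime_idl_subspace)
    have "c = c'" if cc: "c \<in> B p'" "c' \<in> B p'" for c c'
    proof (rule ccontr)
      assume ne: "c \<noteq> c'"
      have "(l + Const c * Var x) - (l + Const c' * Var x) \<in> p'"
        using cc unfolding B_def mem_Collect_eq by (rule idl.subspace_diff[OF sub])
      then have "Const (c - c') * Var x \<in> p'" by (simp add: Const_diff left_diff_distrib)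
      then have "Const (inverse (c - c')) * (Const (c - c') * Var x) \<in> p'" by (rule idl.subspace_scale[OF sub])
      then have V: "Var x \<in> p'" using ne by (simp add: mult.assoc[symmetric] flip: Const_mult)
      have "(l + Const c * Var x) - Const c * Var x \<in> p'"
        using cc(1) unfolding B_def mem_Collect_eq by (intro idl.subspace_diff[OF sub] idl.subspace_scale[OF sub V])
      then have "l \<in> p'" by simp
      then show False using V x l p' by auto
    qed
    then show ?thesis by (metis finite.emptyI finite_insert finite_subset insertI1 subsetI equals0I)
  qed
  then have "finite (\<Union>p'\<in>insert p \<P>. B p')" using insert(1) by blast
  then obtain c where c: "c \<notin> (\<Union>p'\<in>insert p \<P>. B p')" using ex_new_if_finite[OF infinite_UNIV_char_0] by blast
  have "homog 1 (l + Const c * Var x)" by (intro homog_add l homog_Const_mult homog_Var)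
  then show ?case using c by (auto simp: B_def intro!: exI[of _ "l + Const c * Var x"])
qed

text \<open>\<open>soc\<close> says that no A/K has a nonzero class killed by the irrelevant ideal.
  Hence no associated prime contains all variables, and one linear form avoids the associated primes
  for all members of \<open>\<K>\<close> at once.\<close>

lemma regular_linear_form_exists:
  fixes \<K> :: "('x::finite, 'k::field_char_0) mpoly set set"
  assumes fin: "finite \<K>" and sub: "\<And>K. K \<in> \<K> \<Longrightarrow> idl.subspace K"
    and soc: "\<And>K u. K \<in> \<K> \<Longrightarrow> (\<And>a. a \<in> irrelevant_idl \<Longrightarrow> a * u \<in> K) \<Longrightarrow> u \<in> K"
  shows "\<exists>l. homog 1 l \<and> (\<forall>K\<in>\<K>. regular_mod K l)"
proof -
  define cover where "cover = (\<lambda>K \<P>. finite \<P> \<and> (\<forall>p\<in>\<P>. prime_idl p \<and> (\<exists>u. u \<notin> K \<and> p = idl_colon K u)) \<and>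
    (\<forall>z :: ('x, 'k) mpoly. \<not> regular_mod K z \<longrightarrow> (\<exists>p\<in>\<P>. z \<in> p)))"
  have "\<forall>K\<in>\<K>. \<exists>\<P>. cover K \<P>"
    unfolding cover_def by (intro ballI mpoly.zero_divisors_primes sub)
  from bchoice[OF this] obtain \<P> where "\<forall>K\<in>\<K>. cover K (\<P> K)" ..
  then have P: "finite (\<P> K)" "p \<in> \<P> K \<Longrightarrow> prime_idl p" "p \<in> \<P> K \<Longrightarrow> \<exists>u. u \<notin> K \<and> p = idl_colon K u"
    "\<not> regular_mod K z \<Longrightarrow> \<exists>p\<in>\<P> K. z \<in> p" if "K \<in> \<K>" for K p z
    using that by (auto simp: cover_def)
  have "\<exists>l. homog 1 l \<and> (\<forall>p\<in>(\<Union>K\<in>\<K>. \<P> K). l \<notin> p)"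
  proof (rule linear_form_avoiding)
    show "finite (\<Union>K\<in>\<K>. \<P> K)" using fin P(1) by blast
    fix p assume "p \<in> (\<Union>K\<in>\<K>. \<P> K)"
    then obtain K where "K \<in> \<K>" "p \<in> \<P> K" by blast
    then obtain u where K: "K \<in> \<K>" "prime_idl p" "u \<notin> K" "p = idl_colon K u" using P(2,3) by blast
    show "prime_idl p" using K by simp
    show "\<exists>x. Var x \<notin> p"
    proof (rule ccontr)
      assume "\<not> ?thesis"
      then have "irrelevant_idl \<subseteq> p" using irrelevant_subset_iff prime_idl_subspace[OF K(2)] by blast
      then have "a * u \<in> K" if "a \<in> irrelevant_idl" for a using that K(4) by (auto simp: idl_colon_def)
      then show False using soc[OF K(1)] K(3) by blast
    qed
  qed
  then obtain l where l: "homog 1 l" "\<forall>p\<in>(\<Union>K\<in>\<K>. \<P> K). l \<notin> p" by blast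
  have "regular_mod K l" if "K \<in> \<K>" for K using P(4)[OF that, of l] l(2) that by blast
  then show ?thesis using l(1) by blast
qed

text \<open>Containment in the irrelevant ideal belongs to the notion, so depth at least 0 still
  says that the origin is a zero of \<open>K\<close>.\<close>

definition depth_ge :: "('x::finite, 'k::field) mpoly set \<Rightarrow> nat \<Rightarrow> bool"
  where "depth_ge K s \<longleftrightarrow> K \<subseteq> irrelevant_idl \<and> (\<exists>zs. length zs = s \<and> set zs \<subseteq> irrelevant_idl \<and> regs K zs)"

lemma subspace_irrelevant_idl: "idl.subspace (irrelevant_idl :: ('x::finite, 'k::field) mpoly set)"
  using prime_irrelevant_idl by (rule prime_idl_subspace)

lemma homog_1_irrelevant: "homog 1 l \<Longrightarrow> l \<in> irrelevant_idl"
  by (force simp: homog_def irrelevant_idl_def in_keys_iff)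

text \<open>Collects the ideals on which a linear form has to be regular. Each has a regular element
  among \<open>zs\<close>, so there is no socle when \<open>zs\<close> lies in the irrelevant ideal.
  The last entry is left out because the linear form is going to replace it.\<close>

lemma regs_prefix_ideals:
  assumes "idl.subspace K" "regs K zs" "zs \<noteq> []"
  shows "\<exists>\<K>. finite \<K> \<and> (\<forall>L\<in>\<K>. idl.subspace L \<and> (\<exists>z\<in>set zs. regular_mod L z)) \<and>
    (\<forall>l. (\<forall>L\<in>\<K>. regular_mod L l) \<longrightarrow> regular_mod_prefixes K (butlast zs) l)"
  using assms
proof (induction zs arbitrary: K)
  case (Cons z zs)
  show ?case
  proof (cases "zs = []")
    case True
    then show ?thesis using Cons.prems by (intro exI[of _ "{K}"]) simp
  next
    case False
    then obtain \<K> where "finite \<K>" "\<forall>L\<in>\<K>. idl.subspace L \<and> (\<exists>z\<in>set zs. regular_mod L z)"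
      "\<forall>l. (\<forall>L\<in>\<K>. regular_mod L l) \<longrightarrow> regular_mod_prefixes (idl_add z K) (butlast zs) l"
      using Cons.IH[of "idl_add z K"] Cons.prems by (auto simp: subspace_idl_add)
    then show ?thesis using Cons.prems False by (intro exI[of _ "insert K \<K>"]) auto
  qed
qed simp

text \<open>Depth drops by at most one modulo a regular \<open>h\<close> unrelated to the given
  sequence. A linear form \<open>l\<close>, regular modulo K + (h) and modulo all prefix ideals,
  goes to the front in place of the last entry; exchanging \<open>l\<close> and \<open>h\<close>
  reduces the claim to K + (l) with one step less.\<close>

lemma depth_ge_idl_add:
  fixes K :: "('x::finite, 'k::field_char_0) mpoly set"
  assumes "idl.subspace K" "depth_ge K (Suc s)" "h \<in> irrelevant_idl" "regular_mod K h"
  shows "depth_ge (idl_add h K) s"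
  using assms
proof (induction s arbitrary: K)
  case 0
  then have "idl_add h K \<subseteq> irrelevant_idl"
    by (intro idl_add_least subspace_irrelevant_idl) (auto simp: depth_ge_def)
  then show ?case by (simp add: depth_ge_def)
next
  case (Suc s)
  obtain zs where zs: "length zs = Suc (Suc s)" "set zs \<subseteq> irrelevant_idl" "regs K zs"
    using Suc.prems(2) by (auto simp: depth_ge_def)
  then obtain x y ws where xy: "zs = x # y # ws" by (metis length_Suc_conv)
  obtain \<K> where \<K>: "finite \<K>" "\<And>L. L \<in> \<K> \<Longrightarrow> idl.subspace L \<and> (\<exists>z\<in>set zs. regular_mod L z)"
    "\<And>l. (\<forall>L\<in>\<K>. regular_mod L l) \<Longrightarrow> regular_mod_prefixes K (butlast zs) l"
    using regs_prefix_ideals[OF Suc.prems(1) zs(3)] xy by blast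
  have "\<exists>l. homog 1 l \<and> (\<forall>L\<in>insert (idl_add h K) \<K>. regular_mod L l)"
  proof (rule regular_linear_form_exists)
    show "finite (insert (idl_add h K) \<K>)" using \<K>(1) by simp
    show "idl.subspace L" if "L \<in> insert (idl_add h K) \<K>" for L
      using that \<K>(2) subspace_idl_add[OF Suc.prems(1)] by auto
    fix L u assume L: "L \<in> insert (idl_add h K) \<K>" and u: "\<And>a. a \<in> irrelevant_idl \<Longrightarrow> a * u \<in> L"
    show "u \<in> L"
    proof (cases "L \<in> \<K>")
      case True
      then show ?thesis using \<K>(2)[OF True] u zs(2) unfolding regular_mod_def by blast
    next
      case False
      then have L: "L = idl_add h K" using L by simp
      \<comment> \<open>K + (h) has no socle because the sequence starts with two regular elements
        \<open>x\<close> and \<open>y\<close>.\<close>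
      show ?thesis unfolding L
      proof (rule no_socle_mod_regular[OF Suc.prems(1), of x irrelevant_idl y])
        show "a * u \<in> idl_add h K" if "a \<in> irrelevant_idl" for a using u[OF that] L by simp
      qed (use zs xy Suc.prems(4) in auto)
    qed
  qed
  then obtain l where l: "homog 1 l" "regular_mod (idl_add h K) l" "\<And>L. L \<in> \<K> \<Longrightarrow> regular_mod L l" by auto
  have pre: "regular_mod_prefixes K (butlast zs) l" using \<K>(3) l(3) by blast
  then have lK: "regular_mod K l" using xy by auto
  have "regs K (butlast zs)"
  proof -
    have "regs K us" if "regs K (us @ vs)" for us vs
      using that by (induction us arbitrary: K) auto
    then show ?thesis using zs(3) xy by (metis append_butlast_last_id list.distinct(1))
  qed
  \<comment> \<open>With \<open>l\<close> in front the sequence has its old length again, so K + (l)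
    has lost exactly one.\<close>
  then have "regs (idl_add l K) (butlast zs)" using regs_idl_add[OF Suc.prems(1) _ pre] by blast
  moreover have "idl_add l K \<subseteq> irrelevant_idl"
    using Suc.prems(2) homog_1_irrelevant[OF l(1)]
    by (intro idl_add_least subspace_irrelevant_idl) (auto simp: depth_ge_def)
  ultimately have D: "depth_ge (idl_add l K) (Suc s)"
    unfolding depth_ge_def using zs by (auto intro!: exI[of _ "butlast zs"] dest: in_set_butlastD)
  have "regular_mod (idl_add l K) h" by (rule regular_mod_exchange[OF Suc.prems(1,4) l(2)])
  from Suc.IH[OF subspace_idl_add[OF Suc.prems(1)] D Suc.prems(3) this]
  obtain ws where ws: "length ws = s" "set ws \<subseteq> irrelevant_idl" "regs (idl_add h (idl_add l K)) ws"
    by (auto simp: depth_ge_def)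
  have "idl_add h K \<subseteq> irrelevant_idl"
    using Suc.prems by (intro idl_add_least subspace_irrelevant_idl) (auto simp: depth_ge_def)
  then show ?case
    unfolding depth_ge_def using ws l homog_1_irrelevant[OF l(1)]
    by (intro conjI exI[of _ "l # ws"]) (auto simp: idl_add_commute)
qed

text \<open>\<open>A/K\<close> is an extension of \<open>A/(K + (t))\<close> by \<open>A/(K : t)\<close>.\<close>

lemma linear_regs_extension:
  fixes K :: "('x::finite, 'k::field_char_0) mpoly set"
  assumes "idl.subspace K" "depth_ge (idl_colon K t) s" "depth_ge (idl_add t K) s"
  shows "\<exists>ls. length ls = s \<and> (\<forall>l\<in>set ls. homog 1 l) \<and> regs K ls"
  using assms
proof (induction s arbitrary: K)
  case (Suc s)
  have reg: "\<exists>z\<in>irrelevant_idl. regular_mod L z" if "depth_ge L (Suc s)" for L :: "('x, 'k) mpoly set"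
    using that by (auto simp: depth_ge_def length_Suc_conv)
  have "\<exists>l. homog 1 l \<and> (\<forall>L\<in>{idl_colon K t, idl_add t K}. regular_mod L l)"
  proof (rule regular_linear_form_exists)
    show "idl.subspace L" if "L \<in> {idl_colon K t, idl_add t K}" for L
      using that subspace_idl_add subspace_idl_colon Suc.prems(1) by auto
    fix L u assume "L \<in> {idl_colon K t, idl_add t K}" and u: "\<And>a. a \<in> irrelevant_idl \<Longrightarrow> a * u \<in> L"
    then show "u \<in> L" using reg Suc.prems(2,3) unfolding regular_mod_def by blast
  qed simp
  then obtain l where l: "homog 1 l" "regular_mod (idl_colon K t) l" "regular_mod (idl_add t K) l" by auto
  have "depth_ge (idl_add l (idl_colon K t)) s"
    using depth_ge_idl_add[OF subspace_idl_colon[OF Suc.prems(1)] Suc.prems(2) homog_1_irrelevant[OF l(1)] l(2)] .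
  then have "depth_ge (idl_colon (idl_add l K) t) s" using idl_colon_idl_add[OF Suc.prems(1) l(3)] by simp
  moreover have "depth_ge (idl_add t (idl_add l K)) s"
    using depth_ge_idl_add[OF subspace_idl_add[OF Suc.prems(1)] Suc.prems(3) homog_1_irrelevant[OF l(1)] l(3)]
    by (simp add: idl_add_commute)
  ultimately obtain ls where "length ls = s" "\<forall>l\<in>set ls. homog 1 l" "regs (idl_add l K) ls"
    using Suc.IH[OF subspace_idl_add[OF Suc.prems(1)]] by blast
  then show ?case using l regular_mod_extension[OF Suc.prems(1) l(2,3)] by (intro exI[of _ "l # ls"]) auto
qed simp

section \<open>Ideals generated by variables\<close>

lemma mem_span_Var_iff:
  fixes p :: "('x::finite, 'k::field) mpoly"
  shows "p \<in> idl.span (Var ` S) \<longleftrightarrow> subst_vars Const (\<lambda>y. if y \<in> S then 0 else Var y) p = 0"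
proof -
  interpret h: subst_hom Const "\<lambda>y. if y \<in> S then 0 else Var y :: ('x, 'k) mpoly"
    by unfold_locales (simp_all add: Const_add Const_mult)
  show ?thesis
  proof
    assume "p \<in> idl.span (Var ` S)"
    then show "subst_vars Const (\<lambda>y. if y \<in> S then 0 else Var y) p = 0"
      by (induction rule: idl.span_induct_alt) (auto simp: h.subst_simps)
  next
    assume "subst_vars Const (\<lambda>y. if y \<in> S then 0 else Var y) p = 0"
    moreover have "p - subst_vars Const (\<lambda>y. if y \<in> S then 0 else Var y) p \<in> idl.span (Var ` S)"
      by (rule subst_vars_diff_in_idl) (auto intro: idl.span_base idl.span_zero)
    ultimately show "p \<in> idl.span (Var ` S)" by simp
  qed
qed

text \<open>The ideal is the kernel of substituting 0 for the variables in \<open>S\<close>, a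
  homomorphism into a domain.\<close>

lemma prime_span_Var:
  "prime_idl (idl.span (Var ` S) :: ('x::finite, 'k::field) mpoly set)"
proof -
  interpret h: subst_hom Const "\<lambda>y. if y \<in> S then 0 else Var y :: ('x, 'k) mpoly"
    by unfold_locales (simp_all add: Const_add Const_mult)
  show ?thesis
    by (auto simp: prime_idl_def mem_span_Var_iff h.subst_simps mpoly_mult_eq_0_iff)
qed

lemma Var_neq_0 [simp]: "Var x \<noteq> (0 :: ('x, 'k::field) mpoly)"
  unfolding Var_def by (metis lookup_single_eq lookup_zero zero_neq_one)

lemma Var_notin_span: "x \<notin> S \<Longrightarrow> Var x \<notin> (idl.span (Var ` S) :: ('x::finite, 'k::field) mpoly set)"
proof -
  interpret h: subst_hom Const "\<lambda>y. if y \<in> S then 0 else Var y :: ('x, 'k) mpoly"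
    by unfold_locales (simp_all add: Const_add Const_mult)
  show "x \<notin> S \<Longrightarrow> Var x \<notin> (idl.span (Var ` S) :: ('x, 'k) mpoly set)"
    by (simp add: mem_span_Var_iff h.subst_Var)
qed

lemma regular_mod_prime: "prime_idl P \<Longrightarrow> z \<notin> P \<Longrightarrow> regular_mod P z"
  by (auto simp: regular_mod_def prime_idl_def)

lemma regs_Var:
  "distinct xs \<Longrightarrow> set xs \<inter> S = {} \<Longrightarrow> regs (idl.span (Var ` S) :: ('x::finite, 'k::field) mpoly set) (map Var xs)"
proof (induction xs arbitrary: S)
  case (Cons x xs)
  have "idl_add (Var x) (idl.span (Var ` S)) = (idl.span (Var ` insert x S) :: ('x, 'k) mpoly set)"
    by (simp add: idl_add_def idl.span_insert)
  moreover have "regs (idl.span (Var ` insert x S) :: ('x, 'k) mpoly set) (map Var xs)"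
    using Cons.prems by (intro Cons.IH) auto
  ultimately show ?case
    using Cons.prems Var_notin_span[of x S] by (auto intro: regular_mod_prime[OF prime_span_Var])
qed simp

lemma depth_ge_zero: "depth_ge ({0} :: ('x::finite, 'k::field) mpoly set) (card (UNIV :: 'x set))"
proof -
  obtain xs :: "'x list" where xs: "set xs = UNIV" "distinct xs"
    using finite_distinct_list[OF finite_class.finite_UNIV] by blast
  have "regs {0} (map Var xs :: ('x, 'k) mpoly list)" using regs_Var[of xs "{}"] xs by simp
  moreover have "length xs = card (UNIV :: 'x set)" using xs distinct_card by metis
  ultimately show ?thesis
    using Var_irrelevant idl.subspace_0[OF subspace_irrelevant_idl]
    by (auto simp: depth_ge_def intro!: exI[of _ "map Var xs"])
qed

section \<open>Systems of parameters\<close>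

lemma prime_chain_le: "prime_chain Q k \<Longrightarrow> i \<le> k \<Longrightarrow> Q 0 \<subseteq> Q i"
proof (induction i)
  case (Suc i)
  then have "Q i \<subset> Q (Suc i)" "Q 0 \<subseteq> Q i" by (auto simp: prime_chain_def)
  then show ?case by blast
qed simp

lemma prime_chain_less: "prime_chain Q (Suc k) \<Longrightarrow> Q 0 \<subset> Q (Suc k)"
  using prime_chain_le[of Q "Suc k" k] unfolding prime_chain_def by (meson le_SucI lessI order_refl subset_psubset_trans)

lemma prime_chain_Cons: "prime_chain Q k \<Longrightarrow> prime_idl p \<Longrightarrow> p \<subset> Q 0 \<Longrightarrow> prime_chain (case_nat p Q) (Suc k)"
  by (auto simp: prime_chain_def less_Suc_eq_0_disj split: nat.splits)

lemma hcomp_0_eq: "hcomp 0 p = Const (lookup p 0)"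
  by (rule poly_mapping_eqI) (simp add: lookup_hcomp lookup_Const when_def)

text \<open>A linear system of parameters for A/K at the origin. The form \<open>l\<close> avoids
  the primes of a finite list over \<open>K\<close> that lie strictly below the irrelevant ideal, so
  a chain over K + (l) can be prolonged downwards. At \<open>s = 0\<close> no prime over
  \<open>K\<close> lies strictly below the irrelevant ideal, and \<open>K\<close> contains all forms
  of large degree.\<close>

lemma linear_parameters:
  fixes K :: "('x::finite, 'k::field_char_0) mpoly set"
  assumes "homog_idl K" "K \<subseteq> irrelevant_idl"
    and "\<And>Q k. prime_chain Q k \<Longrightarrow> K \<subseteq> Q 0 \<Longrightarrow> Q k = irrelevant_idl \<Longrightarrow> k \<le> s"
  shows "\<exists>ls c. length ls = s \<and> (\<forall>l\<in>set ls. homog 1 l) \<and> (\<forall>j\<ge>c. \<forall>p. homog j p \<longrightarrow> p \<in> fold idl_add ls K)"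
  using assms
proof (induction s arbitrary: K)
  case 0
  have K: "idl.subspace K" using 0(1) by (rule homog_idl_subspace)
  obtain ps where ps: "\<And>p. p \<in> set ps \<Longrightarrow> prime_idl p \<and> K \<subseteq> p"
    "\<And>fs. list_all2 (\<in>) fs ps \<Longrightarrow> prod_list fs \<in> K" using mpoly.prime_product[OF K] by blast
  have only: "p = irrelevant_idl \<or> \<not> p \<subseteq> irrelevant_idl" if "p \<in> set ps" for p
  proof (rule ccontr)
    assume "\<not> ?thesis"
    then have "p \<subset> irrelevant_idl" by blast
    then have "prime_chain (case_nat p (\<lambda>_. irrelevant_idl)) (Suc 0)"
      using ps(1)[OF that] by (intro prime_chain_Cons) (auto simp: prime_chain_def prime_irrelevant_idl)
    then show False using 0(3)[of "case_nat p (\<lambda>_. irrelevant_idl)" "Suc 0"] ps(1)[OF that] by simp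
  qed
  \<comment> \<open>Each entry equal to the irrelevant ideal uses up one variable of
    \<open>m\<close>; every other entry contributes an element not vanishing at the origin, and
    these are collected in \<open>u\<close>.\<close>
  have mono: "\<exists>fs u r. list_all2 (\<in>) fs qs \<and> u \<notin> irrelevant_idl \<and> prod_list fs * r = u * single m 1"
    if "set qs \<subseteq> set ps" "length qs \<le> mon_degree m" for qs m
    using that
  proof (induction qs arbitrary: m)
    case Nil
    have "(1 :: ('x, 'k) mpoly) \<notin> irrelevant_idl" using prime_irrelevant_idl unfolding prime_idl_def by blast
    then show ?case by (intro exI[of _ "[]"] exI[of _ 1] exI[of _ "single m 1"]) simp
  next
    case (Cons q qs)
    show ?case
    proof (cases "q = irrelevant_idl")
      case True
      have "m \<noteq> 0" using Cons.prems(2) by auto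
      then obtain x where x: "lookup m x \<noteq> 0" by (metis poly_mapping_eqI lookup_zero)
      define m' where "m' = m - single x 1"
      have m: "m = single x 1 + m'"
        using x by (intro poly_mapping_eqI) (auto simp: m'_def lookup_add lookup_minus lookup_single when_def)
      then have "length qs \<le> mon_degree m'" using Cons.prems(2) by (simp add: mon_degree_add)
      then obtain fs u r where *: "list_all2 (\<in>) fs qs" "u \<notin> irrelevant_idl" "prod_list fs * r = u * single m' 1"
        using Cons.IH[of m'] Cons.prems(1) by auto
      have "prod_list (Var x # fs) * r = u * (Var x * single m' 1)"
        by (simp add: mult.assoc *(3) mult.left_commute[of u])
      also have "Var x * single m' 1 = (single m 1 :: ('x, 'k) mpoly)"
        by (simp add: Var_def mult_single m)
      finally show ?thesis using * True Var_irrelevant by (intro exI[of _ "Var x # fs"] exI[of _ u] exI[of _ r]) simp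
    next
      case False
      then obtain f where f: "f \<in> q" "f \<notin> irrelevant_idl" using only[of q] Cons.prems(1) by auto
      obtain fs u r where *: "list_all2 (\<in>) fs qs" "u \<notin> irrelevant_idl" "prod_list fs * r = u * single m 1"
        using Cons.IH[of m] Cons.prems by auto
      have "f * u \<notin> irrelevant_idl" using f * prime_idl_mult_iff[OF prime_irrelevant_idl] by blast
      moreover have "prod_list (f # fs) * r = (f * u) * single m 1" using *(3) by (simp add: mult_ac)
      ultimately show ?thesis using f * by (intro exI[of _ "f # fs"] exI[of _ "f * u"] exI[of _ r]) simp
    qed
  qed
  have mon: "single m a \<in> K" if m: "length ps \<le> mon_degree m" for m a
  proof -
    obtain fs u r where *: "list_all2 (\<in>) fs ps" "u \<notin> irrelevant_idl" "prod_list fs * r = u * single m 1"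
      using mono[OF order_refl m] by blast
    have "single m 1 * u \<in> K" using idl_mult_left[OF K ps(2)[OF *(1)], of r] *(3) by (simp add: mult.commute)
    \<comment> \<open>As \<open>K\<close> is homogeneous, it contains the lowest component of this
      product, in which \<open>u\<close> is replaced by its nonzero constant term.\<close>
    then have "hcomp (mon_degree m) (single m 1 * u) \<in> K" using 0(1) by (simp add: homog_idl_def)
    then have "single m 1 * Const (lookup u 0) \<in> K"
      by (simp add: hcomp_homog_mult[OF homog_single] hcomp_0_eq)
    then have "Const (a / lookup u 0) * (single m 1 * Const (lookup u 0)) \<in> K"
      by (rule idl.subspace_scale[OF K])
    moreover have "Const (a / lookup u 0) * (single m 1 * Const (lookup u 0)) = single m a"
      using *(2) by (simp add: irrelevant_idl_def Const_def mult_single)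
    ultimately show ?thesis by simp
  qed
  have "p \<in> K" if "length ps \<le> j" "homog j p" for j p
  proof -
    have "(\<Sum>m\<in>keys p. single m (lookup p m)) \<in> K"
      using that by (intro idl.subspace_sum[OF K] mon) (simp add: homog_def)
    then show ?thesis by (simp add: sum_single_keys)
  qed
  then show ?case by (intro exI[of _ "[]"] exI[of _ "length ps"]) simp
next
  case (Suc s)
  have K: "idl.subspace K" using Suc.prems(1) by (rule homog_idl_subspace)
  obtain ps where ps: "\<And>p. p \<in> set ps \<Longrightarrow> prime_idl p \<and> K \<subseteq> p"
    "\<And>fs. list_all2 (\<in>) fs ps \<Longrightarrow> prod_list fs \<in> K" using mpoly.prime_product[OF K] by blast
  have "\<exists>l. homog 1 l \<and> (\<forall>p\<in>{p \<in> set ps. p \<subset> irrelevant_idl}. l \<notin> p)"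
  proof (rule linear_form_avoiding)
    fix p assume p: "p \<in> {p \<in> set ps. p \<subset> irrelevant_idl}"
    then show "prime_idl p" using ps by auto
    then show "\<exists>x. Var x \<notin> p" using irrelevant_subset_iff[OF prime_idl_subspace, of p] p by blast
  qed simp
  then obtain l where l: "homog 1 l" "\<And>p. p \<in> set ps \<Longrightarrow> p \<subset> irrelevant_idl \<Longrightarrow> l \<notin> p" by blast
  have "\<exists>ls c. length ls = s \<and> (\<forall>l\<in>set ls. homog 1 l) \<and> (\<forall>j\<ge>c. \<forall>p. homog j p \<longrightarrow> p \<in> fold idl_add ls (idl_add l K))"
  proof (rule Suc.IH)
    show "homog_idl (idl_add l K)" using Suc.prems(1) l(1) by (rule homog_idl_add)
    show "idl_add l K \<subseteq> irrelevant_idl"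
      using Suc.prems(2) homog_1_irrelevant[OF l(1)] by (intro idl_add_least subspace_irrelevant_idl)
    fix Q k assume Q: "prime_chain Q k" "idl_add l K \<subseteq> Q 0" "Q k = irrelevant_idl"
    have Q0: "prime_idl (Q 0)" using Q(1) by (simp add: prime_chain_def)
    have KQ: "K \<subseteq> Q 0" using Q(2) idl_add_superset[OF K] by blast
    \<comment> \<open>Otherwise factors outside \<open>Q 0\<close>, one from each prime of the list,
      would have a product in \<open>K \<subseteq> Q 0\<close>.\<close>
    have "\<exists>p\<in>set ps. p \<subseteq> Q 0"
    proof (rule ccontr)
      assume "\<not> ?thesis"
      then have "\<forall>p\<in>set ps. \<exists>f. f \<in> p \<and> f \<notin> Q 0" by blast
      then obtain f where f: "\<And>p. p \<in> set ps \<Longrightarrow> f p \<in> p \<and> f p \<notin> Q 0" by metis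
      have "list_all2 (\<in>) (map f ps) ps" using f by (simp add: list_all2_map1 list_all2_same)
      then have "prod_list (map f ps) \<in> Q 0" using ps(2) KQ by blast
      then show False using prime_idl_prod_list[OF Q0] f by fastforce
    qed
    then obtain p where p: "p \<in> set ps" "p \<subseteq> Q 0" by blast
    have Qi: "Q 0 \<subseteq> irrelevant_idl" using prime_chain_le[OF Q(1) order_refl] Q(3) by simp
    show "k \<le> s"
    proof (cases "p = irrelevant_idl")
      \<comment> \<open>\<open>Q 0\<close> is squeezed between \<open>p\<close> and the irrelevant
        ideal, so the chain has length 0.\<close>
      case True
      then have "Q 0 = Q k" using p(2) Qi Q(3) by blast
      then have "k = 0" using prime_chain_less[of Q "k - 1"] Q(1) by (cases k) auto
      then show ?thesis by simp
    next
      case False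
      then have "l \<notin> p" using l(2)[OF p(1)] p(2) Qi by blast
      moreover have "l \<in> Q 0" using Q(2) idl_add_self[OF K] by blast
      ultimately have "p \<subset> Q 0" using p(2) by blast
      then have "prime_chain (case_nat p Q) (Suc k)" using ps(1)[OF p(1)] by (intro prime_chain_Cons Q(1)) auto
      then have "Suc k \<le> Suc s" using ps(1)[OF p(1)] Q(3) by (intro Suc.prems(3)[of "case_nat p Q"]) auto
      then show ?thesis by simp
    qed
  qed
  then obtain ls c where "length ls = s" "\<forall>l\<in>set ls. homog 1 l"
    "\<forall>j\<ge>c. \<forall>p. homog j p \<longrightarrow> p \<in> fold idl_add ls (idl_add l K)" by blast
  then show ?case using l(1) by (intro exI[of _ "l # ls"] exI[of _ c]) simp
qed

lemma growth_le_of_chains: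
  fixes K :: "('x::finite, 'k::field_char_0) mpoly set"
  assumes "homog_idl K" "K \<subseteq> irrelevant_idl"
    and "\<And>Q k. prime_chain Q k \<Longrightarrow> K \<subseteq> Q 0 \<Longrightarrow> Q k = irrelevant_idl \<Longrightarrow> k \<le> s"
  shows "growth_le K s"
proof -
  obtain ls c where "length ls = s" "\<forall>l\<in>set ls. homog 1 l" "\<forall>j\<ge>c. \<forall>p. homog j p \<longrightarrow> p \<in> fold idl_add ls K"
    using linear_parameters[of K s] assms by blast
  then show ?thesis using growth_le_linear[OF assms(1), of ls c] by blast
qed

section \<open>Translating homogeneous regular sequences\<close>

text \<open>\<open>leading_forms K K0\<close> says that \<open>K0\<close> is the ideal of leading forms of \<open>K\<close>. It is stated degree by
  degree, since \<open>hcomp d u\<close> with \<open>deg_le d u\<close> may be \<open>0\<close>.\<close>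

definition leading_forms :: "('x::finite, 'k::field) mpoly set \<Rightarrow> ('x, 'k) mpoly set \<Rightarrow> bool"
  where "leading_forms K K0 \<longleftrightarrow> idl.subspace K \<and> homog_idl K0 \<and>
    (\<forall>d u. u \<in> K \<longrightarrow> deg_le d u \<longrightarrow> hcomp d u \<in> K0) \<and>
    (\<forall>d h. h \<in> K0 \<longrightarrow> homog d h \<longrightarrow> (\<exists>g\<in>K. deg_le d g \<and> hcomp d g = h))"

lemma leading_forms_homog: "homog_idl K \<Longrightarrow> leading_forms K K"
  by (auto simp: leading_forms_def homog_idl_def homog_iff_hcomp intro!: deg_le_homog)

lemma deg_le_shift: "homog 1 l \<Longrightarrow> deg_le d u \<Longrightarrow> deg_le (Suc d) ((l - Const c) * u)"
  using deg_le_mult[of 1 "l - Const c" d u]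
  by (auto intro!: deg_le_diff deg_le_mono[OF deg_le_homog[OF homog_Const[of c]]] dest: deg_le_homog)

lemma hcomp_shift: "homog 1 l \<Longrightarrow> hcomp (Suc d) ((l - Const c) * u) = l * hcomp d u - Const c * hcomp (Suc d) u"
  by (simp add: left_diff_distrib hcomp_diff hcomp_homog_mult[of 1 l] hcomp_homog_mult[OF homog_Const])

lemma deg_le_reduce: "deg_le d u \<Longrightarrow> hcomp d u = 0 \<Longrightarrow> u = 0 \<or> (\<exists>e. d = Suc e \<and> deg_le e u)"
  by (cases d) (auto dest: deg_le_step deg_le_0D simp: hcomp_0_eq)

text \<open>The leading form of \<open>(l - Const c) * u\<close> is \<open>l\<close> times that of
  \<open>u\<close>, so the latter lies in \<open>K0\<close>; subtracting an element of
  \<open>K\<close> with the same leading form lowers the degree of \<open>u\<close>.\<close>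

lemma leading_forms_regular:
  fixes K :: "('x::finite, 'k::field) mpoly set"
  assumes LF: "leading_forms K K0" and l: "homog 1 l" "regular_mod K0 l"
  shows "regular_mod K (l - Const c)"
proof -
  have K: "idl.subspace K" using LF by (simp add: leading_forms_def)
  have "u \<in> K" if "deg_le d u" "(l - Const c) * u \<in> K" for d u
    using that
  proof (induction d arbitrary: u rule: less_induct)
    case (less d)
    have "hcomp (Suc d) ((l - Const c) * u) \<in> K0"
      using LF less.prems deg_le_shift[OF l(1) less.prems(1)] unfolding leading_forms_def by blast
    moreover have "hcomp (Suc d) u = 0" using less.prems(1) by (simp add: deg_le_iff)
    ultimately have "l * hcomp d u \<in> K0" by (simp add: hcomp_shift[OF l(1)])
    then have "hcomp d u \<in> K0" using l(2) by (simp add: regular_mod_def)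
    then obtain g where g: "g \<in> K" "deg_le d g" "hcomp d g = hcomp d u"
      using LF homog_hcomp[of d u] unfolding leading_forms_def by blast
    have "deg_le d (u - g)" "hcomp d (u - g) = 0" using less.prems g by (auto simp: deg_le_diff hcomp_diff)
    then consider "u - g = 0" | e where "d = Suc e" "deg_le e (u - g)" using deg_le_reduce by blast
    then have "u - g \<in> K"
    proof cases
      case 2
      have "(l - Const c) * (u - g) \<in> K"
        unfolding right_diff_distrib[of "l - Const c"]
        by (intro idl.subspace_diff[OF K] less.prems(2) idl.subspace_scale[OF K] g(1))
      then show ?thesis using less.IH[of e] 2 by simp
    qed (simp add: idl.subspace_0[OF K])
    then have "(u - g) + g \<in> K" using g(1) idl.subspace_add[OF K] by blast
    then show ?case by simp
  qed
  then show ?thesis unfolding regular_mod_def using deg_le_exists by blast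
qed

text \<open>Leading forms of a sum could escape K0 + (l) only if the top degrees of its two summands
  cancel, and regularity of \<open>l\<close> modulo \<open>K0\<close> allows such a sum to be
  rewritten with a smaller multiplier.\<close>

lemma leading_forms_idl_add:
  fixes K :: "('x::finite, 'k::field) mpoly set"
  assumes LF: "leading_forms K K0" and l: "homog 1 l" "regular_mod K0 l"
  shows "leading_forms (idl_add (l - Const c) K) (idl_add l K0)"
proof -
  have K: "idl.subspace K" and hK0: "homog_idl K0"
    and a: "\<And>d u. u \<in> K \<Longrightarrow> deg_le d u \<Longrightarrow> hcomp d u \<in> K0"
    and b: "\<And>d h. h \<in> K0 \<Longrightarrow> homog d h \<Longrightarrow> \<exists>g\<in>K. deg_le d g \<and> hcomp d g = h"
    using LF by (auto simp: leading_forms_def)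
  have K0: "idl.subspace K0" using hK0 by (rule homog_idl_subspace)
  have A: "hcomp d (g + (l - Const c) * u) \<in> idl_add l K0"
    if "g \<in> K" "deg_le e u" "deg_le d (g + (l - Const c) * u)" for d e g u
    using that
  proof (induction e arbitrary: g u rule: less_induct)
    case (less e)
    let ?w = "g + (l - Const c) * u"
    show ?case
    proof (cases "Suc e \<le> d")
      case True
      then obtain d' where d': "d = Suc d'" by (cases d) auto
      have "deg_le d (?w - (l - Const c) * u)"
        using True by (intro deg_le_diff less.prems deg_le_mono[OF deg_le_shift[OF l(1) less.prems(2)]])
      then have "hcomp d g \<in> K0" using a[OF less.prems(1)] by simp
      moreover have "hcomp d u = 0" using less.prems(2) True by (simp add: deg_le_iff)
      ultimately have "hcomp d ?w - hcomp d' u * l \<in> K0"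
        unfolding d' hcomp_add hcomp_shift[OF l(1)] by (simp add: mult.commute)
      then show ?thesis by (rule idl_addI)
    next
      \<comment> \<open>The bound on \<open>u\<close> exceeds what the degree of the sum permits, so
        the top terms cancel and \<open>l * hcomp e u \<in> K0\<close>. Then
        \<open>hcomp e u\<close> is the leading form of some \<open>g'\<close> in \<open>K\<close>,
        and moving \<open>(l - Const c) * g'\<close> into \<open>g\<close> lowers the degree of the
        multiplier.\<close>
      case False
      have "deg_le (Suc e) (?w - (l - Const c) * u)"
        using False by (intro deg_le_diff deg_le_mono[OF less.prems(3)] deg_le_shift[OF l(1) less.prems(2)]) simp
      then have "hcomp (Suc e) g \<in> K0" using a[OF less.prems(1)] by simp
      moreover have "hcomp (Suc e) ?w = 0" using less.prems(3) False by (simp add: deg_le_iff)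
      moreover have "hcomp (Suc e) u = 0" using less.prems(2) by (simp add: deg_le_iff)
      ultimately have "- (l * hcomp e u) \<in> K0" by (simp add: hcomp_add hcomp_shift[OF l(1)] add_eq_0_iff2)
      then have "l * hcomp e u \<in> K0" using idl.subspace_neg[OF K0, of "- (l * hcomp e u)"] by simp
      then have "hcomp e u \<in> K0" using l(2) by (simp add: regular_mod_def)
      then obtain g' where g': "g' \<in> K" "deg_le e g'" "hcomp e g' = hcomp e u" using b[OF _ homog_hcomp] by blast
      have gK: "g + (l - Const c) * g' \<in> K" using less.prems(1) g'(1) K by (intro idl.subspace_add idl.subspace_scale)
      have w: "?w = (g + (l - Const c) * g') + (l - Const c) * (u - g')" by (simp add: algebra_simps)
      have "deg_le e (u - g')" "hcomp e (u - g') = 0" using less.prems g' by (auto simp: deg_le_diff hcomp_diff)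
      then consider "u - g' = 0" | e' where "e = Suc e'" "deg_le e' (u - g')" using deg_le_reduce by blast
      then show ?thesis
      proof cases
        case 1
        then have "?w = g + (l - Const c) * g'" using w by simp
        then have "hcomp d ?w \<in> K0" using a[OF gK] less.prems(3) by simp
        then show ?thesis using idl_add_superset[OF K0] by blast
      next
        case 2
        then show ?thesis
          unfolding w using less.prems(3)[unfolded w] by (intro less.IH[of e'] gK) simp_all
      qed
    qed
  qed
  have B: "\<exists>g\<in>idl_add (l - Const c) K. deg_le d g \<and> hcomp d g = h" if hl: "h \<in> idl_add l K0" "homog d h" for d h
  proof -
    obtain k where k: "h - k * l \<in> K0" using hl(1) by (auto simp: idl_add_def)
    have "hcomp d (h - k * l) \<in> K0" using hK0 k by (simp add: homog_idl_def)
    then obtain g0 where g0: "g0 \<in> K" "deg_le d g0" "hcomp d g0 = hcomp d (h - k * l)" using b[OF _ homog_hcomp] by blast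
    have h: "hcomp d g0 = h - hcomp d (l * k)" using g0(3) hl(2) by (simp add: hcomp_diff homog_iff_hcomp mult.commute)
    show ?thesis
    proof (cases d)
      case 0
      then have "hcomp d g0 = h" using h l(1) by (simp add: hcomp_homog_mult)
      then show ?thesis using g0 idl_add_superset[OF K] by blast
    next
      case (Suc d')
      define v where "v = hcomp d' k"
      have v: "homog d' v" by (simp add: v_def homog_hcomp)
      have "hcomp d (l * k) = l * v" using l(1) Suc by (simp add: hcomp_homog_mult v_def)
      moreover have "hcomp (Suc d') v = 0" using v by (simp add: hcomp_homog)
      moreover have "hcomp d' v = v" using v by (simp add: homog_iff_hcomp)
      ultimately have "hcomp d (g0 + (l - Const c) * v) = h"
        using h by (simp add: Suc hcomp_add hcomp_shift[OF l(1)])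
      moreover have "deg_le d (g0 + (l - Const c) * v)"
        unfolding Suc using g0(2) Suc deg_le_shift[OF l(1) deg_le_homog[OF v]] by (intro deg_le_add) simp_all
      moreover have "g0 + (l - Const c) * v \<in> idl_add (l - Const c) K"
        using g0(1) by (intro idl_addI[of _ v]) (simp add: mult.commute)
      ultimately show ?thesis by blast
    qed
  qed
  have "hcomp d w \<in> idl_add l K0" if w: "w \<in> idl_add (l - Const c) K" "deg_le d w" for d w
  proof -
    obtain u where u: "w - u * (l - Const c) \<in> K" using w(1) by (auto simp: idl_add_def)
    obtain e where "deg_le e u" using deg_le_exists by blast
    then show ?thesis using A[OF u, of e u d] w(2) by (simp add: mult.commute)
  qed
  then show ?thesis
    using B subspace_idl_add[OF K] homog_idl_add[OF hK0 l(1)] by (auto simp: leading_forms_def)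
qed

text \<open>To be started with \<open>K = K0\<close> homogeneous; the two ideals separate in the
  course of the induction, hence the general form.\<close>

lemma regs_shift:
  fixes K :: "('x::finite, 'k::field) mpoly set"
  assumes "leading_forms K K0" "\<And>l. l \<in> set ls \<Longrightarrow> homog 1 l" "regs K0 ls"
  shows "regs K (map (\<lambda>l. l - Const (c l)) ls)"
  using assms
proof (induction ls arbitrary: K K0)
  case (Cons l ls)
  have "regular_mod K (l - Const (c l))"
    by (rule leading_forms_regular[OF Cons.prems(1)]) (use Cons.prems in auto)
  moreover have "leading_forms (idl_add (l - Const (c l)) K) (idl_add l K0)"
    using Cons.prems by (intro leading_forms_idl_add) auto
  ultimately show ?case using Cons by auto
qed simp

section \<open>Weak Nullstellensatz\<close>

lemma mpoly_Var_induct [case_names Const Var add]: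
  fixes p :: "('x::finite, 'k::comm_ring_1) mpoly"
  assumes C: "\<And>a. P (Const a)" and V: "\<And>x p. P p \<Longrightarrow> P (Var x * p)" and A: "\<And>p q. P p \<Longrightarrow> P q \<Longrightarrow> P (p + q)"
  shows "P p"
proof (induction p rule: poly_mapping_add_induct)
  case (single m a)
  have pw: "P (Var x ^ n * p)" if "P p" for x n p
    using that by (induction n) (simp_all add: V mult.assoc)
  have pr: "P ((\<Prod>x\<in>S. Var x ^ lookup m x) * Const a)" if "finite S" for S
    using that by (induction S rule: finite_induct) (simp_all add: C pw mult.assoc)
  from pr[of UNIV] show ?case by (simp add: prod_Var_power Const_def mult_single)
qed (rule A)

text \<open>Over an algebraically closed field \<open>h\<close> splits into linear factors, and a
  prime containing their product contains one of them.\<close>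

lemma prime_idl_root:
  fixes P :: "('x::finite, 'k::alg_closed_field) mpoly set"
  assumes P: "prime_idl P" and "h \<noteq> 0" "poly (map_poly Const h) (Var x) \<in> P"
  shows "\<exists>c. Var x - Const c \<in> P"
  using assms(2,3)
proof (induction "degree h" arbitrary: h)
  case 0
  then obtain c where c: "h = [:c:]" by (metis degree_eq_zeroE)
  then have "c \<noteq> 0" "Const c \<in> P" using 0 by (auto simp: map_poly_pCons)
  then have "Const (inverse c) * Const c \<in> P" using idl.subspace_scale[OF prime_idl_subspace[OF P]] by blast
  then have "1 \<in> P" using \<open>c \<noteq> 0\<close> by (simp flip: Const_mult)
  then show ?case using P by (simp add: prime_idl_def)
next
  case (Suc n)
  then obtain r where "poly h r = 0" using alg_closed_imp_poly_has_root[of h] by auto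
  then obtain h' where h': "h = [:- r, 1:] * h'" by (metis poly_eq_0_iff_dvd dvdE)
  have "h' \<noteq> 0" using h' Suc.prems(1) by auto
  then have "degree h' = n" using Suc.hyps(2) unfolding h' by (simp add: degree_mult_eq del: mult_pCons_left)
  have "(map_poly Const h :: ('x, 'k) mpoly poly) = [:- Const r, 1:] * map_poly Const h'"
    by (rule poly_eqI) (simp add: h' coeff_map_poly Const_diff Const_mult coeff_pCons Const_add Const_uminus split: nat.splits)
  then have "poly (map_poly Const h) (Var x) = (Var x - Const r) * poly (map_poly Const h') (Var x)"
    by (simp only: poly_mult) simp
  then have "(Var x - Const r) * poly (map_poly Const h') (Var x) \<in> P" using Suc.prems(2) by simp
  then show ?case using Suc.hyps(1)[of h'] \<open>h' \<noteq> 0\<close> \<open>_ = n\<close> prime_idl_mult_iff[OF P] by blast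
qed

section \<open>Residue class rings as modules over the polynomials in \<open>W\<close>\<close>

definition span_mod :: "'x set \<Rightarrow> ('x::finite, 'k::field) mpoly set \<Rightarrow> ('x, 'k) mpoly set \<Rightarrow> ('x, 'k) mpoly set"
  where "span_mod W P E = {p. \<exists>b. (\<forall>e. in_vars W (b e)) \<and> p - (\<Sum>e\<in>E. b e * e) \<in> P}"

lemma span_mod_base: "idl.subspace P \<Longrightarrow> finite E \<Longrightarrow> e \<in> E \<Longrightarrow> e \<in> span_mod W P E"
  unfolding span_mod_def
  by (intro CollectI exI[of _ "\<lambda>x. if x = e then 1 else 0"])
     (simp add: if_distrib[of "\<lambda>b. b * _"] sum.delta idl.subspace_0 cong: if_cong)

lemma span_mod_ideal: "p \<in> P \<Longrightarrow> p \<in> span_mod W P E"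
  unfolding span_mod_def by (intro CollectI exI[of _ "\<lambda>_. 0"]) simp

lemma span_mod_add: "idl.subspace P \<Longrightarrow> p \<in> span_mod W P E \<Longrightarrow> q \<in> span_mod W P E \<Longrightarrow> p + q \<in> span_mod W P E"
proof -
  assume P: "idl.subspace P" and "p \<in> span_mod W P E" "q \<in> span_mod W P E"
  then obtain b c where bc: "\<forall>e. in_vars W (b e)" "p - (\<Sum>e\<in>E. b e * e) \<in> P"
    "\<forall>e. in_vars W (c e)" "q - (\<Sum>e\<in>E. c e * e) \<in> P" by (auto simp: span_mod_def)
  have "(p + q) - (\<Sum>e\<in>E. (b e + c e) * e) = (p - (\<Sum>e\<in>E. b e * e)) + (q - (\<Sum>e\<in>E. c e * e))"
    by (simp add: distrib_right sum.distrib)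
  also have "\<dots> \<in> P" using bc P by (intro idl.subspace_add)
  finally show ?thesis
    using bc unfolding span_mod_def by (intro CollectI exI[of _ "\<lambda>e. b e + c e"]) (simp add: in_vars_add)
qed

lemma span_mod_mult: "idl.subspace P \<Longrightarrow> in_vars W r \<Longrightarrow> p \<in> span_mod W P E \<Longrightarrow> r * p \<in> span_mod W P E"
proof -
  assume P: "idl.subspace P" and r: "in_vars W r" and "p \<in> span_mod W P E"
  then obtain b where b: "\<forall>e. in_vars W (b e)" "p - (\<Sum>e\<in>E. b e * e) \<in> P" by (auto simp: span_mod_def)
  have "r * p - (\<Sum>e\<in>E. (r * b e) * e) = r * (p - (\<Sum>e\<in>E. b e * e))"
    by (simp add: right_diff_distrib sum_distrib_left mult.assoc)
  also have "\<dots> \<in> P" using b P by (intro idl.subspace_scale)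
  finally show ?thesis
    using b r unfolding span_mod_def by (intro CollectI exI[of _ "\<lambda>e. r * b e"]) (simp add: in_vars_mult)
qed

lemma span_mod_sum:
  "idl.subspace P \<Longrightarrow> (\<And>i. i \<in> I \<Longrightarrow> f i \<in> span_mod W P E) \<Longrightarrow> sum f I \<in> span_mod W P E"
  by (induction I rule: infinite_finite_induct)
     (auto intro: span_mod_add span_mod_ideal idl.subspace_0)

lemma span_mod_induct:
  assumes P: "idl.subspace P" and E: "finite E" and p: "p \<in> span_mod W P E"
    and S: "\<And>p. p \<in> P \<Longrightarrow> p \<in> S" "\<And>p q. p \<in> S \<Longrightarrow> q \<in> S \<Longrightarrow> p + q \<in> S"
      "\<And>r p. in_vars W r \<Longrightarrow> p \<in> S \<Longrightarrow> r * p \<in> S" "\<And>e. e \<in> E \<Longrightarrow> e \<in> S"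
  shows "p \<in> S"
proof -
  obtain b where b: "\<forall>e. in_vars W (b e)" "p - (\<Sum>e\<in>E. b e * e) \<in> P" using p by (auto simp: span_mod_def)
  have "(\<Sum>e\<in>E'. b e * e) \<in> S" if "finite E'" "E' \<subseteq> E" for E'
    using that
  proof (induction E' rule: finite_induct)
    case empty
    then show ?case using S(1) idl.subspace_0[OF P] by simp
  qed (use b S in auto)
  then have "(p - (\<Sum>e\<in>E. b e * e)) + (\<Sum>e\<in>E. b e * e) \<in> S" using S(1,2) b E by blast
  then show ?thesis by simp
qed

text \<open>If the variables in \<open>W\<close> are a transcendence basis modulo \<open>P\<close>, then after inverting some
  \<open>h \<in> k[W]\<close> the residue class ring becomes a finite module over \<open>k[W]\<close>.\<close>

lemma generically_finite:
  fixes P :: "('x::finite, 'k::field) mpoly set"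
  assumes P: "prime_idl P" and ind: "\<And>p. p \<in> P \<Longrightarrow> in_vars W p \<Longrightarrow> p = 0"
    and dep: "\<And>x. x \<notin> W \<Longrightarrow> \<exists>g\<in>P. g \<noteq> 0 \<and> in_vars (insert x W) g"
  shows "\<exists>h E. h \<noteq> 0 \<and> in_vars W h \<and> finite E \<and> 1 \<in> E \<and> (\<forall>a. \<exists>M. h ^ M * a \<in> span_mod W P E)"
proof -
  have Ps: "idl.subspace P" using P by (rule prime_idl_subspace)
  obtain g where g: "\<And>x. x \<notin> W \<Longrightarrow> g x \<in> P" "\<And>x. x \<notin> W \<Longrightarrow> g x \<noteq> 0" "\<And>x. x \<notin> W \<Longrightarrow> in_vars (insert x W) (g x)"
    using dep by metis
  define n where "n = (\<lambda>x. degree (split_var x (g x)))"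
  define lc where "lc = (\<lambda>x. coeff (split_var x (g x)) (n x))"
  have co: "in_vars W (coeff (split_var x (g x)) i)" if "x \<notin> W" for x i
    using in_vars_coeff_split_var[OF g(3)[OF that], of x i] that by simp
  have lc: "lc x \<noteq> 0" "in_vars W (lc x)" if "x \<notin> W" for x
    using g(2)[OF that] co[OF that] by (auto simp: lc_def n_def)
  have g_eq: "g x = lc x * Var x ^ n x + (\<Sum>i<n x. coeff (split_var x (g x)) i * Var x ^ i)" for x
  proof -
    have "g x = (\<Sum>i\<le>n x. coeff (split_var x (g x)) i * Var x ^ i)"
      using poly_split_var[of x "g x"] unfolding poly_altdef n_def by simp
    then show ?thesis by (simp add: lc_def lessThan_Suc_atMost[symmetric] add.commute)
  qed
  have n_pos: "0 < n x" if "x \<notin> W" for x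
  proof (rule ccontr)
    assume "\<not> 0 < n x"
    then have "g x = lc x" using g_eq[of x] by simp
    then show False using ind[OF g(1)[OF that]] lc[OF that] by simp
  qed
  \<comment> \<open>Inverting \<open>h\<close> inverts the leading coefficients of all relations
    \<open>g x\<close> with \<open>x\<close> outside \<open>W\<close>.\<close>
  define h where "h = (\<Prod>x\<in>- W. lc x)"
  have h0: "h \<noteq> 0" using mpoly_prod_eq_0[of "- W" lc] lc by (auto simp: h_def)
  have hW: "in_vars W h" unfolding h_def by (intro in_vars_prod lc) simp
  \<comment> \<open>Monomials in the dependent variables, with exponents below the degrees of the
    relations.\<close>
  define Mo where "Mo = {m. keys m \<subseteq> - W \<and> (\<forall>x\<in>- W. lookup m x < n x)}"
  have "mon_degree m < Suc (\<Sum>x\<in>UNIV. n x)" if "m \<in> Mo" for m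
  proof -
    have "lookup m x \<le> n x" for x
      using that by (cases "x \<in> W") (auto simp: Mo_def in_keys_iff subset_iff intro: less_imp_le)
    then show ?thesis unfolding mon_degree_def by (simp add: less_Suc_eq_le sum_mono)
  qed
  then have finMo: "finite Mo" by (intro finite_subset[OF _ finite_mon_degree_less]) auto
  define E where "E = (\<lambda>m. single m (1 :: 'k)) ` Mo"
  have finE: "finite E" using finMo by (simp add: E_def)
  have "0 \<in> Mo" using n_pos by (simp add: Mo_def)
  then have E1: "1 \<in> E" unfolding E_def by (intro image_eqI[of _ _ 0]) auto
  have step: "h * (Var x * e) \<in> span_mod W P E" if x: "x \<notin> W" and e: "e \<in> E" for x e
  proof -
    obtain m where m: "m \<in> Mo" "e = single m 1" using e by (auto simp: E_def)
    define m' where "m' = m - single x (lookup m x)"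
    have lm': "lookup m' y = (if y = x then 0 else lookup m y)" for y
      by (simp add: m'_def lookup_minus lookup_single when_def)
    have mm': "m = m' + single x (lookup m x)"
      by (rule poly_mapping_eqI) (auto simp: lookup_add lm' lookup_single when_def)
    have inE: "single m' 1 * Var x ^ i \<in> E" if "i < n x" for i
    proof -
      have "m' + single x i \<in> Mo"
        using m(1) that x unfolding Mo_def
        by (auto simp: in_keys_iff lookup_add lm' lookup_single when_def subset_iff split: if_splits)
      then show ?thesis by (auto simp: E_def Var_power mult_single)
    qed
    have e_eq: "Var x * e = single m' 1 * Var x ^ Suc (lookup m x)"
      unfolding m(2) Var_power[of x "Suc _"] mult_single
      by (subst mm') (simp add: Var_def mult_single add_ac flip: single_add)
    show ?thesis
    proof (cases "Suc (lookup m x) < n x")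
      case True
      then have "Var x * e \<in> E" using inE[OF True] by (simp only: e_eq)
      then show ?thesis by (intro span_mod_mult[OF Ps hW] span_mod_base[OF Ps finE])
    next
      \<comment> \<open>The exponent of \<open>x\<close> reaches the degree of \<open>g x\<close>,
        whose leading coefficient divides \<open>h\<close>; the relation trades the top power for
        lower ones.\<close>
      case False
      moreover have "lookup m x < n x" using m(1) x by (simp add: Mo_def)
      ultimately have nx: "Suc (lookup m x) = n x" by simp
      let ?s = "single m' (1 :: 'k)"
      have "lc x * (Var x * e) = ?s * g x - (\<Sum>i<n x. coeff (split_var x (g x)) i * (?s * Var x ^ i))"
        unfolding e_eq nx by (subst g_eq) (simp add: algebra_simps sum_distrib_left)
      also have "\<dots> = ?s * g x + (\<Sum>i<n x. (- coeff (split_var x (g x)) i) * (?s * Var x ^ i))"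
        by (simp add: sum_negf)
      also have "\<dots> \<in> span_mod W P E"
        using inE by (intro span_mod_add[OF Ps] span_mod_sum[OF Ps] span_mod_mult[OF Ps] span_mod_base[OF Ps finE]
            span_mod_ideal idl.subspace_scale[OF Ps] g(1)[OF x] in_vars_uminus co[OF x]) auto
      finally have *: "lc x * (Var x * e) \<in> span_mod W P E" .
      have "h * (Var x * e) = (\<Prod>y\<in>- W - {x}. lc y) * (lc x * (Var x * e))"
        unfolding h_def using x by (subst prod.remove[of _ x]) (auto simp: mult_ac)
      also have "\<dots> \<in> span_mod W P E" by (intro span_mod_mult[OF Ps _ *] in_vars_prod lc) auto
      finally show ?thesis .
    qed
  qed
  have stepV: "h * (Var x * p) \<in> span_mod W P E" if p: "p \<in> span_mod W P E" for x p
  proof (cases "x \<in> W")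
    case True
    then show ?thesis using p by (intro span_mod_mult[OF Ps] hW) (simp_all add: in_vars_Var)
  next
    case False
    have "p \<in> {p. h * (Var x * p) \<in> span_mod W P E}"
    proof (rule span_mod_induct[OF Ps finE p])
      fix r q :: "('x, 'k) mpoly" assume "in_vars W r" "q \<in> {p. h * (Var x * p) \<in> span_mod W P E}"
      then have "r * (h * (Var x * q)) \<in> span_mod W P E" using span_mod_mult[OF Ps] by blast
      then show "r * q \<in> {p. h * (Var x * p) \<in> span_mod W P E}" by (simp add: mult_ac)
    qed (use step[OF False] span_mod_add[OF Ps] idl.subspace_scale[OF Ps] in
        \<open>auto simp: distrib_left intro: span_mod_ideal\<close>)
    then show ?thesis by simp
  qed
  have "\<exists>M. h ^ M * a \<in> span_mod W P E" for a
  proof (induction a rule: mpoly_Var_induct)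
    case (Const c)
    have "Const c * 1 \<in> span_mod W P E" by (intro span_mod_mult[OF Ps] span_mod_base[OF Ps finE E1]) simp
    then show ?case by (intro exI[of _ 0]) simp
  next
    case (Var x p)
    then obtain M where "h ^ M * p \<in> span_mod W P E" by blast
    from stepV[OF this, of x] show ?case by (intro exI[of _ "Suc M"]) (simp add: mult_ac)
  next
    case (add p q)
    then obtain M N where MN: "h ^ M * p \<in> span_mod W P E" "h ^ N * q \<in> span_mod W P E" by blast
    have "h ^ N * (h ^ M * p) + h ^ M * (h ^ N * q) \<in> span_mod W P E"
      using span_mod_add[OF Ps span_mod_mult[OF Ps in_vars_power[OF hW] MN(1)]
          span_mod_mult[OF Ps in_vars_power[OF hW] MN(2)]] .
    then show ?case by (intro exI[of _ "M + N"]) (simp add: power_add algebra_simps)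
  qed
  then show ?thesis using h0 hW finE E1 by blast
qed

definition indep_over :: "'x set \<Rightarrow> ('x::finite, 'k::field) mpoly set \<Rightarrow> ('x, 'k) mpoly set \<Rightarrow> bool"
  where "indep_over W P E \<longleftrightarrow> (\<forall>b. (\<forall>e. in_vars W (b e)) \<longrightarrow> (\<Sum>e\<in>E. b e * e) \<in> P \<longrightarrow> (\<forall>e\<in>E. b e = 0))"

text \<open>A largest independent part \<open>B\<close> of the spanning set still spans once the
  denominators \<open>d e\<close> of the other elements are inverted too. The element 1 is kept in
  \<open>B\<close> so that its coefficients can be compared later.\<close>

lemma generically_free:
  fixes P :: "('x::finite, 'k::field) mpoly set"
  assumes P: "prime_idl P" and ind: "\<And>p. p \<in> P \<Longrightarrow> in_vars W p \<Longrightarrow> p = 0"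
    and dep: "\<And>x. x \<notin> W \<Longrightarrow> \<exists>g\<in>P. g \<noteq> 0 \<and> in_vars (insert x W) g"
  shows "\<exists>h E. h \<noteq> 0 \<and> in_vars W h \<and> finite E \<and> 1 \<in> E \<and> indep_over W P E \<and>
    (\<forall>a. \<exists>M. h ^ M * a \<in> span_mod W P E)"
proof -
  have Ps: "idl.subspace P" using P by (rule prime_idl_subspace)
  obtain h E where hE: "h \<noteq> 0" "in_vars W h" "finite E" "1 \<in> E" "\<And>a. \<exists>M. h ^ M * a \<in> span_mod W P E"
    using generically_finite[OF assms] by blast
  let ?I = "\<lambda>B. B \<subseteq> E \<and> 1 \<in> B \<and> indep_over W P B"
  have "?I {1}" using ind hE(4) by (auto simp: indep_over_def)
  then have "\<exists>B. ?I B \<and> (\<forall>B'. ?I B' \<longrightarrow> card B' \<le> card B)"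
    by (rule ex_has_greatest_nat[of ?I "{1}" card "Suc (card E)"]) (simp add: card_mono[OF hE(3)] le_imp_less_Suc)
  then obtain B where B: "?I B" and Bmax: "\<And>B'. ?I B' \<Longrightarrow> card B' \<le> card B" by blast
  have finB: "finite B" using B hE(3) finite_subset by blast
  have "\<exists>d. d \<noteq> 0 \<and> in_vars W d \<and> d * e \<in> span_mod W P B" if e: "e \<in> E" for e
  proof (cases "e \<in> B")
    case True
    then show ?thesis using span_mod_base[OF Ps finB] by (intro exI[of _ 1]) simp
  next
    case False
    then have "\<not> ?I (insert e B)" using Bmax[of "insert e B"] finB by auto
    then have "\<not> indep_over W P (insert e B)" using e B by blast
    then obtain b where b: "\<And>e. in_vars W (b e)" "(\<Sum>e\<in>insert e B. b e * e) \<in> P" "\<exists>e'\<in>insert e B. b e' \<noteq> 0"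
      unfolding indep_over_def by blast
    have sm: "b e * e + (\<Sum>e\<in>B. b e * e) \<in> P" using b(2) finB False by simp
    have "b e \<noteq> 0"
    proof
      assume be: "b e = 0"
      then have "(\<Sum>e\<in>B. b e * e) \<in> P" using sm by simp
      then have "\<forall>e\<in>B. b e = 0" using B b(1) unfolding indep_over_def by blast
      then show False using b(3) be by auto
    qed
    moreover have "b e * e \<in> span_mod W P B"
      unfolding span_mod_def
      using b(1) sm by (intro CollectI exI[of _ "\<lambda>e. - b e"]) (auto simp: in_vars_uminus sum_negf)
    ultimately show ?thesis using b(1) by blast
  qed
  then obtain d where d: "\<And>e. e \<in> E \<Longrightarrow> d e \<noteq> 0" "\<And>e. e \<in> E \<Longrightarrow> in_vars W (d e)"
    "\<And>e. e \<in> E \<Longrightarrow> d e * e \<in> span_mod W P B" by metis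
  define D where "D = prod d E"
  have D0: "D \<noteq> 0" using mpoly_prod_eq_0[OF hE(3), of d] d(1) by (auto simp: D_def)
  have DW: "in_vars W D" unfolding D_def by (intro in_vars_prod d)
  have De: "D * e \<in> span_mod W P B" if e: "e \<in> E" for e
  proof -
    have "D * e = prod d (E - {e}) * (d e * e)" unfolding D_def using hE(3) e by (simp add: prod.remove mult_ac)
    also have "\<dots> \<in> span_mod W P B" using d e by (intro span_mod_mult[OF Ps _ d(3)] in_vars_prod) auto
    finally show ?thesis .
  qed
  have Dp: "D * p \<in> span_mod W P B" if p: "p \<in> span_mod W P E" for p
  proof -
    have "p \<in> {p. D * p \<in> span_mod W P B}"
    proof (rule span_mod_induct[OF Ps hE(3) p])
      fix r q :: "('x, 'k) mpoly" assume "in_vars W r" "q \<in> {p. D * p \<in> span_mod W P B}"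
      then have "r * (D * q) \<in> span_mod W P B" using span_mod_mult[OF Ps] by blast
      then show "r * q \<in> {p. D * p \<in> span_mod W P B}" by (simp add: mult_ac)
    qed (use De span_mod_add[OF Ps] idl.subspace_scale[OF Ps] in \<open>auto simp: distrib_left intro: span_mod_ideal\<close>)
    then show ?thesis by simp
  qed
  have "\<exists>M. (h * D) ^ M * a \<in> span_mod W P B" for a
  proof -
    obtain M where "h ^ M * a \<in> span_mod W P E" using hE(5) by blast
    then have "(h * D ^ M) * (D * (h ^ M * a)) \<in> span_mod W P B"
      by (intro span_mod_mult[OF Ps _ Dp] in_vars_mult in_vars_power DW hE(2))
    then show ?thesis by (intro exI[of _ "Suc M"]) (simp add: power_mult_distrib mult_ac)
  qed
  moreover have "h * D \<noteq> 0" using hE(1) D0 by (simp add: mpoly_mult_eq_0_iff)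
  ultimately show ?thesis using B finB in_vars_mult[OF hE(2) DW] by blast
qed

text \<open>Otherwise every \<open>x - c\<close> is invertible modulo \<open>P\<close>, hence divides a power of \<open>h\<close> in \<open>k[W]\<close> for the \<open>h\<close>
  of the previous lemma; so \<open>h\<close> vanishes at every point, which is absurd.\<close>

lemma maximal_contains_Var:
  fixes P :: "('x::finite, 'k::{alg_closed_field, field_char_0}) mpoly set"
  assumes P: "prime_idl P" and max: "\<And>a. a \<notin> P \<Longrightarrow> \<exists>b. 1 - a * b \<in> P"
  shows "\<exists>c. Var x - Const c \<in> P"
proof (rule ccontr)
  assume nc: "\<not> ?thesis"
  have Ps: "idl.subspace P" using P by (rule prime_idl_subspace)
  let ?I = "\<lambda>W. x \<in> W \<and> (\<forall>p\<in>P. in_vars W p \<longrightarrow> p = 0)"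
  \<comment> \<open>A nonzero relation in \<open>x\<close> alone would, by algebraic closedness, put
    some \<open>Var x - Const c\<close> into \<open>P\<close>.\<close>
  have "?I {x}"
  proof (intro conjI ballI impI)
    fix p assume p: "p \<in> P" "in_vars {x} p"
    have cc: "coeff (split_var x p) i = Const (lookup (coeff (split_var x p) i) 0)" for i
      using in_vars_coeff_split_var[OF p(2), of x i]
      by (intro poly_mapping_eqI) (auto simp: in_vars_def lookup_Const when_def in_keys_iff)
    define h where "h = map_poly (\<lambda>q. lookup q 0) (split_var x p)"
    have "map_poly Const h = split_var x p"
      by (rule poly_eqI) (simp add: h_def coeff_map_poly cc[symmetric])
    then have "poly (map_poly Const h) (Var x) \<in> P" using p by (simp add: poly_split_var)
    then have "h = 0" using prime_idl_root[OF P] nc by blast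
    then show "p = 0" using \<open>map_poly Const h = split_var x p\<close> by simp
  qed simp
  then have "\<exists>W. ?I W \<and> (\<forall>W'. ?I W' \<longrightarrow> card W' \<le> card W)"
    by (rule ex_has_greatest_nat[of ?I "{x}" card "Suc (card (UNIV :: 'x set))"]) (simp add: card_mono le_imp_less_Suc)
  then obtain W where W: "?I W" "\<And>W'. ?I W' \<Longrightarrow> card W' \<le> card W" by blast
  have dep: "\<exists>g\<in>P. g \<noteq> 0 \<and> in_vars (insert y W) g" if "y \<notin> W" for y
    using W(2)[of "insert y W"] that W(1) by auto
  have ind: "\<And>p. p \<in> P \<Longrightarrow> in_vars W p \<Longrightarrow> p = 0" using W(1) by blast
  obtain h E where hE: "h \<noteq> 0" "in_vars W h" "finite E" "1 \<in> E" "indep_over W P E"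
    "\<And>a. \<exists>M. h ^ M * a \<in> span_mod W P E"
    using generically_free[OF P ind dep] by blast
  \<comment> \<open>The polynomial \<open>y\<close> below vanishes at this point while
    \<open>h\<close> does not, against the identity \<open>h ^ M = y * b 1\<close> to be
    derived.\<close>
  obtain a where a: "ev a h \<noteq> 0" using ev_nonzero_exists[OF hE(1)] by blast
  define y where "y = Var x - Const (a x)"
  have yW: "in_vars W y" unfolding y_def using W(1) by (intro in_vars_diff) (simp_all add: in_vars_Var)
  obtain g where g: "1 - y * g \<in> P" using max nc unfolding y_def by blast
  obtain M where "h ^ M * g \<in> span_mod W P E" using hE(6) by blast
  then obtain b where b: "\<And>e. in_vars W (b e)" "h ^ M * g - (\<Sum>e\<in>E. b e * e) \<in> P" by (auto simp: span_mod_def)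
  \<comment> \<open>Coefficients over \<open>E\<close> of an element congruent to
    \<open>h ^ M * (1 - y * g)\<close>, which lies in \<open>P\<close> because \<open>g\<close>
    inverts \<open>y\<close>. By independence all of them vanish, in particular that of 1.\<close>
  define b' where "b' = (\<lambda>e. (if e = 1 then h ^ M else 0) - y * b e)"
  have b'W: "in_vars W (b' e)" for e
    unfolding b'_def using b(1) yW hE(2) by (auto intro: in_vars_diff in_vars_mult in_vars_power in_vars_uminus)
  have "(\<Sum>e\<in>E. b' e * e) = h ^ M - y * (\<Sum>e\<in>E. b e * e)"
    using hE(3,4) by (simp add: b'_def left_diff_distrib sum_subtractf sum_distrib_left mult.assoc
        if_distrib[of "\<lambda>b. b * _"] sum.delta cong: if_cong)
  also have "\<dots> = h ^ M * (1 - y * g) + y * (h ^ M * g - (\<Sum>e\<in>E. b e * e))" by (simp add: algebra_simps)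
  also have "\<dots> \<in> P" using g b(2) by (intro idl.subspace_add[OF Ps] idl.subspace_scale[OF Ps])
  finally have "\<forall>e\<in>E. b' e = 0" using hE(5) b'W unfolding indep_over_def by blast
  then have "h ^ M = y * b 1" using hE(4) by (auto simp: b'_def)
  then have "ev a h ^ M = ev a y * ev a (b 1)" by (metis ev.subst_power ev.subst_mult)
  moreover have "ev a y = 0" by (simp add: y_def ev.subst_simps)
  ultimately show False using a by simp
qed

section \<open>Residue class rings\<close>

text \<open>One interface serves both the residue class ring by \<open>J\<close> and, with
  \<open>J\<close> zero, the polynomial ring itself; ideals of \<open>R\<close> are handled through
  their preimages.\<close>

locale quotient_map = cring R for R :: "('b, 'm) ring_scheme" (structure) +
  fixes \<pi> :: "'a::comm_ring_1 \<Rightarrow> 'b" and J :: "'a set"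
  assumes subspace_J: "idl.subspace J" and carrier_eq: "carrier R = range \<pi>"
    and \<pi>_add: "\<pi> (x + y) = \<pi> x \<oplus> \<pi> y" and \<pi>_mult: "\<pi> (x * y) = \<pi> x \<otimes> \<pi> y"
    and \<pi>_1: "\<pi> 1 = \<one>" and \<pi>_eq_iff: "\<pi> x = \<pi> y \<longleftrightarrow> x - y \<in> J"
begin

lemma \<pi>_closed [simp]: "\<pi> x \<in> carrier R"
  by (simp add: carrier_eq)

lemma \<pi>_0: "\<pi> 0 = \<zero>"
proof -
  have "\<pi> 0 \<oplus> \<pi> 0 = \<pi> 0" by (simp flip: \<pi>_add)
  then show ?thesis using add.l_cancel_one'[of "\<pi> 0" "\<pi> 0"] by simp
qed

lemma \<pi>_uminus: "\<ominus> \<pi> x = \<pi> (- x)"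
proof (rule minus_equality)
  show "\<pi> (- x) \<oplus> \<pi> x = \<zero>" by (simp flip: \<pi>_add \<pi>_0)
qed simp_all

lemma subspace_vimage: "ideal I R \<Longrightarrow> idl.subspace (\<pi> -` I)"
proof -
  assume I: "ideal I R"
  interpret ideal I R by fact
  show ?thesis
    by (rule idl.subspaceI) (auto simp: \<pi>_0 \<pi>_add \<pi>_mult intro: I_l_closed)
qed

lemma J_subset_vimage: "ideal I R \<Longrightarrow> J \<subseteq> \<pi> -` I"
proof
  fix x assume I: "ideal I R" and "x \<in> J"
  then have "\<pi> x = \<zero>" using \<pi>_eq_iff[of x 0] by (simp add: \<pi>_0)
  then show "x \<in> \<pi> -` I" using additive_subgroup.zero_closed[OF ideal.axioms(1)[OF I]] by simp
qed

lemma image_vimage: "I \<subseteq> carrier R \<Longrightarrow> \<pi> ` (\<pi> -` I) = I"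
  by (auto simp: carrier_eq)

lemma ideal_subset: "ideal I R \<Longrightarrow> I \<subseteq> carrier R"
  by (rule additive_subgroup.a_subset[OF ideal.axioms(1)])

lemma vimage_image: "idl.subspace K \<Longrightarrow> J \<subseteq> K \<Longrightarrow> \<pi> -` (\<pi> ` K) = K"
proof (intro equalityI subsetI)
  fix x assume K: "idl.subspace K" "J \<subseteq> K" and "x \<in> \<pi> -` (\<pi> ` K)"
  then obtain y where y: "y \<in> K" "x - y \<in> K" using \<pi>_eq_iff by auto
  then have "(x - y) + y \<in> K" using K idl.subspace_add by blast
  then show "x \<in> K" by simp
qed auto

lemma ideal_image: "idl.subspace K \<Longrightarrow> ideal (\<pi> ` K) R"
proof (rule idealI[OF ring_axioms])
  assume K: "idl.subspace K"
  show "subgroup (\<pi> ` K) (add_monoid R)"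
  proof (rule add.subgroupI)
    show "\<pi> ` K \<noteq> {}" using idl.subspace_0[OF K] by blast
    fix a b assume "a \<in> \<pi> ` K" "b \<in> \<pi> ` K"
    then obtain x y where xy: "a = \<pi> x" "b = \<pi> y" "x \<in> K" "y \<in> K" by blast
    show "\<ominus> a \<in> \<pi> ` K" using xy idl.subspace_neg[OF K] by (simp add: \<pi>_uminus)
    show "a \<oplus> b \<in> \<pi> ` K" using xy idl.subspace_add[OF K] by (simp flip: \<pi>_add)
  qed auto
  fix a x assume "a \<in> \<pi> ` K" "x \<in> carrier R"
  then obtain y z where yz: "a = \<pi> y" "y \<in> K" "x = \<pi> z" by (auto simp: carrier_eq)
  show "x \<otimes> a \<in> \<pi> ` K" using yz idl.subspace_scale[OF K] by (simp flip: \<pi>_mult)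
  show "a \<otimes> x \<in> \<pi> ` K" using yz idl_mult_left[OF K] by (simp flip: \<pi>_mult)
qed

lemma prime_vimage: "primeideal P R \<Longrightarrow> prime_idl (\<pi> -` P)"
proof -
  assume "primeideal P R"
  then interpret primeideal P R .
  have I: "ideal P R" by (rule is_ideal)
  have "1 \<notin> \<pi> -` P" using I_notcarr one_imp_carrier by (auto simp: \<pi>_1)
  then show ?thesis
    using subspace_vimage[OF I] I_prime by (auto simp: prime_idl_def \<pi>_mult)
qed

lemma prime_image:
  assumes K: "prime_idl K" "J \<subseteq> K"
  shows "primeideal (\<pi> ` K) R"
proof (rule primeidealI[OF ideal_image is_cring])
  show Ks: "idl.subspace K" using K(1) by (rule prime_idl_subspace)
  have vi: "\<pi> x \<in> \<pi> ` K \<longleftrightarrow> x \<in> K" for x using vimage_image[OF Ks K(2)] by blast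
  have "1 \<notin> K" using K by (simp add: prime_idl_def)
  then have "\<pi> 1 \<notin> \<pi> ` K" by (simp only: vi not_False_eq_True)
  then show "carrier R \<noteq> \<pi> ` K" using \<pi>_closed[of 1] by blast
  fix a b assume "a \<in> carrier R" "b \<in> carrier R" "a \<otimes> b \<in> \<pi> ` K"
  moreover then obtain x y where xy: "a = \<pi> x" "b = \<pi> y" by (auto simp: carrier_eq)
  ultimately have "\<pi> (x * y) \<in> \<pi> ` K" by (simp add: \<pi>_mult)
  then have "x * y \<in> K" by (simp only: vi)
  then show "a \<in> \<pi> ` K \<or> b \<in> \<pi> ` K" using K(1) xy by (auto simp: prime_idl_def)
qed

lemma maximal_vimage:
  assumes P: "maximalideal P R" and a: "a \<notin> \<pi> -` P"
  shows "\<exists>b. 1 - a * b \<in> \<pi> -` P"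
proof -
  interpret maximalideal P R by fact
  have I: "ideal P R" by (rule is_ideal)
  have s: "idl.subspace (\<pi> -` P)" using subspace_vimage[OF I] .
  let ?K = "idl_add a (\<pi> -` P)"
  have "\<pi> ` (\<pi> -` P) \<subseteq> \<pi> ` ?K" using idl_add_superset[OF s] by (rule image_mono)
  then have "P \<subseteq> \<pi> ` ?K" using image_vimage[OF ideal_subset[OF I]] by simp
  then have "\<pi> ` ?K = P \<or> \<pi> ` ?K = carrier R"
    using ideal_image[OF subspace_idl_add[OF s]] by (intro I_maximal) auto
  moreover have "\<pi> a \<in> \<pi> ` ?K" using idl_add_self[OF s] by blast
  ultimately have "\<pi> ` ?K = carrier R" using a by auto
  then have "\<pi> 1 \<in> \<pi> ` ?K" by simp
  moreover have "J \<subseteq> ?K" using J_subset_vimage[OF I] idl_add_superset[OF s] by blast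
  ultimately have "1 \<in> ?K" using vimage_image[OF subspace_idl_add[OF s]] by blast
  then show ?thesis unfolding idl_add_def mem_Collect_eq by (simp only: mult.commute)
qed

lemma maximal_image:
  assumes P: "prime_idl P" "J \<subseteq> P" and max: "\<And>a. a \<notin> P \<Longrightarrow> \<exists>b. 1 - a * b \<in> P"
  shows "maximalideal (\<pi> ` P) R"
proof (rule maximalidealI)
  have p: "primeideal (\<pi> ` P) R" using P by (rule prime_image)
  show "ideal (\<pi> ` P) R" using ideal_image[OF prime_idl_subspace[OF P(1)]] .
  show "carrier R \<noteq> \<pi> ` P" using primeideal.I_notcarr[OF p] .
  fix I assume I: "ideal I R" "\<pi> ` P \<subseteq> I" "I \<subseteq> carrier R"
  show "I = \<pi> ` P \<or> I = carrier R"
  proof (rule disjCI)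
    assume "I \<noteq> carrier R"
    then have "\<one> \<notin> I" using ideal.one_imp_carrier[OF I(1)] by blast
    then have 1: "1 \<notin> \<pi> -` I" by (simp add: \<pi>_1)
    have "\<pi> -` I \<subseteq> P"
    proof
      fix a assume a: "a \<in> \<pi> -` I"
      show "a \<in> P"
      proof (rule ccontr)
        assume "a \<notin> P"
        then obtain b where "1 - a * b \<in> P" using max by blast
        then have "1 - a * b \<in> \<pi> -` I" using I(2) by blast
        then have "(1 - a * b) + a * b \<in> \<pi> -` I"
          using idl.subspace_add[OF subspace_vimage[OF I(1)]] idl_mult_left[OF subspace_vimage[OF I(1)] a] by blast
        then show False using 1 by simp
      qed
    qed
    then have "\<pi> ` (\<pi> -` I) \<subseteq> \<pi> ` P" by (rule image_mono)
    then show "I = \<pi> ` P" unfolding image_vimage[OF I(3)] using I(2) by (rule equalityI)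
  qed
qed

text \<open>A maximal ideal is the only prime containing it, so the infimum is over a single
  height.\<close>

lemma codimension_maximal:
  assumes P: "maximalideal P R"
  shows "codimension R P = prime_height R P"
proof -
  interpret maximalideal P R by fact
  have "P' = P" if P': "primeideal P' R" "P \<subseteq> P'" for P'
  proof -
    have id: "ideal P' R" using primeideal.axioms(1)[OF P'(1)] .
    from I_maximal[OF id P'(2) ideal_subset[OF id]] show ?thesis using primeideal.I_notcarr[OF P'(1)] by simp
  qed
  moreover have "primeideal P R" using maximalideal_prime[OF P] .
  ultimately have "primeideal Q R \<and> P \<subseteq> Q \<longleftrightarrow> Q = P" for Q by (intro iffI) simp_all
  then show ?thesis by (simp add: codimension_def)
qed

lemma prime_height_ge:
  assumes Q: "prime_chain Q k" "J \<subseteq> Q 0"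
  shows "enat k \<le> prime_height R (\<pi> ` Q k)"
proof -
  have JQ: "J \<subseteq> Q i" if "i \<le> k" for i using prime_chain_le[OF Q(1) that] Q(2) by blast
  have pr: "prime_idl (Q i)" if "i \<le> k" for i using Q(1) that by (simp add: prime_chain_def)
  have "\<pi> ` Q i \<subset> \<pi> ` Q (Suc i)" if "i < k" for i
  proof -
    have "Q i \<subset> Q (Suc i)" using Q(1) that by (simp add: prime_chain_def)
    moreover have "\<pi> ` Q i \<noteq> \<pi> ` Q (Suc i)"
      using vimage_image[OF prime_idl_subspace[OF pr], of i] vimage_image[OF prime_idl_subspace[OF pr], of "Suc i"]
        JQ[of i] JQ[of "Suc i"] that \<open>Q i \<subset> Q (Suc i)\<close> by (metis Suc_leI less_imp_le psubset_eq)
    ultimately show ?thesis by blast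
  qed
  moreover have "primeideal (\<pi> ` Q i) R" if "i \<le> k" for i using prime_image[OF pr JQ] that by simp
  ultimately show ?thesis
    unfolding prime_height_def by (intro Sup_upper CollectI exI[of _ k] conjI exI[of _ "\<lambda>i. \<pi> ` Q i"]) auto
qed

lemma prime_height_le:
  assumes P: "P \<subseteq> carrier R" and le: "\<And>Q k. prime_chain Q k \<Longrightarrow> J \<subseteq> Q 0 \<Longrightarrow> Q k = \<pi> -` P \<Longrightarrow> k \<le> s"
  shows "prime_height R P \<le> enat s"
  unfolding prime_height_def
proof (rule Sup_least)
  fix e assume "e \<in> {enat k | k. \<exists>Q. (\<forall>i\<le>k. primeideal (Q i) R) \<and> (\<forall>i<k. Q i \<subset> Q (Suc i)) \<and> Q k = P}"
  then obtain k Q where Q: "e = enat k" "\<And>i. i \<le> k \<Longrightarrow> primeideal (Q i) R" "\<And>i. i < k \<Longrightarrow> Q i \<subset> Q (Suc i)" "Q k = P"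
    by blast
  have id: "ideal (Q i) R" if "i \<le> k" for i using primeideal.axioms(1)[OF Q(2)[OF that]] .
  have "\<pi> -` Q i \<subset> \<pi> -` Q (Suc i)" if "i < k" for i
  proof -
    have "\<pi> ` (\<pi> -` Q i) = Q i" "\<pi> ` (\<pi> -` Q (Suc i)) = Q (Suc i)"
      using image_vimage ideal_subset id that by simp_all
    then show ?thesis using Q(3)[OF that] by (metis psubset_eq vimage_mono)
  qed
  then have "prime_chain (\<lambda>i. \<pi> -` Q i) k" using prime_vimage Q(2) by (simp add: prime_chain_def)
  moreover have "J \<subseteq> \<pi> -` Q 0" using J_subset_vimage[OF id[of 0]] by simp
  ultimately have "k \<le> s" using le[of "\<lambda>i. \<pi> -` Q i" k] Q(4) by simp
  then show "e \<le> enat s" using Q(1) by simp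
qed

lemma genideal_image: "genideal R (\<pi> ` Y) = \<pi> ` idl.span (Y \<union> J)"
proof (rule equalityI)
  have "\<pi> ` Y \<subseteq> \<pi> ` idl.span (Y \<union> J)" by (intro image_mono) (auto intro: idl.span_base)
  then show "genideal R (\<pi> ` Y) \<subseteq> \<pi> ` idl.span (Y \<union> J)"
    by (intro genideal_minimal ideal_image idl.subspace_span)
  have Y: "\<pi> ` Y \<subseteq> carrier R" by auto
  have I: "ideal (genideal R (\<pi> ` Y)) R" using genideal_ideal[OF Y] .
  have "Y \<union> J \<subseteq> \<pi> -` genideal R (\<pi> ` Y)" using genideal_self[OF Y] J_subset_vimage[OF I] by blast
  then have "idl.span (Y \<union> J) \<subseteq> \<pi> -` genideal R (\<pi> ` Y)" using subspace_vimage[OF I] by (rule idl.span_minimal)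
  then show "\<pi> ` idl.span (Y \<union> J) \<subseteq> genideal R (\<pi> ` Y)" by blast
qed

lemma regs_iff_nth:
  "regs K zs \<longleftrightarrow> (\<forall>i<length zs. regular_mod (fold idl_add (take i zs) K) (zs ! i))" for K :: "'a set"
  by (induction zs arbitrary: K) (auto simp: less_Suc_eq_0_disj)

lemma genideal_take: "genideal R (set (take i (map \<pi> zs))) = \<pi> ` fold idl_add (take i zs) J"
  using genideal_image[of "set (take i zs)"] by (simp add: fold_idl_add_eq_span[OF subspace_J] take_map)

lemma regular_step_iff:
  "(\<forall>y\<in>carrier R. \<pi> z \<otimes> y \<in> \<pi> ` fold idl_add zs J \<longrightarrow> y \<in> \<pi> ` fold idl_add zs J)
    \<longleftrightarrow> regular_mod (fold idl_add zs J) z"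
proof -
  let ?K = "fold idl_add zs J"
  have K: "idl.subspace ?K" by (rule subspace_fold_idl_add[OF subspace_J])
  have "J \<subseteq> ?K" by (auto simp: fold_idl_add_eq_span[OF subspace_J] intro: idl.span_base)
  then have "\<pi> x \<in> \<pi> ` ?K \<longleftrightarrow> x \<in> ?K" for x using vimage_image[OF K] by blast
  then show ?thesis by (simp add: regular_mod_def carrier_eq flip: \<pi>_mult)
qed

text \<open>The prime \<open>P\<close> supplies the properness that \<open>regular_sequence\<close>
  demands.\<close>

lemma regular_sequence_image:
  assumes "regs J zs" and P: "prime_idl P" "J \<subseteq> P" "set zs \<subseteq> P"
  shows "regular_sequence R (map \<pi> zs)"
proof -
  have "idl.span (set zs \<union> J) \<subseteq> P" using P prime_idl_subspace by (intro idl.span_minimal) auto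
  then have "1 \<notin> idl.span (set zs \<union> J)" using P(1) by (auto simp: prime_idl_def)
  then have "\<pi> 1 \<notin> \<pi> ` idl.span (set zs \<union> J)" using vimage_image[of "idl.span (set zs \<union> J)"]
    by (auto simp: idl.span_base subset_iff)
  then have "genideal R (\<pi> ` set zs) \<noteq> carrier R" unfolding genideal_image using \<pi>_closed by blast
  then show ?thesis
    using assms(1) unfolding regular_sequence_def genideal_take
    by (auto simp: regular_step_iff regs_iff_nth)
qed

lemma regular_sequence_lift:
  assumes "regular_sequence R xs"
  shows "\<exists>zs. xs = map \<pi> zs \<and> regs J zs"
proof -
  have "set xs \<subseteq> range \<pi>" using assms by (simp add: regular_sequence_def carrier_eq)
  then have "\<exists>zs. xs = map \<pi> zs" by (simp add: ex_map_conv) blast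
  then obtain zs where zs: "xs = map \<pi> zs" ..
  have "regs J zs"
    unfolding regs_iff_nth
  proof (intro allI impI)
    fix i assume i: "i < length zs"
    then have "\<forall>y\<in>carrier R. xs ! i \<otimes> y \<in> genideal R (set (take i xs)) \<longrightarrow> y \<in> genideal R (set (take i xs))"
      using assms by (simp add: regular_sequence_def zs)
    then show "regular_mod (fold idl_add (take i zs) J) (zs ! i)"
      unfolding zs genideal_take nth_map[OF i] regular_step_iff .
  qed
  then show ?thesis using zs by blast
qed

end

section \<open>The polynomial ring and its residue class rings as carrier-based rings\<close>

lemma ring_of_type_algebra_sel [simp]:
  "carrier ring_of_type_algebra = UNIV" "x \<otimes>\<^bsub>ring_of_type_algebra\<^esub> y = x * y"
  "x \<oplus>\<^bsub>ring_of_type_algebra\<^esub> y = x + y" "\<one>\<^bsub>ring_of_type_algebra\<^esub> = 1" "\<zero>\<^bsub>ring_of_type_algebra\<^esub> = 0"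
  by (simp_all add: ring_of_type_algebra_def)

lemma quotient_map_id: "quotient_map ring_of_type_algebra (\<lambda>x :: 'a::comm_ring_1. x) {0}"
proof -
  interpret cring "ring_of_type_algebra :: 'a ring" by (rule cring_from_type_algebra)
  show ?thesis by unfold_locales (auto simp: idl.subspace_def)
qed

lemma ideal_ring_of_type_algebra: "idl.subspace J \<Longrightarrow> ideal J (ring_of_type_algebra :: 'a::comm_ring_1 ring)"
  using quotient_map.ideal_image[OF quotient_map_id, of J] by simp

lemma genideal_ring_of_type_algebra:
  "genideal ring_of_type_algebra Y = idl.span (Y :: 'a::comm_ring_1 set)"
proof -
  have "idl.span (Y \<union> {0}) = idl.span Y"
    by (intro equalityI idl.span_minimal idl.span_mono) (auto intro: idl.span_base idl.span_zero)
  then show ?thesis using quotient_map.genideal_image[OF quotient_map_id, of Y] by simp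
qed

lemma quotient_map_Quot:
  fixes J :: "'a::comm_ring_1 set"
  assumes J: "idl.subspace J"
  shows "quotient_map (ring_of_type_algebra Quot J) (\<lambda>x. J +>\<^bsub>ring_of_type_algebra\<^esub> x) J"
proof -
  let ?S = "ring_of_type_algebra :: 'a ring"
  interpret S: cring ?S by (rule cring_from_type_algebra)
  interpret I: ideal J ?S using J by (rule ideal_ring_of_type_algebra)
  interpret Q: cring "?S Quot J" by (rule I.quotient_is_cring[OF S.is_cring])
  note hom = I.rcos_ring_hom
  have cos: "J +>\<^bsub>?S\<^esub> x = {h + x | h. h \<in> J}" for x by (auto simp: a_r_coset_def')
  show ?thesis
  proof
    show "idl.subspace J" by fact
    show "carrier (?S Quot J) = range (\<lambda>x. J +>\<^bsub>?S\<^esub> x)" by (auto simp: FactRing_def A_RCOSETS_def')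
    fix x y
    show "J +>\<^bsub>?S\<^esub> (x + y) = (J +>\<^bsub>?S\<^esub> x) \<oplus>\<^bsub>?S Quot J\<^esub> (J +>\<^bsub>?S\<^esub> y)"
      using ring_hom_add[OF hom, of x y] by simp
    show "J +>\<^bsub>?S\<^esub> (x * y) = (J +>\<^bsub>?S\<^esub> x) \<otimes>\<^bsub>?S Quot J\<^esub> (J +>\<^bsub>?S\<^esub> y)"
      using ring_hom_mult[OF hom, of x y] by simp
    show "J +>\<^bsub>?S\<^esub> 1 = \<one>\<^bsub>?S Quot J\<^esub>" using ring_hom_one[OF hom] by simp
    show "(J +>\<^bsub>?S\<^esub> x = J +>\<^bsub>?S\<^esub> y) \<longleftrightarrow> x - y \<in> J"
    proof
      assume "J +>\<^bsub>?S\<^esub> x = J +>\<^bsub>?S\<^esub> y"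
      moreover have "0 + x \<in> J +>\<^bsub>?S\<^esub> x" unfolding cos using idl.subspace_0[OF J] by blast
      ultimately obtain h where "h \<in> J" "0 + x = h + y" unfolding cos by blast
      then show "x - y \<in> J" by simp
    next
      assume d: "x - y \<in> J"
      have sub: "{h + a | h. h \<in> J} \<subseteq> {h + b | h. h \<in> J}" if "a - b \<in> J" for a b
      proof
        fix z assume "z \<in> {h + a | h. h \<in> J}"
        then obtain h where h: "h \<in> J" "z = h + a" by blast
        have "z = (h + (a - b)) + b" "h + (a - b) \<in> J" using h that idl.subspace_add[OF J] by auto
        then show "z \<in> {h + b | h. h \<in> J}" by blast
      qed
      show "J +>\<^bsub>?S\<^esub> x = J +>\<^bsub>?S\<^esub> y"
        unfolding cos using sub[OF d] sub[of y x] idl.subspace_neg[OF J d] by auto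
    qed
  qed
qed

lemma (in quotient_map) noetherian:
  assumes "noetherian_type TYPE('a)"
  shows "noetherian_ring R"
proof (rule noetherian_ringI)
  fix I assume I: "ideal I R"
  obtain S where S: "finite S" "\<pi> -` I = idl.span S"
    using noetherian_type.fin_gen[OF assms subspace_vimage[OF I]] by blast
  have "idl.span (S \<union> J) \<subseteq> idl.span S"
    using J_subset_vimage[OF I] S(2) idl.span_superset[of S] by (intro idl.span_minimal) auto
  then have "idl.span (S \<union> J) = idl.span S" using idl.span_mono[of S "S \<union> J"] by blast
  then have "genideal R (\<pi> ` S) = \<pi> ` (\<pi> -` I)" using S(2) by (simp add: genideal_image)
  also have "\<dots> = I" using I ideal_subset image_vimage by blast
  finally show "\<exists>A\<subseteq>carrier R. finite A \<and> I = genideal R A"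
    using S(1) by (intro exI[of _ "\<pi> ` S"]) auto
qed

section \<open>The extension argument\<close>

lemma irrelevant_idl_maximal:
  fixes a :: "('x::finite, 'k::field) mpoly"
  assumes "a \<notin> irrelevant_idl"
  shows "\<exists>b. 1 - a * b \<in> irrelevant_idl"
proof (intro exI)
  show "1 - a * Const (inverse (ev (\<lambda>_. 0) a)) \<in> irrelevant_idl"
    using assms by (simp add: irrelevant_idl_iff ev.subst_simps)
qed

lemma regs_take: "regs K zs \<Longrightarrow> regs K (take n zs)"
  by (induction zs arbitrary: K n) (auto simp: take_Cons split: nat.splits)

lemma prime_chain_append:
  assumes "prime_chain R j" "prime_chain Q k" "R j = Q 0"
  shows "prime_chain (\<lambda>i. if i \<le> j then R i else Q (i - j)) (j + k)"
  unfolding prime_chain_def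
proof (intro conjI allI impI)
  fix i assume i: "i \<le> j + k"
  then have "i - j \<le> k" by simp
  then show "prime_idl (if i \<le> j then R i else Q (i - j))"
    using assms(1,2) by (simp add: prime_chain_def)
next
  fix i assume i: "i < j + k"
  consider "i < j" | "i = j" | "j < i" by linarith
  then show "(if i \<le> j then R i else Q (i - j)) \<subset> (if Suc i \<le> j then R (Suc i) else Q (Suc i - j))"
  proof cases
    case 3
    then have "Suc i - j = Suc (i - j)" "i - j < k" using i by auto
    then show ?thesis using assms(2) 3 by (simp add: prime_chain_def)
  qed (use assms i in \<open>auto simp: prime_chain_def\<close>)
qed

text \<open>By perfection the depth at the origin is the height of the irrelevant ideal over
  \<open>I\<close>. Were it below \<open>s\<close>, linear parameters would bound the growth of A/I
  by \<open>s - 1\<close>, while \<open>q\<close>, of height at most \<open>h\<close>, forces growth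
  \<open>s\<close>.\<close>

lemma depth_ge_of_perfect:
  fixes I :: "('x::finite, 'k::field_char_0) mpoly set"
  assumes I: "homog_idl I" "I \<subseteq> irrelevant_idl" and perf: "perfect_ideal polynomial_ring I"
    and q: "prime_idl q" "I \<subseteq> q" "\<And>Q k. prime_chain Q k \<Longrightarrow> Q k = q \<Longrightarrow> k \<le> h"
  shows "depth_ge I (card (UNIV :: 'x set) - h)"
proof (rule ccontr)
  define s where "s = card (UNIV :: 'x set) - h"
  assume "\<not> depth_ge I (card (UNIV :: 'x set) - h)"
  then have nd: "\<not> depth_ge I s" by (simp add: s_def)
  have Is: "idl.subspace I" using I(1) by (rule homog_idl_subspace)
  define \<pi> where "\<pi> = (\<lambda>x. I +>\<^bsub>polynomial_ring\<^esub> x)"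
  interpret quotient_map "polynomial_ring Quot I" \<pi> I
    unfolding \<pi>_def by (rule quotient_map_Quot[OF Is])
  let ?m = "irrelevant_idl :: ('x, 'k) mpoly set"
  \<comment> \<open>Depth at least 0 always holds here, so the assumed failure gives
    \<open>0 < s\<close>, and \<open>s - 1\<close> does not truncate.\<close>
  have "0 < s" using nd I(2) by (cases s) (auto simp: depth_ge_def)
  have max: "maximalideal (\<pi> ` ?m) (polynomial_ring Quot I)"
    using irrelevant_idl_maximal by (intro maximal_image prime_irrelevant_idl I(2))
  have vm: "\<pi> -` (\<pi> ` ?m) = ?m" by (rule vimage_image[OF subspace_irrelevant_idl I(2)])
  have "ideal_depth (polynomial_ring Quot I) (\<pi> ` ?m) \<le> enat (s - 1)"
    unfolding ideal_depth_def
  proof (rule Sup_least)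
    fix e assume "e \<in> {enat (length xs) | xs. regular_sequence (polynomial_ring Quot I) xs \<and> set xs \<subseteq> \<pi> ` ?m}"
    then obtain xs where xs: "e = enat (length xs)" "regular_sequence (polynomial_ring Quot I) xs" "set xs \<subseteq> \<pi> ` ?m" by blast
    obtain zs where zs: "xs = map \<pi> zs" "regs I zs" using regular_sequence_lift[OF xs(2)] by blast
    have "set zs \<subseteq> \<pi> -` (\<pi> ` ?m)" 
      using xs(3) unfolding zs(1) by (simp only: set_map image_subset_iff_subset_vimage)
    then have zm: "set zs \<subseteq> ?m" using vm by simp
    have "length zs < s"
    proof (rule ccontr)
      assume "\<not> length zs < s"
      then have "depth_ge I s"
        unfolding depth_ge_def using I(2) regs_take[OF zs(2), of s] zm set_take_subset[of s zs]
        by (intro conjI exI[of _ "take s zs"]) auto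
      then show False using nd by simp
    qed
    then show "e \<le> enat (s - 1)" using xs(1) zs(1) by simp
  qed
  moreover have "ideal_depth (polynomial_ring Quot I) (\<pi> ` ?m) = prime_height (polynomial_ring Quot I) (\<pi> ` ?m)"
    using perf max codimension_maximal[OF max] by (simp add: perfect_ideal_def cohen_macaulay_def)
  ultimately have ht: "prime_height (polynomial_ring Quot I) (\<pi> ` ?m) \<le> enat (s - 1)" by simp
  have "growth_le I (s - 1)"
  proof (rule growth_le_of_chains[OF I])
    fix Q k assume Q: "prime_chain Q k" "I \<subseteq> Q 0" "Q k = ?m"
    have "enat k \<le> enat (s - 1)" using prime_height_ge[OF Q(1,2)] ht Q(3) order_trans by force
    then show "k \<le> s - 1" by simp
  qed
  moreover have "growth_ge I s"
    using growth_ge_mono[OF prime_growth_height[OF q(1,3)] q(2)] by (simp add: s_def)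
  ultimately have "s \<le> s - 1" using growth_ge_le by blast
  then show False using \<open>0 < s\<close> by simp
qed

text \<open>At every maximal ideal the \<open>ls\<close>, shifted by their values at its point, form
  a regular sequence inside it. As regular sequences yield prime chains, depth and height both equal
  the bound \<open>length ls\<close>.\<close>

lemma perfect_idealI:
  fixes J :: "('x::finite, 'k::{alg_closed_field, field_char_0}) mpoly set"
  assumes J: "homog_idl J" and ls: "\<And>l. l \<in> set ls \<Longrightarrow> homog 1 l" "regs J ls"
    and le: "\<And>Q k. prime_chain Q k \<Longrightarrow> J \<subseteq> Q 0 \<Longrightarrow> k \<le> length ls"
  shows "perfect_ideal polynomial_ring J"
  unfolding perfect_ideal_def cohen_macaulay_def
proof (intro conjI allI impI)
  have Js: "idl.subspace J" using J by (rule homog_idl_subspace)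
  let ?R = "polynomial_ring Quot J"
  define \<pi> where "\<pi> = (\<lambda>x. J +>\<^bsub>polynomial_ring\<^esub> x)"
  interpret quotient_map ?R \<pi> J
    unfolding \<pi>_def by (rule quotient_map_Quot[OF Js])
  show "cring ?R" by (rule is_cring)
  show "noetherian_ring ?R" by (rule noetherian) (rule mpoly.noetherian_type_axioms)
  fix P assume P: "maximalideal P ?R"
  define P0 where "P0 = \<pi> -` P"
  have Pp: "primeideal P ?R" using maximalideal_prime[OF P] .
  have Pid: "ideal P ?R" using primeideal.axioms(1)[OF Pp] .
  have P0: "prime_idl P0" "J \<subseteq> P0" using prime_vimage[OF Pp] J_subset_vimage[OF Pid] by (simp_all add: P0_def)
  have PP: "\<pi> ` P0 = P" using image_vimage[OF ideal_subset[OF Pid]] by (simp add: P0_def)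
  have "\<exists>c. Var x - Const c \<in> P0" for x
    using maximal_vimage[OF P] by (intro maximal_contains_Var P0(1)) (simp add: P0_def)
  then obtain a where a: "\<And>x. Var x - Const (a x) \<in> P0" by metis
  define zs where "zs = map (\<lambda>l. l - Const (ev a l)) ls"
  have zs: "regs J zs" "set zs \<subseteq> P0" "length zs = length ls"
    using regs_shift[OF leading_forms_homog[OF J] ls] ev_diff_in_idl[OF prime_idl_subspace[OF P0(1)] a]
    by (auto simp: zs_def)
  have "ideal_depth ?R P = enat (length ls)"
  proof (rule antisym)
    have "regular_sequence ?R (map \<pi> zs)" using zs P0 by (intro regular_sequence_image)
    moreover have "set (map \<pi> zs) \<subseteq> P" using zs(2) PP by auto
    ultimately show "enat (length ls) \<le> ideal_depth ?R P"
      unfolding ideal_depth_def using zs(3) by (intro Sup_upper CollectI exI[of _ "map \<pi> zs"]) simp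
    show "ideal_depth ?R P \<le> enat (length ls)"
      unfolding ideal_depth_def
    proof (rule Sup_least)
      fix e assume "e \<in> {enat (length xs) | xs. regular_sequence ?R xs \<and> set xs \<subseteq> P}"
      then obtain xs where xs: "e = enat (length xs)" "regular_sequence ?R xs" "set xs \<subseteq> P" by blast
      obtain ys where ys: "xs = map \<pi> ys" "regs J ys" using regular_sequence_lift[OF xs(2)] by blast
      have "set ys \<subseteq> P0"
        using xs(3) unfolding ys(1) P0_def by (simp only: set_map image_subset_iff_subset_vimage)
      then obtain Q where "prime_chain Q (length ys)" "J \<subseteq> Q 0"
        using mpoly.regs_imp_chain[OF Js ys(2) P0(2) _ P0(1)] by blast
      then show "e \<le> enat (length ls)" using le xs(1) ys(1) by simp
    qed
  qed
  moreover have "prime_height ?R P = enat (length ls)"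
  proof (rule antisym)
    obtain Q where "prime_chain Q (length zs)" "J \<subseteq> Q 0" "Q (length zs) = P0"
      using mpoly.regs_imp_chain[OF Js zs(1) P0(2) zs(2) P0(1)] by blast
    then show "enat (length ls) \<le> prime_height ?R P" using prime_height_ge[of Q "length zs"] PP zs(3) by simp
    show "prime_height ?R P \<le> enat (length ls)"
      by (rule prime_height_le[OF ideal_subset[OF Pid]]) (rule le)
  qed
  ultimately show "ideal_depth ?R P = codimension ?R P" using codimension_maximal[OF P] by simp
qed

lemma prime_height_chain:
  assumes "enat (Suc h) \<le> prime_height (ring_of_type_algebra :: 'a::comm_ring_1 ring) P"
  shows "\<exists>Q k. Suc h \<le> k \<and> prime_chain Q k \<and> Q k = P"
proof (rule ccontr)
  interpret quotient_map ring_of_type_algebra "\<lambda>x :: 'a. x" "{0}" by (rule quotient_map_id)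
  assume "\<not> ?thesis"
  then have "prime_height (ring_of_type_algebra :: 'a ring) P \<le> enat h"
    by (intro prime_height_le) (auto simp: not_less_eq_eq)
  then have "enat (Suc h) \<le> enat h" using assms order_trans by blast
  then show False by simp
qed

lemma prime_chain_height:
  assumes "prime_chain Q k"
  shows "enat k \<le> prime_height (ring_of_type_algebra :: 'a::comm_ring_1 ring) (Q k)"
proof -
  interpret quotient_map ring_of_type_algebra "\<lambda>x :: 'a. x" "{0}" by (rule quotient_map_id)
  have "idl.subspace (Q 0)" using assms by (auto simp: prime_chain_def intro: prime_idl_subspace)
  then show ?thesis using prime_height_ge[OF assms] idl.subspace_0 by auto
qed

lemma primeideal_ring_of_type_algebra:
  "primeideal P (ring_of_type_algebra :: 'a::comm_ring_1 ring) \<longleftrightarrow> prime_idl P"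
proof -
  interpret quotient_map ring_of_type_algebra "\<lambda>x :: 'a. x" "{0}" by (rule quotient_map_id)
  show ?thesis using prime_vimage[of P] prime_image[of P] idl.subspace_0[of P] prime_idl_subspace[of P] by auto
qed

lemma perfect_extension:
  fixes I :: "('x::finite, 'k::{alg_closed_field, field_char_0}) mpoly set"
  assumes I: "homog_idl I" "I \<subseteq> irrelevant_idl"
    and perf: "perfect_ideal polynomial_ring I" and codim: "codimension polynomial_ring I = 2"
    and H: "H \<in> I" "homog d H" "H \<notin> idl.span {Var t}"
  shows "perfect_ideal polynomial_ring (idl_add H ((*) (Var t) ` I))"
proof -
  let ?N = "card (UNIV :: 'x set)"
  let ?J = "idl_add H ((*) (Var t) ` I)"
  have Is: "idl.subspace I" using I(1) by (rule homog_idl_subspace)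
  have tI: "homog_idl ((*) (Var t) ` I)"
    unfolding homog_idl_def
  proof (intro conjI ballI allI)
    show "idl.subspace ((*) (Var t) ` I)"
    proof (rule idl.subspaceI)
      show "0 \<in> (*) (Var t) ` I" using idl.subspace_0[OF Is] by (intro image_eqI[of _ _ 0]) simp_all
      fix p q c assume "p \<in> (*) (Var t) ` I"
      then obtain a where a: "p = Var t * a" "a \<in> I" by blast
      show "c * p \<in> (*) (Var t) ` I"
        using a idl.subspace_scale[OF Is] by (intro image_eqI[of _ _ "c * a"]) (simp_all add: mult_ac)
      assume "q \<in> (*) (Var t) ` I"
      then obtain b where b: "q = Var t * b" "b \<in> I" by blast
      show "p + q \<in> (*) (Var t) ` I"
        using a b idl.subspace_add[OF Is] by (intro image_eqI[of _ _ "a + b"]) (simp_all add: distrib_left)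
    qed
    fix p e assume "p \<in> (*) (Var t) ` I"
    then obtain a where a: "p = Var t * a" "a \<in> I" by blast
    then have "hcomp e p = Var t * (if 1 \<le> e then hcomp (e - 1) a else 0)"
      using hcomp_homog_mult[OF homog_Var, of e t a] by simp
    moreover have "(if 1 \<le> e then hcomp (e - 1) a else 0) \<in> I"
      using a(2) I(1) idl.subspace_0[OF Is] by (simp add: homog_idl_def)
    ultimately show "hcomp e p \<in> (*) (Var t) ` I" by blast
  qed
  have tIs: "idl.subspace ((*) (Var t) ` I)" using tI by (rule homog_idl_subspace)
  have hJ: "homog_idl ?J" using homog_idl_add[OF tI H(2)] .
  have J: "idl.subspace ?J" using hJ by (rule homog_idl_subspace)
  have pt: "prime_idl (idl.span {Var t :: ('x, 'k) mpoly})" using prime_span_Var[of "{t}"] by simp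
  \<comment> \<open>From \<open>g * Var t - h * H = Var t * a\<close> the prime (t) contains
    \<open>h * H\<close> but not \<open>H\<close>, hence contains \<open>h\<close>; cancelling
    \<open>Var t\<close> leaves \<open>g\<close> in \<open>I\<close>.\<close>
  have colon: "idl_colon ?J (Var t) = I"
  proof (intro equalityI subsetI)
    fix g assume "g \<in> I"
    then have "Var t * g \<in> ?J" using idl_add_superset[OF tIs] by blast
    then show "g \<in> idl_colon ?J (Var t)" by (simp add: idl_colon_def mult.commute)
  next
    fix g assume "g \<in> idl_colon ?J (Var t)"
    then obtain h a where ha: "g * Var t - h * H = Var t * a" "a \<in> I" by (auto simp: idl_colon_def idl_add_def)
    then have "h * H = (g - a) * Var t" by (simp add: algebra_simps)
    then have "h * H \<in> idl.span {Var t}" by (auto simp: idl.span_singleton)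
    then have "h \<in> idl.span {Var t}" using prime_idl_mult_iff[OF pt] H(3) by blast
    then obtain h' where h': "h = h' * Var t" by (auto simp: idl.span_singleton)
    have "Var t * (g - h' * H - a) = 0" using ha(1) h' by (simp add: algebra_simps)
    then have "g - h' * H - a = 0" unfolding mpoly_mult_eq_0_iff by simp
    then have "g = h' * H + a" by (simp add: algebra_simps)
    then show "g \<in> I" using ha(2) H(1) by (simp add: idl.subspace_add[OF Is] idl.subspace_scale[OF Is])
  qed
  have plus: "idl_add (Var t) ?J = idl_add H (idl.span {Var t})"
  proof (rule equalityI)
    have s: "idl.subspace (idl_add H (idl.span {Var t}))" by (intro subspace_idl_add idl.subspace_span)
    have V: "Var t \<in> idl_add H (idl.span {Var t})"
      by (rule subsetD[OF idl_add_superset[OF idl.subspace_span] idl.span_base]) simp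
    show "idl_add (Var t) ?J \<subseteq> idl_add H (idl.span {Var t})"
      using idl_mult_left[OF s V] idl_add_self[OF idl.subspace_span, of H "{Var t}"]
      by (intro idl_add_least s V) auto
    have s': "idl.subspace (idl_add (Var t) ?J)" using subspace_idl_add[OF J] .
    show "idl_add H (idl.span {Var t}) \<subseteq> idl_add (Var t) ?J"
      using idl_add_self[OF J, of "Var t"] idl_add_self[OF tIs, of H] idl_add_superset[OF J, of "Var t"]
      by (intro idl_add_least s' idl.span_minimal) auto
  qed
  have codim_le: "2 \<le> prime_height polynomial_ring P" if "prime_idl P" "I \<subseteq> P" for P :: "('x, 'k) mpoly set"
  proof -
    have "codimension polynomial_ring I \<le> prime_height polynomial_ring P"
      unfolding codimension_def using that by (intro Inf_lower) (auto simp: primeideal_ring_of_type_algebra)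
    then show ?thesis using codim by simp
  qed
  \<comment> \<open>An infimum of a nonempty set of extended naturals is attained, so some prime
    over \<open>I\<close> has height exactly 2.\<close>
  have "\<exists>q :: ('x, 'k) mpoly set. prime_idl q \<and> I \<subseteq> q \<and> prime_height polynomial_ring q = 2"
  proof -
    let ?A = "{prime_height polynomial_ring P | P :: ('x, 'k) mpoly set. primeideal P polynomial_ring \<and> I \<subseteq> P}"
    have "?A \<noteq> {}"
    proof
      assume "?A = {}"
      then have "codimension polynomial_ring I = \<infinity>" by (simp add: codimension_def Inf_enat_def)
      then show False using codim by simp
    qed
    then have "Inf ?A \<in> ?A" unfolding Inf_enat_def by (auto intro: LeastI)
    then show ?thesis using codim unfolding codimension_def primeideal_ring_of_type_algebra by auto
  qed
  then obtain q :: "('x, 'k) mpoly set" where q: "prime_idl q" "I \<subseteq> q" "prime_height polynomial_ring q = 2" by blast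
  have q_le: "k \<le> 2" if "prime_chain Q k" "Q k = q" for Q k
  proof -
    have "enat k \<le> 2" using prime_chain_height[OF that(1)] that(2) q(3) by simp
    then show ?thesis by (simp add: numeral_eq_enat)
  qed
  have DI: "depth_ge I (?N - 2)" using depth_ge_of_perfect[OF I perf q(1,2) q_le] .
  \<comment> \<open>Ensures that \<open>?N - 2\<close> does not truncate when the reductions by
    \<open>Var t\<close> and \<open>H\<close> each cost one.\<close>
  have N2: "2 \<le> ?N"
  proof -
    have "enat (Suc 1) \<le> prime_height polynomial_ring q" using q(3) by (simp add: numeral_eq_enat)
    then obtain Q k where "Suc 1 \<le> k" "prime_chain Q k" "Q k = q" using prime_height_chain by blast
    then show ?thesis using prime_chain_length_le[of Q k] by simp
  qed
  have Vreg: "regular_mod {0} (Var t :: ('x, 'k) mpoly)" by (rule regular_mod_prime[OF prime_zero_idl]) simp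
  have "idl_add (Var t) {0} = (idl.span {Var t} :: ('x, 'k) mpoly set)"
    by (auto simp: idl_add_def idl.span_singleton)
  moreover have "Suc (Suc (?N - 2)) = ?N" using N2 by simp
  then have "depth_ge ({0} :: ('x, 'k) mpoly set) (Suc (Suc (?N - 2)))" using depth_ge_zero by simp
  from depth_ge_idl_add[OF idl.subspace_single_0 this Var_irrelevant Vreg]
  have "depth_ge (idl_add (Var t) {0 :: ('x, 'k) mpoly}) (Suc (?N - 2))" .
  ultimately have "depth_ge (idl.span {Var t :: ('x, 'k) mpoly}) (Suc (?N - 2))" by simp
  then have "depth_ge (idl_add H (idl.span {Var t})) (?N - 2)"
    using H(1,3) I(2) by (intro depth_ge_idl_add idl.subspace_span regular_mod_prime[OF pt]) auto
  then have "\<exists>ls. length ls = ?N - 2 \<and> (\<forall>l\<in>set ls. homog 1 l) \<and> regs ?J ls"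
    using DI by (intro linear_regs_extension[OF J, where t = "Var t"]) (simp_all add: colon plus)
  then obtain ls where ls: "length ls = ?N - 2" "\<And>l. l \<in> set ls \<Longrightarrow> homog 1 l" "regs ?J ls" by blast
  \<comment> \<open>If \<open>P\<close> contains \<open>Var t\<close>, the chain is 0, (t), P, where
    \<open>H\<close> separates the last two; otherwise \<open>P\<close> contains \<open>I\<close>,
    and the codimension of \<open>I\<close> applies.\<close>
  have ht2: "\<exists>Q k. 2 \<le> k \<and> prime_chain Q k \<and> Q k = P" if P: "prime_idl P" "?J \<subseteq> P" for P
  proof (cases "Var t \<in> P")
    case True
    have HP: "H \<in> P" using P(2) idl_add_self[OF tIs] by blast
    have Ps: "idl.subspace P" using P(1) by (rule prime_idl_subspace)
    have "idl.span {Var t} \<subset> P"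
      using True HP H(3) idl.span_minimal[OF _ Ps, of "{Var t}"] by blast
    then have c1: "prime_chain (case_nat (idl.span {Var t}) (\<lambda>_. P)) (Suc 0)"
      using P(1) pt by (intro prime_chain_Cons) (auto simp: prime_chain_def)
    have "{0} \<subset> (idl.span {Var t} :: ('x, 'k) mpoly set)"
      using idl.span_base[of "Var t :: ('x, 'k) mpoly" "{Var t}"] idl.span_zero[of "{Var t}"] Var_neq_0[of t] by blast
    then have "prime_chain (case_nat {0} (case_nat (idl.span {Var t}) (\<lambda>_. P))) (Suc (Suc 0))"
      by (intro prime_chain_Cons[OF c1] prime_zero_idl) simp
    then show ?thesis by (intro exI[of _ "case_nat {0} (case_nat (idl.span {Var t}) (\<lambda>_. P))"] exI[of _ 2]) (simp add: numeral_2_eq_2)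
  next
    case False
    have "I \<subseteq> P"
    proof
      fix a assume "a \<in> I"
      then have "Var t * a \<in> P" using P(2) idl_add_superset[OF tIs] by blast
      then show "a \<in> P" using False prime_idl_mult_iff[OF P(1)] by blast
    qed
    then have "enat (Suc 1) \<le> prime_height polynomial_ring P" using codim_le[OF P(1)] by (simp add: numeral_eq_enat numeral_2_eq_2)
    from prime_height_chain[OF this] show ?thesis by (simp add: numeral_2_eq_2)
  qed
  show ?thesis
  proof (rule perfect_idealI[OF hJ ls(2,3)])
    fix Q k assume Q: "prime_chain Q k" "?J \<subseteq> Q 0"
    have "prime_idl (Q 0)" using Q(1) by (simp add: prime_chain_def)
    then obtain R j where R: "2 \<le> j" "prime_chain R j" "R j = Q 0" using ht2[of "Q 0"] Q(2) by blast
    \<comment> \<open>The chain of length at least 2 ending in \<open>Q 0\<close>, followed by the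
      given one, is a chain in the whole ring.\<close>
    have "j + k \<le> ?N" using prime_chain_length_le[OF prime_chain_append[OF R(2) Q(1) R(3)]] .
    then show "k \<le> length ls" using R(1) ls(1) by simp
  qed
qed

section \<open>Cones over weighted homogeneous polynomials\<close>

lemma partial_deriv_superset:
  assumes "finite S" "keys f \<subseteq> S"
  shows "partial_deriv x f = (\<Sum>m\<in>S. single (m - single x 1)
    (of_nat (lookup m x) * lookup f m))"
  unfolding partial_deriv_def
  by (rule sum.mono_neutral_left) (use assms in \<open>auto simp: in_keys_iff\<close>)

lemma partial_deriv_single:
  "partial_deriv x (single m a)
    = single (m - single x 1) (of_nat (lookup m x) * a)"
  by (subst partial_deriv_superset[of "{m}"]) (auto split: if_splits)

lemma partial_deriv_add: "partial_deriv x (f + g) = partial_deriv x f + partial_deriv x g"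
proof -
  let ?S = "keys f \<union> keys g"
  have "keys (f + g) \<subseteq> ?S" by (rule Poly_Mapping.keys_add)
  then show ?thesis
    by (simp add: partial_deriv_superset[of ?S] lookup_add distrib_left single_add sum.distrib)
qed

lemma partial_deriv_sum: "partial_deriv x (sum f S) = (\<Sum>y\<in>S. partial_deriv x (f y))"
  by (induction S rule: infinite_finite_induct) (simp_all add: partial_deriv_add, simp_all add: partial_deriv_def)

lemma Var_mult_single: "Var x * single m a = single (m + single x 1) a"
  for a :: "'k::comm_ring_1"
  by (simp add: Var_def mult_single add.commute)

lemma minus_single_add:
  "lookup m x \<noteq> 0 \<Longrightarrow> m - single x 1 + single x 1 = m"
  for m :: "'x \<Rightarrow>\<^sub>0 nat"
  by (rule poly_mapping_eqI) (auto simp: lookup_add lookup_minus lookup_single when_def)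

text \<open>Multiplied by its variable, the derivative scales each monomial by an exponent and no
  truncated subtraction remains; the Euler identities below are compared in this form.\<close>

lemma Var_partial_deriv_single:
  "Var x * partial_deriv x (single m a) = single m (of_nat (lookup m x) * a)"
  for a :: "'k::comm_ring_1"
  by (cases "lookup m x = 0")
     (simp_all add: partial_deriv_single Var_mult_single minus_single_add del: One_nat_def)

lemma partial_deriv_Var_mult_same: "partial_deriv x (Var x * p) = p + Var x * partial_deriv x p"
proof (induction p rule: poly_mapping_add_induct)
  case (single m a)
  then show ?case
    by (simp add: Var_partial_deriv_single)
       (simp add: Var_mult_single partial_deriv_single lookup_add distrib_right single_add)
qed (simp add: distrib_left partial_deriv_add)

lemma partial_deriv_Var_mult_other:
  assumes "x \<noteq> y"
  shows "partial_deriv x (Var y * p) = Var y * partial_deriv x p"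
proof (induction p rule: poly_mapping_add_induct)
  case (single m a)
  have lk: "lookup (m + single y 1) x = lookup m x"
    using assms by (simp add: lookup_add lookup_single)
  show ?case
  proof (cases "lookup m x = 0")
    case False
    have "m + single y 1 - single x 1 = m - single x 1 + single y 1"
      using False assms
      by (intro poly_mapping_eqI) (auto simp: lookup_add lookup_minus lookup_single when_def)
    then show ?thesis unfolding Var_mult_single partial_deriv_single lk by simp
  qed (simp add: Var_mult_single partial_deriv_single lk del: One_nat_def)
qed (simp add: distrib_left partial_deriv_add)

section \<open>Homogenization and weights\<close>

definition homogenize_mon :: "nat \<Rightarrow> ('x::finite \<Rightarrow>\<^sub>0 nat) \<Rightarrow> 'x option \<Rightarrow>\<^sub>0 nat"
  where "homogenize_mon d m = (\<Sum>x\<in>UNIV. single (Some x) (lookup m x))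
    + single None (d - mon_degree m)"

lemma lookup_homogenize_mon:
  "lookup (homogenize_mon d m) (Some x) = lookup m x"
  "lookup (homogenize_mon d m) None = d - mon_degree m"
  by (simp_all add: homogenize_mon_def lookup_add lookup_sum lookup_single when_def sum.delta)

lemma homogenize_mon_eq_iff: "homogenize_mon d m = homogenize_mon d m' \<longleftrightarrow> m = m'"
  by (metis lookup_homogenize_mon(1) poly_mapping_eqI)

lemma mon_degree_homogenize_mon: "mon_degree m \<le> d \<Longrightarrow> mon_degree (homogenize_mon d m) = d"
proof -
  assume "mon_degree m \<le> d"
  moreover have "mon_degree (homogenize_mon d m) = mon_degree m + (d - mon_degree m)"
    unfolding mon_degree_def[of "homogenize_mon d m"] UNIV_option_conv
    by (subst sum.insert) (auto simp: sum.reindex lookup_homogenize_mon, simp add: mon_degree_def)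
  ultimately show ?thesis by simp
qed

lemma mon_degree_le_total_degree: "m \<in> keys f \<Longrightarrow> mon_degree m \<le> total_degree f"
  unfolding total_degree_def by (rule Max_ge) auto

lemma homogenization_eq:
  fixes f :: "('x::finite, 'k::comm_ring_1) mpoly"
  shows "homogenization f = (\<Sum>m\<in>keys f. single (homogenize_mon (total_degree f) m) (lookup f m))"
  unfolding homogenization_def homogenize_mon_def
  by (rule sum.cong) (simp_all add: Var_power prod_single_1 Const_def mult_single)

text \<open>Compare the coefficients of \<open>s\<^bsup>w\<^esup> x\<^bsup>m\<^esup>\<close> for \<open>w\<close> the weight of \<open>m\<close>.\<close>

lemma weight_eq_1:
  fixes f :: "('x::finite, 'k::comm_ring_1) mpoly"
  assumes wh: "weighted_homogeneous a f" and m: "m \<in> keys f"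
  shows "(\<Sum>x\<in>UNIV. a x * of_nat (lookup m x)) = 1"
proof -
  define w where "w = (\<lambda>m :: 'x \<Rightarrow>\<^sub>0 nat. \<Sum>x\<in>UNIV. a x * of_nat (lookup m x))"
  have pw: "single q p ^ n = single (q * of_nat n) (p ^ n)"
    for q :: rat and p :: "('x, 'k) mpoly" and n
    by (induction n) (simp_all add: mult_single algebra_simps)
  have pr: "(\<Prod>x\<in>S. single (q x) (p x)) = single (sum q S) (prod p S)"
    for q :: "'x \<Rightarrow> rat" and p :: "'x \<Rightarrow> ('x, 'k) mpoly" and S
    by (induction S rule: infinite_finite_induct) (simp_all add: mult_single)
  have "(\<Sum>m\<in>keys f. single (w m) (single m (lookup f m)))
    = subst_vars (\<lambda>c. single 0 (Const c)) (\<lambda>x. single (a x) (Var x)) f"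
    unfolding subst_vars_def pw pr prod_Var_power
    by (rule sum.cong) (simp_all add: mult_single w_def flip: single_Const_mult)
  also have "\<dots> = single 1 f" using wh by (simp add: weighted_homogeneous_def)
  finally have eq: "(\<Sum>m\<in>keys f. single (w m) (single m (lookup f m)))
    = single 1 f" .
  have "lookup (lookup (single 1 f) (w m)) m
    = (\<Sum>m'\<in>keys f. if m' = m then lookup f m else 0)"
    unfolding eq[symmetric] lookup_sum by (rule sum.cong) (auto simp: lookup_single when_def)
  also have "\<dots> = lookup f m" using m by simp
  finally have "w m = 1" using m by (auto simp: lookup_single when_def in_keys_iff split: if_splits)
  then show ?thesis by (simp add: w_def)
qed

theorem proposition2p8:
  fixes f :: "('n::finite, 'k::{alg_closed_field, field_char_0}) mpoly"
    and a :: "'n \<Rightarrow> rat"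
    and F G :: "('n option, 'k) mpoly"
  defines "S \<equiv> (polynomial_ring :: ('n option, 'k) mpoly ring)"
  defines "I\<^sub>F \<equiv> genideal S (range (\<lambda>i. partial_deriv (Some i) F))"
  assumes "weighted_homogeneous a f"
    and "\<not> homogeneous f"
    and "G = cone f"
    and "G = Var None * F"
    and "perfect_ideal S I\<^sub>F"
    and "codimension S I\<^sub>F = 2"
  shows "perfect_ideal S (gradient_ideal G)"
proof -
  define d where "d = total_degree f"
  define mo :: "('n \<Rightarrow>\<^sub>0 nat) \<Rightarrow> 'n option \<Rightarrow>\<^sub>0 nat" where "mo = homogenize_mon d"
  have "Var None * (F - homogenization f) = 0" using assms(5,6) by (simp add: cone_def right_diff_distrib)
  then have "F = homogenization f" using mpoly_mult_eq_0_iff[of "Var None" "F - homogenization f"] by simp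
  then have F: "F = (\<Sum>m\<in>keys f. single (mo m) (lookup f m))"
    by (simp add: homogenization_eq mo_def d_def)
  have deg_le_d: "mon_degree m \<le> d" if "m \<in> keys f" for m
    using mon_degree_le_total_degree[OF that] by (simp add: d_def)
  have a_le: "a x \<le> 1 / 2" for x using assms(3) by (simp add: weighted_homogeneous_def)
  \<comment> \<open>A total weight of 1 with all weights at most 1/2 takes at least two factors.
    Hence \<open>2 \<le> d\<close>, the derivatives of \<open>F\<close> have no constant term, and
    \<open>I\<close> lies in the irrelevant ideal.\<close>
  have deg_ge: "2 \<le> mon_degree m" if m: "m \<in> keys f" for m
  proof -
    have "1 = (\<Sum>x\<in>UNIV. a x * of_nat (lookup m x))" using weight_eq_1[OF assms(3) m] by simp
    also have "\<dots> \<le> (\<Sum>x\<in>UNIV. 1 / 2 * of_nat (lookup m x))"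
      by (intro sum_mono mult_right_mono a_le) simp
    also have "\<dots> = of_nat (mon_degree m) / 2" by (simp add: mon_degree_def sum_divide_distrib)
    finally have "(2 :: rat) \<le> of_nat (mon_degree m)" by simp
    then show ?thesis by (metis of_nat_le_iff of_nat_numeral)
  qed
  have "keys f \<noteq> {}" using assms(4) by (auto simp: homogeneous_def)
  then have "\<exists>m\<in>keys f. mon_degree m = d"
  proof -
    \<comment> \<open>The maximum in \<open>total_degree\<close> includes 0; as all monomials of
      \<open>f\<close> have degree at least 2, it is nevertheless attained by one of them.\<close>
    have "d \<in> insert 0 (mon_degree ` keys f)" unfolding d_def total_degree_def by (rule Max_in) auto
    moreover obtain m where "m \<in> keys f" using \<open>keys f \<noteq> {}\<close> by blast
    ultimately show ?thesis using deg_ge[of m] deg_le_d[of m] by auto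
  qed
  then obtain m0 where m0: "m0 \<in> keys f" "mon_degree m0 = d" by blast
  have d2: "2 \<le> d" using deg_ge[OF m0(1)] m0(2) by simp
  have mo_deg: "mon_degree (mo m) = d" if "m \<in> keys f" for m
    using mon_degree_homogenize_mon[OF deg_le_d[OF that]] by (simp add: mo_def)
  have lk_mo: "lookup (mo m) (Some x) = lookup m x"
    "lookup (mo m) None = d - mon_degree m" for m x
    by (simp_all add: mo_def lookup_homogenize_mon)
  define I where "I = idl.span (range (\<lambda>i. partial_deriv (Some i) F))"
  have IF: "I\<^sub>F = I" unfolding I\<^sub>F_def S_def I_def by (rule genideal_ring_of_type_algebra)
  have dF_homog: "homog (d - 1) (partial_deriv (Some i) F)" for i
    unfolding F partial_deriv_sum partial_deriv_single lk_mo
  proof (rule homog_sum)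
    fix m assume m: "m \<in> keys f"
    show "homog (d - 1) (single (mo m - single (Some i) 1)
      (of_nat (lookup m i) * lookup f m))"
    proof (cases "lookup m i = 0")
      case False
      then have "mo m - single (Some i) 1 + single (Some i) 1 = mo m"
        by (intro minus_single_add) (simp add: lk_mo)
      then have "mon_degree (mo m - single (Some i) 1) + 1 = d"
        using mo_deg[OF m] by (metis mon_degree_add mon_degree_single)
      then have "mon_degree (mo m - single (Some i) 1) = d - 1" by simp
      then show ?thesis using homog_single[of "mo m - single (Some i) 1"] by metis
    qed simp
  qed
  have hI: "homog_idl I" unfolding I_def using dF_homog by (intro homog_idl_span) auto
  have Is: "idl.subspace I" by (simp add: I_def)
  have dF_I: "partial_deriv (Some i) F \<in> I" for i by (simp add: I_def idl.span_base)
  have "partial_deriv (Some i) F \<in> irrelevant_idl" for i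
    using dF_homog[of i] d2 by (force simp: homog_def irrelevant_idl_def in_keys_iff)
  then have I_irr: "I \<subseteq> irrelevant_idl" unfolding I_def by (intro idl.span_minimal subspace_irrelevant_idl) auto
  have D: "Var x * partial_deriv x F
    = (\<Sum>m\<in>keys f. single (mo m) (of_nat (lookup (mo m) x) * lookup f m))" for x
    unfolding F partial_deriv_sum sum_distrib_left Var_partial_deriv_single ..
  \<comment> \<open>The weighted Euler formula: each monomial is multiplied by its weight, which is
    1, and homogenizing leaves the exponents of the \<open>x\<close>-variables unchanged.\<close>
  have "(\<Sum>i\<in>UNIV. Const (of_rat (a i)) * (Var (Some i) * partial_deriv (Some i) F))
    = (\<Sum>m\<in>keys f. \<Sum>i\<in>UNIV. single (mo m)
        (of_rat (a i) * of_nat (lookup m i) * lookup f m))"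
    unfolding D lk_mo sum_distrib_left Const_def mult_single
    by (subst sum.swap) (simp add: mult.assoc)
  also have "\<dots> = F"
    unfolding F
  proof (rule sum.cong[OF refl])
    fix m assume m: "m \<in> keys f"
    have "(\<Sum>i\<in>UNIV. of_rat (a i) * of_nat (lookup m i)) = (of_rat (\<Sum>i\<in>UNIV. a i * of_nat (lookup m i)) :: 'k)"
      by (simp add: of_rat_sum of_rat_mult)
    also have "\<dots> = 1" using weight_eq_1[OF assms(3) m] by simp
    finally have w: "(\<Sum>i\<in>UNIV. of_rat (a i) * of_nat (lookup m i)) = (1 :: 'k)" .
    have ss: "(\<Sum>i\<in>B. single n (c i)) = single n (\<Sum>i\<in>B. c i)"
      for B :: "'n set" and n :: "'n option \<Rightarrow>\<^sub>0 nat" and c :: "'n \<Rightarrow> 'k"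
      by (induction B rule: infinite_finite_induct) (simp_all add: single_add)
    show "(\<Sum>i\<in>UNIV. single (mo m) (of_rat (a i) * of_nat (lookup m i) * lookup f m))
      = single (mo m) (lookup f m)"
      unfolding ss sum_distrib_right[symmetric] w by simp
  qed
  finally have euler_w: "F = (\<Sum>i\<in>UNIV. Const (of_rat (a i)) * (Var (Some i) * partial_deriv (Some i) F))" ..
  have FI: "F \<in> I"
    by (subst euler_w) (intro idl.subspace_sum[OF Is] idl.subspace_scale[OF Is] dF_I)
  \<comment> \<open>The derivative of \<open>G\<close> with respect to \<open>t\<close>, by the
    product rule.\<close>
  define H where "H = F + Var None * partial_deriv None F"
  have H_eq: "H = (\<Sum>m\<in>keys f. single (mo m) (of_nat (Suc (d - mon_degree m)) * lookup f m))"
    unfolding H_def D lk_mo by (simp add: F sum.distrib[symmetric] distrib_right single_add)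
  \<comment> \<open>Euler's formula for the form \<open>F\<close> of degree \<open>d\<close>,
    \<open>t\<close> included, in which \<open>H = F + t F_t\<close> absorbs the
    \<open>t\<close>-derivative; this accounts for the factor \<open>Suc d\<close>.\<close>
  have "Const (of_nat (Suc d)) * F - H = (\<Sum>i\<in>UNIV. Var (Some i) * partial_deriv (Some i) F)"
  proof -
    have "Const (of_nat (Suc d)) * F - H = (\<Sum>m\<in>keys f. single (mo m) (of_nat (mon_degree m) * lookup f m))"
      unfolding H_eq F sum_distrib_left sum_subtractf[symmetric] Const_def mult_single
      by (rule sum.cong) (simp_all add: single_diff[symmetric] left_diff_distrib[symmetric] of_nat_diff deg_le_d)
    also have "\<dots> = (\<Sum>m\<in>keys f. \<Sum>i\<in>UNIV. single (mo m) (of_nat (lookup m i) * lookup f m))"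
    proof (rule sum.cong[OF refl])
      fix m
      have ss: "single n (\<Sum>i\<in>B. c i) = (\<Sum>i\<in>B. single n (c i))"
        for B :: "'n set" and n :: "'n option \<Rightarrow>\<^sub>0 nat" and c :: "'n \<Rightarrow> 'k"
        by (induction B rule: infinite_finite_induct) (simp_all add: single_add)
      show "single (mo m) (of_nat (mon_degree m) * lookup f m)
        = (\<Sum>i\<in>UNIV. single (mo m) (of_nat (lookup m i) * lookup f m))"
        unfolding mon_degree_def of_nat_sum sum_distrib_right ss ..
    qed
    also have "\<dots> = (\<Sum>i\<in>UNIV. Var (Some i) * partial_deriv (Some i) F)"
      unfolding D lk_mo by (rule sum.swap)
    finally show ?thesis .
  qed
  then have "H = Const (of_nat (Suc d)) * F - (\<Sum>i\<in>UNIV. Var (Some i) * partial_deriv (Some i) F)"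
    by (simp add: algebra_simps)
  then have HI: "H \<in> I"
    by (simp only:) (intro idl.subspace_diff[OF Is] idl.subspace_sum[OF Is] idl.subspace_scale[OF Is] dF_I FI)
  have H_homog: "homog d H"
    unfolding H_eq
  proof (rule homog_sum)
    fix m assume "m \<in> keys f"
    then show "homog d (single (mo m) (of_nat (Suc (d - mon_degree m)) * lookup f m))"
      using homog_single[of "mo m"] mo_deg by metis
  qed
  have H_t: "H \<notin> idl.span {Var None}"
  proof
    assume "H \<in> idl.span {Var None}"
    then obtain k where k: "H = k * Var None" by (auto simp: idl.span_singleton)
    \<comment> \<open>A monomial of \<open>f\<close> of top degree stays free of \<open>t\<close>,
      and its coefficient in \<open>H\<close> is that in \<open>f\<close>, the factor
      \<open>Suc (d - mon_degree m0)\<close> being 1.\<close>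
    have "lookup H (mo m0) = (\<Sum>m\<in>keys f. if m = m0 then lookup f m0 else 0)"
      unfolding H_eq lookup_sum
      by (rule sum.cong) (auto simp: lookup_single when_def mo_def homogenize_mon_eq_iff m0(2))
    also have "\<dots> \<noteq> 0" using m0(1) by (simp add: in_keys_iff)
    finally have "mo m0 \<in> keys (k * Var None)" by (simp add: in_keys_iff k)
    then obtain p q where "mo m0 = p + q" "q \<in> keys (Var None :: ('n option, 'k) mpoly)"
      using keys_mult[of k "Var None"] by blast
    then have "lookup (mo m0) None \<noteq> 0" by (auto simp: Var_def lookup_add lookup_single)
    then show False by (simp add: lk_mo m0(2))
  qed
  have "gradient_ideal G = idl_add H ((*) (Var None) ` I)"
  proof -
    have "range (\<lambda>x. partial_deriv x G) = insert H ((*) (Var None) ` range (\<lambda>i. partial_deriv (Some i) F))"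
      unfolding UNIV_option_conv assms(6) H_def
      by (auto simp: partial_deriv_Var_mult_same partial_deriv_Var_mult_other image_image)
    \<comment> \<open>Multiplication by \<open>t\<close> is linear over the ring, so it commutes
      with forming spans.\<close>
    moreover have "idl.span ((*) (Var None) ` range (\<lambda>i. partial_deriv (Some i) F)) = (*) (Var None) ` I"
    proof -
      interpret tm: module_hom "(*)" "(*)" "(*) (Var None :: ('n option, 'k) mpoly)"
        by unfold_locales (simp_all add: distrib_left mult.left_commute)
      show ?thesis unfolding I_def by (rule tm.span_image)
    qed
    ultimately show ?thesis
      unfolding gradient_ideal_def genideal_ring_of_type_algebra
      by (simp add: idl.span_insert idl_add_def)
  qed
  moreover have "perfect_ideal polynomial_ring (idl_add H ((*) (Var None) ` I))"
    using assms(7,8) unfolding IF S_def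
    by (intro perfect_extension[OF hI I_irr _ _ HI H_homog H_t])
  ultimately show ?thesis by (simp add: S_def)
qed

end
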